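(* Let $r\in\{3,5,7\}$ and let $q\in\mathbb{C}$ be a primitive $r$-th root of unity. The noncommutative de Rham cohomologies $H^i$ of the 4-dimensional differential calculus on the reduced quantum group $\mathcal{A}=\mathbb{C}_q[SL_2]$ satisfy $\dim H^i=\dim\Lambda^i$ in every degree, i.e. $\dim H^0,\dots,\dim H^4=1,4,6,4,1$. Moreover, writing $e_{ij\cdots}=e_i\wedge e_j\wedge\cdots$, bases are given by the classes of the following closed forms. $H^2$: $m_1=e_{bd}ac^{r-1}$, $m_2=e_{ab}ac^{r-1}$, $m_3=e_{ac}a^{r-1}b^{r-1}$, $m_4=e_{cd}a^{r-1}b^{r-1}$, $m_5=(e_{ac}-e_{cd})a^{r-1}c-e_{ad}$, $m_6=e_{bd}ab^{r-1}c^{r-2}+q^4e_{cd}a^{r-1}b^{r-2}c^{r-1}$. $H^3$: $\Theta=e_{bcd}b^{r-1}c^{r-1}$, $h_1^*=e_{abd}ac^{r-1}$, $h_2^*=e_{acd}a^{r-1}b^{r-1}$, $s=e_{abd}ab^{r-1}c^{r-2}+q^4e_{acd}a^{r-1}b^{r-2}c^{r-1}$. $H^4$: $e_{abcd}b^{r-1}c^{r-1}$.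
   Context: Put $\mu=1-q^{-2}$. $\mathcal{A}$ is the unital $\mathbb{C}$-algebra generated by $a,b,c,d$ with relations $ba=qab$, $ca=qac$, $db=qbd$, $dc=qcd$, $cb=bc$, $da-ad=q\mu bc$, $ad-q^{-1}bc=1$, $a^r=d^r=1$, $b^r=c^r=0$. It has basis $\{a^mb^nc^k\}_{0\le m,n,k\le r-1}$. $\Lambda$ is the graded algebra generated by degree-1 elements $e_a,e_b,e_c,e_d$ with relations: $e_b,e_c,e_d$ pairwise anticommute and square to zero; $e_a\wedge e_a=\mu e_b\wedge e_c$; $e_a\wedge e_d+e_d\wedge e_a+\mu e_b\wedge e_c=0$; $e_a\wedge e_b+q^2e_b\wedge e_a-\mu e_b\wedge e_d=0$; $e_c\wedge e_a+q^2e_a\wedge e_c+\mu e_c\wedge e_d=0$. It has dimensions $1,4,6,4,1$ in degrees $0,\dots,4$. The exterior algebra $\Omega=\Lambda\otimes\mathcal{A}$ is the free right $\mathcal{A}$-module on $\Lambda$, with algebra structure given by those of $\Lambda$, $\mathcal{A}$ and the following cross relations, where $(u,v)$ is either $(a,c)$ or $(b,d)$: $ve_b=e_bv$, $ue_c=e_cu$, $ue_d=q^{-1}e_du$, $ve_d=qe_dv$, $ue_b=e_bu+q\mu e_dv$, $ve_c=e_cv+q\mu e_du$, $ve_a=q^{-1}e_av+\mu e_bu$, $ue_a=qe_au+\mu e_cv+q\mu^2e_du$. The exterior derivative is $\mathrm{d}\omega=-(\theta\wedge\omega-(-1)^{|\omega|}\omega\wedge\theta)$ with $\theta=e_a+e_d$;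 it satisfies $\mathrm{d}^2=0$ and the graded Leibniz rule. $H^i$ is the degree-$i$ cohomology of $(\Omega,\mathrm{d})$. *)

theory Defs
  imports
    Complex_Main
    "HOL-Library.Poly_Mapping"
    "HOL-Library.FuncSet"
    "HOL-Algebra.Algebra"
    "HOL-Algebra.Algebraic_Closure_Type"
begin

section \<open>Complex vector spaces with carriers: bases, dimension, quotients\<close>

text \<open>Complex vector spaces are records of type \<open>(complex, 'v) module\<close>. A list is a basis
  if every vector has exactly one coordinate family with respect to it.\<close>

definition is_basis :: "(complex, 'v) module \<Rightarrow> 'v list \<Rightarrow> bool" where
  "is_basis V vs \<longleftrightarrow>
     set vs \<subseteq> carrier V \<and>
     (\<forall>v\<in>carrier V. \<exists>!c. c \<in> {..<length vs} \<rightarrow>\<^sub>E (UNIV :: complex set) \<and>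
        v = (\<Oplus>\<^bsub>V\<^esub>i\<in>{..<length vs}. c i \<odot>\<^bsub>V\<^esub> (vs ! i)))"

definition has_dim :: "(complex, 'v) module \<Rightarrow> nat \<Rightarrow> bool" where
  "has_dim V n \<longleftrightarrow> (\<exists>vs. length vs = n \<and> is_basis V vs)"

text \<open>The quotient by \<open>W\<close>, with cosets as elements. It is used both for an algebra modulo a
  two-sided ideal and for a vector space modulo a subspace; in the second case the
  multiplicative components of the record carry no meaning.\<close>

definition quot_module :: "('k, 'v) module \<Rightarrow> 'v set \<Rightarrow> ('k, 'v set) module" where
  "quot_module V W =
     ring.extend (V Quot W) (module.fields (\<lambda>c S. \<Union>x\<in>S. W +>\<^bsub>V\<^esub> (c \<odot>\<^bsub>V\<^esub> x)))"


section \<open>Complex algebras given by generators and relations\<close>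

text \<open>The free monoid on \<open>'g\<close>, written additively so that the convolution product of
  finitely supported functions on it is the product of the free algebra.\<close>

datatype 'g fword = FWord (letters: "'g list")

instantiation fword :: (type) monoid_add
begin

definition zero_fword :: "'a fword" where
  "zero_fword = FWord []"

definition plus_fword :: "'a fword \<Rightarrow> 'a fword \<Rightarrow> 'a fword" where
  "plus_fword u v = FWord (letters u @ letters v)"

instance
  by standard (simp_all add: zero_fword_def plus_fword_def)

end

type_synonym 'g free_alg = "'g fword \<Rightarrow>\<^sub>0 complex"

definition gen :: "'g \<Rightarrow> 'g free_alg" where
  "gen g = Poly_Mapping.single (FWord [g]) 1"

definition scal :: "complex \<Rightarrow> 'g free_alg" where
  "scal c = Poly_Mapping.single 0 c"

definition free_algebra :: "(complex, 'g free_alg) module" where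
  "free_algebra = ring.extend ring_of_type_algebra (module.fields (\<lambda>c f. scal c * f))"

definition presented_algebra :: "'g free_alg set \<Rightarrow> (complex, 'g free_alg set) module" where
  "presented_algebra R = quot_module free_algebra (Idl\<^bsub>free_algebra\<^esub> R)"

definition presented_class :: "'g free_alg set \<Rightarrow> 'g free_alg \<Rightarrow> 'g free_alg set" where
  "presented_class R f = (Idl\<^bsub>free_algebra\<^esub> R) +>\<^bsub>free_algebra\<^esub> f"

text \<open>The component of degree \<open>i\<close>, where the generators satisfying \<open>P\<close> have degree 1 and all
  others degree 0.\<close>

definition graded_part ::
    "('g \<Rightarrow> bool) \<Rightarrow> 'g free_alg set \<Rightarrow> nat \<Rightarrow> (complex, 'g free_alg set) module" where
  "graded_part P R i = (presented_algebra R)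
     \<lparr>carrier := presented_class R `
        {f. \<forall>w\<in>Poly_Mapping.keys f. length (filter P (letters w)) = i}\<rparr>"


section \<open>The reduced quantum group and its 4-dimensional calculus\<close>

datatype idx = A | B | C | D

datatype calc_gen = Coord idx | Form idx

fun is_form :: "calc_gen \<Rightarrow> bool" where
  "is_form (Coord i) = False"
| "is_form (Form i) = True"

definition mu :: "complex \<Rightarrow> complex" where
  "mu q = 1 - inverse q ^ 2"

text \<open>Relations of the form \<open>lhs = rhs\<close> are encoded as \<open>lhs - rhs\<close>.\<close>

definition coord_rels :: "complex \<Rightarrow> nat \<Rightarrow> (idx \<Rightarrow> 'g free_alg) \<Rightarrow> 'g free_alg set" where
  "coord_rels q r x = (let a = x A; b = x B; c = x C; d = x D in
     {b * a - scal q * a * b,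
      c * a - scal q * a * c,
      d * b - scal q * b * d,
      d * c - scal q * c * d,
      c * b - b * c,
      d * a - a * d - scal (q * mu q) * b * c,
      a * d - scal (inverse q) * b * c - 1,
      a ^ r - 1, d ^ r - 1, b ^ r, c ^ r})"

definition form_rels :: "complex \<Rightarrow> (idx \<Rightarrow> 'g free_alg) \<Rightarrow> 'g free_alg set" where
  "form_rels q e =
     {e i * e j + e j * e i |i j. i \<in> {B, C, D} \<and> j \<in> {B, C, D} \<and> i \<noteq> j} \<union>
     {e i * e i |i. i \<in> {B, C, D}} \<union>
     {e A * e A - scal (mu q) * e B * e C,
      e A * e D + e D * e A + scal (mu q) * e B * e C,
      e A * e B + scal (q ^ 2) * e B * e A - scal (mu q) * e B * e D,
      e C * e A + scal (q ^ 2) * e A * e C + scal (mu q) * e C * e D}"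

definition cross_rels ::
    "complex \<Rightarrow> (idx \<Rightarrow> 'g free_alg) \<Rightarrow> (idx \<Rightarrow> 'g free_alg) \<Rightarrow> 'g free_alg set" where
  "cross_rels q x e = (\<Union>(u, v)\<in>{(x A, x C), (x B, x D)}.
     {v * e B - e B * v,
      u * e C - e C * u,
      u * e D - scal (inverse q) * e D * u,
      v * e D - scal q * e D * v,
      u * e B - (e B * u + scal (q * mu q) * e D * v),
      v * e C - (e C * v + scal (q * mu q) * e D * u),
      v * e A - (scal (inverse q) * e A * v + scal (mu q) * e B * u),
      u * e A - (scal q * e A * u + scal (mu q) * e C * v + scal (q * mu q ^ 2) * e D * u)})"

definition Lambda_part :: "complex \<Rightarrow> nat \<Rightarrow> (complex, idx free_alg set) module" where
  "Lambda_part q = graded_part (\<lambda>_. True) (form_rels q gen)"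

text \<open>The algebra structure on \<open>\<Lambda> \<otimes> \<A>\<close> is the one determined by the relations of
  \<open>\<Lambda>\<close>, those of \<open>\<A>\<close>, and the cross relations, which move coordinate functions to the
  right of forms; hence it is presented by these relations taken together.\<close>

definition Omega_rels :: "complex \<Rightarrow> nat \<Rightarrow> calc_gen free_alg set" where
  "Omega_rels q r =
     coord_rels q r (\<lambda>i. gen (Coord i)) \<union>
     form_rels q (\<lambda>i. gen (Form i)) \<union>
     cross_rels q (\<lambda>i. gen (Coord i)) (\<lambda>i. gen (Form i))"

definition Omega :: "complex \<Rightarrow> nat \<Rightarrow> (complex, calc_gen free_alg set) module" where
  "Omega q r = presented_algebra (Omega_rels q r)"

definition Omega_class :: "complex \<Rightarrow> nat \<Rightarrow> calc_gen free_alg \<Rightarrow> calc_gen free_alg set" where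
  "Omega_class q r = presented_class (Omega_rels q r)"

definition Omega_part :: "complex \<Rightarrow> nat \<Rightarrow> nat \<Rightarrow> (complex, calc_gen free_alg set) module" where
  "Omega_part q r = graded_part is_form (Omega_rels q r)"

definition theta :: "complex \<Rightarrow> nat \<Rightarrow> calc_gen free_alg set" where
  "theta q r = Omega_class q r (gen (Form A) + gen (Form D))"

text \<open>The exterior derivative on forms of degree \<open>i\<close>.\<close>

definition ext_d ::
    "complex \<Rightarrow> nat \<Rightarrow> nat \<Rightarrow> calc_gen free_alg set \<Rightarrow> calc_gen free_alg set" where
  "ext_d q r i \<omega> =
     \<ominus>\<^bsub>Omega q r\<^esub> ((theta q r \<otimes>\<^bsub>Omega q r\<^esub> \<omega>) \<ominus>\<^bsub>Omega q r\<^esub>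
       ((-1) ^ i \<odot>\<^bsub>Omega q r\<^esub> (\<omega> \<otimes>\<^bsub>Omega q r\<^esub> theta q r)))"

definition closed_forms :: "complex \<Rightarrow> nat \<Rightarrow> nat \<Rightarrow> calc_gen free_alg set set" where
  "closed_forms q r i =
     {\<omega> \<in> carrier (Omega_part q r i). ext_d q r i \<omega> = \<zero>\<^bsub>Omega q r\<^esub>}"

definition exact_forms :: "complex \<Rightarrow> nat \<Rightarrow> nat \<Rightarrow> calc_gen free_alg set set" where
  "exact_forms q r i =
     (case i of 0 \<Rightarrow> {\<zero>\<^bsub>Omega q r\<^esub>} | Suc j \<Rightarrow> ext_d q r j ` carrier (Omega_part q r j))"

definition cohomology ::
    "complex \<Rightarrow> nat \<Rightarrow> nat \<Rightarrow> (complex, calc_gen free_alg set set) module" where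
  "cohomology q r i =
     quot_module ((Omega q r)\<lparr>carrier := closed_forms q r i\<rparr>) (exact_forms q r i)"

text \<open>The \<open>f\<close> in \<open>fs\<close> are representatives in the free algebra.\<close>

definition cohomology_basis ::
    "complex \<Rightarrow> nat \<Rightarrow> nat \<Rightarrow> calc_gen free_alg list \<Rightarrow> bool" where
  "cohomology_basis q r i fs \<longleftrightarrow>
     Omega_class q r ` set fs \<subseteq> closed_forms q r i \<and>
     is_basis (cohomology q r i)
       (map (\<lambda>f. exact_forms q r i +>\<^bsub>Omega q r\<^esub> Omega_class q r f) fs)"

end

theory Submission
  imports Defs "HOL-Computational_Algebra.Polynomial"
begin

text \<open>Let \<open>y = a\<^sup>-\<^sup>1 c\<close>, \<open>\<eta> = e\<^sub>d - e\<^sub>c y\<close>, \<open>\<beta> = e\<^sub>b + e\<^sub>d y\<close>, \<open>\<gamma> = e\<^sub>c\<close> and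
  \<open>\<alpha> = \<theta> - q\<^sup>-\<^sup>2 \<eta>\<close>. These four forms square to zero and pairwise commute up to a scalar, and moving a
  monomial in \<open>a, b, c\<close> past them produces few terms, so that
  \<open>d\<close> of a basis form \<open>x = \<alpha>\<^sup>i \<eta>\<^sup>j \<beta>\<^sup>k \<gamma>\<^sup>l a\<^sup>u b\<^sup>v c\<^sup>w\<close> has a term \<open>(wt x - 1) \<alpha> x\<close>,
  a \<open>q\<close>-derivative in \<open>c\<close> multiplied by \<open>\<beta>\<close>, a \<open>q\<close>-derivative in \<open>b\<close> multiplied by \<open>\<gamma>\<close>, and
  terms containing \<open>\<eta>\<close>. All of them have the same \<open>wt\<close>, hence the complex splits: where
  \<open>wt \<noteq> 1\<close> it is contracted by \<open>\<alpha>\<close>, and where \<open>wt = 1\<close> the \<open>q\<close>-derivatives cancel all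
  forms against each other except those with \<open>w = (r - 1) k\<close> and \<open>v = (r - 1) l\<close>,
  since \<open>[r]\<^sub>q = 0\<close> while \<open>[n]\<^sub>q \<noteq> 0\<close> for \<open>0 < n < r\<close>. The cancellation is triangular, which
  leaves one class for each of the 16 subsets of \<open>{\<alpha>, \<eta>, \<beta>, \<gamma>}\<close>. That the normally ordered
  words are a basis of the presented algebra is shown by an explicit representation.\<close>

section \<open>Linear operators on functions\<close>

text \<open>A presentation only bounds dimensions from above: rewriting shows that normally ordered
  words span, but neither that they are independent nor that a given form is not exact. Concrete
  operators supply this. In the given generators the cross relations mix the four forms; as
  \<open>a\<close> is invertible, multiples of \<open>a^-1 c\<close> can be subtracted until
  \<open>a\<close> acts diagonally on forms and \<open>b\<close>, \<open>c\<close> produce at most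
  four terms. The operators are therefore written in the adapted generators, where each relation is
  a check over 16 exterior patterns, and the original generators are combinations of these.
  Independence of the words then needs no inverse change of basis: words and adapted forms have the
  same finite index set, and the adapted forms lie in the span of the words.

  The obstacle to the cancellation is the part of the derivative with \<eta>. It makes \<beta>
  \<gamma> b^(r-1) c^(r-1) fail to be closed; this form has to be corrected by two terms with
  \<eta>, and that is the origin of the classes m_6 and s and of the constant q^4.\<close>

typedef 'i lop =
  "{T :: ('i \<Rightarrow> complex) \<Rightarrow> 'i \<Rightarrow> complex.
      \<forall>c f g. T (\<lambda>i. c * f i + g i) = (\<lambda>i. c * T f i + T g i)}"
  morphisms app Lop
  by (rule exI[of _ id]) simp

setup_lifting type_definition_lop

lemma lop_eqI: "(\<And>f i. app S f i = app T f i) \<Longrightarrow> S = T"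
  by (metis app_inject ext)

instantiation lop :: (type) ring_1
begin

lift_definition zero_lop :: "'a lop" is "\<lambda>f i. 0" by simp
lift_definition one_lop :: "'a lop" is "\<lambda>f. f" by simp
lift_definition plus_lop :: "'a lop \<Rightarrow> 'a lop \<Rightarrow> 'a lop" is "\<lambda>S T f i. S f i + T f i"
  by (simp add: algebra_simps)
lift_definition minus_lop :: "'a lop \<Rightarrow> 'a lop \<Rightarrow> 'a lop" is "\<lambda>S T f i. S f i - T f i"
  by (simp add: algebra_simps)
lift_definition uminus_lop :: "'a lop \<Rightarrow> 'a lop" is "\<lambda>S f i. - S f i"
  by (simp add: algebra_simps)
text \<open>Composition is reversed because the operators of the model are transposed left
  multiplications, \<open>(S f) v = f (S v)\<close>.\<close>
lift_definition times_lop :: "'a lop \<Rightarrow> 'a lop \<Rightarrow> 'a lop" is "\<lambda>S T f. T (S f)"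
  by simp

lemma lop_add_app: "app T (\<lambda>i. f i + g i) = (\<lambda>i. app T f i + app T g i)"
  using app[of T] by (auto dest: spec[of _ 1])

instance
proof
  fix a b c :: "'a lop"
  show "(a + b) * c = a * c + b * c"
    by (rule lop_eqI) (simp add: times_lop.rep_eq plus_lop.rep_eq lop_add_app)
  show "(0::'a lop) \<noteq> 1"
  proof
    assume "(0::'a lop) = 1"
    then have "app (0::'a lop) (\<lambda>_. 1) undefined = app 1 (\<lambda>_. 1) undefined" by simp
    then show False by (simp add: zero_lop.rep_eq one_lop.rep_eq)
  qed
qed (rule lop_eqI, simp add: times_lop.rep_eq plus_lop.rep_eq zero_lop.rep_eq one_lop.rep_eq
    minus_lop.rep_eq uminus_lop.rep_eq)+

end

lift_definition cscale :: "complex \<Rightarrow> 'i lop \<Rightarrow> 'i lop" is "\<lambda>c S f i. c * S f i"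
  by (simp add: algebra_simps)

lemma lop_scale_app: "app T (\<lambda>i. c * f i) = (\<lambda>i. c * app T f i)"
proof -
  have "\<forall>g. app T (\<lambda>i. c * f i + g i) = (\<lambda>i. c * app T f i + app T g i)"
    using app[of T] by blast
  moreover have "app T (\<lambda>i. 0) = (\<lambda>i. 0)"
    using lop_add_app[of T "\<lambda>i. 0" "\<lambda>i. 0"] by (simp add: fun_eq_iff)
  ultimately show ?thesis
    by (auto dest: spec[of _ "\<lambda>i. 0"])
qed

lemmas lop_app = times_lop.rep_eq plus_lop.rep_eq zero_lop.rep_eq one_lop.rep_eq
    minus_lop.rep_eq uminus_lop.rep_eq cscale.rep_eq

text \<open>Serves both for operators and for the free algebra, so that spans on the two sides of
  the evaluation map are handled alike.\<close>

locale complex_algebra = vector_space scale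
  for scale :: "complex \<Rightarrow> 'e::ring_1 \<Rightarrow> 'e" (infixr \<open>*\<^sub>C\<close> 75) +
  assumes scale_mult_left: "(c *\<^sub>C x) * y = c *\<^sub>C (x * y)"
    and scale_mult_right: "x * (c *\<^sub>C y) = c *\<^sub>C (x * y)"

interpretation lop: complex_algebra "cscale :: _ \<Rightarrow> 'i lop \<Rightarrow> _"
  by unfold_locales
    (rule lop_eqI, simp add: lop_app lop_scale_app algebra_simps)+

section \<open>A faithful model of the calculus\<close>

text \<open>The cell \<open>(i, j, k, l, x, n, m)\<close> stands for
  \<open>\<alpha>\<^sup>i \<eta>\<^sup>j \<beta>\<^sup>k \<gamma>\<^sup>l a\<^sup>u b\<^sup>n c\<^sup>m\<close> with \<open>x = q\<^sup>u\<close>. Letting \<open>x\<close> range over all of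
  \<open>\<complex>\<close> and \<open>n, m\<close> over all of \<open>\<nat>\<close> makes the relations pointwise
  identities without reduction of exponents modulo \<open>r\<close>; the factor \<open>chi\<close> is what enforces
  \<open>b\<^sup>r = c\<^sup>r = 0\<close>.\<close>

type_synonym cell = "bool \<times> bool \<times> bool \<times> bool \<times> complex \<times> nat \<times> nat"

definition chi :: "nat \<Rightarrow> nat \<Rightarrow> complex" where
  "chi r n = (if r dvd n then 0 else 1)"

definition fac :: "bool \<Rightarrow> complex \<Rightarrow> complex" where "fac i c = (if i then c else 1)"

lift_definition op_a :: "complex \<Rightarrow> cell lop" is
  "\<lambda>q f (i, j, k, l, x, n, m). fac i q * fac j (inverse q) * f (i, j, k, l, q * x, n, m)"
  by (auto simp: algebra_simps)

lift_definition op_ai :: "complex \<Rightarrow> cell lop" is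
  "\<lambda>q f (i, j, k, l, x, n, m). fac i (inverse q) * fac j q * f (i, j, k, l, inverse q * x, n, m)"
  by (auto simp: algebra_simps)

text \<open>The first term lets \<open>b\<close> reach the power of \<open>b\<close>; the others are
  the corrections from passing \<alpha> and \<beta>. The factor \<open>inverse q ^ 2\<close> in the
  third, present when \<gamma> occurs, merges two contributions: \<open>q * mu\<close> from creating
  \<eta> directly, and \<open>- q * mu^2\<close> from the \<open>c\<close> of the other \<beta>
  correction meeting \<gamma>. Their sum is \<open>q * mu * (1 - mu)\<close>.\<close>

lift_definition op_b :: "complex \<Rightarrow> nat \<Rightarrow> cell lop" is
  "\<lambda>q r f (i, j, k, l, x, n, m).
     fac i q * fac j (inverse q) * x * chi r (Suc n) * f (i, j, k, l, x, Suc n, m)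
   + of_bool (i \<and> \<not> l) * mu q * fac j (- inverse q) * fac k (-1) * f (False, j, k, True, inverse q * x, n, m)
   + of_bool (k \<and> \<not> j) * q * mu q * fac i q * fac l (inverse q ^ 2) * f (i, True, False, l, inverse q * x, n, m)
   + of_bool (k \<and> \<not> l) * mu q * fac i q * fac j (inverse q) * x * chi r (Suc m) *
       f (i, j, False, True, inverse q ^ 2 * x, n, Suc m)"
  by (auto simp: algebra_simps)

lift_definition op_c :: "complex \<Rightarrow> nat \<Rightarrow> cell lop" is
  "\<lambda>q r f (i, j, k, l, x, n, m).
     fac i (inverse q) * fac j (inverse q) * fac l (q^2) * x * chi r (Suc m) * f (i, j, k, l, x, n, Suc m)
   + of_bool (i \<and> \<not> k) * mu q * fac j (- inverse q) * f (False, j, True, l, q * x, n, m)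
   + of_bool (l \<and> \<not> j) * q * mu q * fac i (inverse q) * fac k (-1) * f (i, True, k, False, q * x, n, m)"
  by (auto simp: algebra_simps)

lift_definition op_al :: "cell lop" is
  "\<lambda>f (i, j, k, l, z). of_bool (\<not> i) * f (True, j, k, l, z)"
  by (auto simp: algebra_simps)

lift_definition op_et :: "cell lop" is
  "\<lambda>f (i, j, k, l, z). of_bool (\<not> j) * fac i (-1) * f (i, True, k, l, z)"
  by (auto simp: algebra_simps)

lift_definition op_be :: "complex \<Rightarrow> cell lop" is
  "\<lambda>q f (i, j, k, l, z). of_bool (\<not> k) * fac i (- (inverse q ^ 2)) * fac j (-1) * f (i, j, True, l, z)"
  by (auto simp: algebra_simps)

lift_definition op_ga :: "complex \<Rightarrow> cell lop" is
  "\<lambda>q f (i, j, k, l, z). of_bool (\<not> l) * fac i (- (q ^ 2)) * fac j (- (inverse q ^ 2)) * fac k (-1) *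
     f (i, j, k, True, z)"
  by (auto simp: algebra_simps)

lemmas op_app = op_a.rep_eq op_ai.rep_eq op_b.rep_eq op_c.rep_eq op_al.rep_eq op_et.rep_eq
  op_be.rep_eq op_ga.rep_eq

lemma cell_eqI:
  assumes "\<And>f i j k l x n m. app S f (i, j, k, l, x, n, m) = app T f (i, j, k, l, x, n, m)"
  shows "S = T"
  by (rule lop_eqI) (use assms in auto)

section \<open>Arithmetic at a root of unity and q-integers\<close>

locale root_calculus =
  fixes q :: complex and r :: nat
  assumes q_root: "q ^ r = 1" and r_ge: "3 \<le> r" and r_odd: "odd r"
    and q_prim: "0 < k \<Longrightarrow> k < r \<Longrightarrow> q ^ k \<noteq> 1"
begin

definition p :: complex where "p = inverse q"
abbreviation "\<mu> \<equiv> mu q"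
abbreviation "a \<equiv> op_a q"
abbreviation "ai \<equiv> op_ai q"
abbreviation "b \<equiv> op_b q r"
abbreviation "c \<equiv> op_c q r"
abbreviation "al \<equiv> op_al"
abbreviation "et \<equiv> op_et"
abbreviation "be \<equiv> op_be q"
abbreviation "ga \<equiv> op_ga q"
abbreviation sc (infixr \<open>\<bullet>\<close> 73) where "sc \<equiv> cscale"

lemma q_nz: "q \<noteq> 0"
  using q_root r_ge by (auto simp: zero_power)
lemma qp: "q * p = 1" "p * q = 1" "q * (p * z) = z" "p * (q * z) = z"
  using q_nz by (simp_all add: p_def flip: mult.assoc)

lemma mu_eq: "\<mu> = 1 - p\<^sup>2"
  by (simp add: mu_def p_def)

lemma pow_eq_1_iff: "q ^ k = 1 \<longleftrightarrow> r dvd k"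
proof
  assume "q ^ k = 1"
  moreover have "q ^ k = (q ^ r) ^ (k div r) * q ^ (k mod r)"
    by (simp flip: power_mult power_add)
  ultimately have "q ^ (k mod r) = 1" using q_root by simp
  then show "r dvd k" using q_prim[of "k mod r"] r_ge by (auto simp: dvd_eq_mod_eq_0)
qed (auto simp: power_mult q_root)

lemma pow_mod: "q ^ (k mod r) = q ^ k"
proof -
  have "q ^ k = (q ^ r) ^ (k div r) * q ^ (k mod r)"
    by (simp flip: power_mult power_add)
  then show ?thesis using q_root by simp
qed

lemma mu_nz: "\<mu> \<noteq> 0"
proof
  assume "\<mu> = 0"
  then have "q ^ 2 = 1" by (simp add: mu_def field_simps q_nz)
  then show False using q_prim[of 2] r_ge by simp
qed

text \<open>The symmetric q-integer, the coefficient in both q-derivatives.\<close>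

definition qint :: "nat \<Rightarrow> complex" where "qint k = (q ^ k - p ^ k) / (q - p)"

lemma q_minus_p: "q - p \<noteq> 0"
proof
  assume "q - p = 0"
  then have "q ^ 2 = 1" using qp by (simp add: power2_eq_square)
  then show False using q_prim[of 2] r_ge by simp
qed

lemma p_r: "p ^ r = 1" by (simp add: p_def power_inverse q_root)

lemma qint_0 [simp]: "qint 0 = 0" and qint_r: "qint r = 0"
  by (simp_all add: qint_def q_root p_r)

text \<open>If \<open>q ^ k = p ^ k\<close>, then \<open>r dvd 2 * k\<close>; as \<open>r\<close> is
  odd, the factor 2 cancels.\<close>

lemma qint_nz: assumes "0 < k" "k < r" shows "qint k \<noteq> 0"
proof
  assume "qint k = 0"
  then have "q ^ k = p ^ k" using q_minus_p by (simp add: qint_def)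
  then have "q ^ k * q ^ k = 1" using q_nz by (metis p_def power_inverse power_not_zero right_inverse)
  then have "r dvd 2 * k" by (simp add: mult_2 power_add flip: pow_eq_1_iff)
  then have "r dvd k" using r_odd by (metis coprime_dvd_mult_right_iff coprime_right_2_iff_odd)
  then show False using assms by (auto dest: dvd_imp_le)
qed

text \<open>The two recursions fit the two derivatives: the first sums the corrections met by a
  power of \<open>c\<close>, the second those met by a power of \<open>b\<close>.\<close>

lemma qint_Suc: "qint (Suc k) = p ^ k + q * qint k" "qint (Suc k) = q ^ k + p * qint k"
proof -
  have "q ^ Suc k - p ^ Suc k = p ^ k * (q - p) + q * (q ^ k - p ^ k)"
    "q ^ Suc k - p ^ Suc k = q ^ k * (q - p) + p * (q ^ k - p ^ k)"
    by (simp_all add: algebra_simps)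
  then show "qint (Suc k) = p ^ k + q * qint k" "qint (Suc k) = q ^ k + p * qint k"
    using q_minus_p unfolding qint_def by (metis add_divide_distrib nonzero_mult_div_cancel_right times_divide_eq_right)+
qed

section \<open>Commutation relations of the adapted generators\<close>

lemmas pointwise = lop_app op_app qp mu_eq p_def[symmetric] power2_eq_square power4_eq_xxxx power3_eq_cube

text \<open>All are pointwise identities between functions of cells, settled by a split into the 16
  patterns of occurring forms. Only \<open>b_al\<close>, \<open>c_al\<close>, \<open>b_be\<close>
  and \<open>c_ga\<close> have correction terms; these are the source of the q-derivatives.\<close>

lemma a_ai: "a * ai = 1" and ai_a: "ai * a = 1"
  and b_a: "b * a = q \<bullet> (a * b)"
  and c_a: "c * a = q \<bullet> (a * c)"
  and c_b: "c * b = b * c"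
  and a_al: "a * al = q \<bullet> (al * a)"
  and b_al: "b * al = q \<bullet> (al * b) + \<mu> \<bullet> (ga * ai)"
  and c_al: "c * al = p \<bullet> (al * c) + \<mu> \<bullet> (be * a)"
  and a_be: "a * be = be * a"
  and b_be: "b * be = be * b + (q * \<mu>) \<bullet> (et * ai) + (q * \<mu>) \<bullet> (ga * ai * c * ai)"
  and c_be: "c * be = be * c"
  and a_ga: "a * ga = ga * a"
  and b_ga: "b * ga = ga * b"
  and c_ga: "c * ga = (q\<^sup>2) \<bullet> (ga * c) + (q * \<mu>) \<bullet> (et * a)"
  and a_et: "a * et = p \<bullet> (et * a)"
  and b_et: "b * et = p \<bullet> (et * b)"
  and c_et: "c * et = p \<bullet> (et * c)"
  by (rule cell_eqI, simp only: pointwise prod.case,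
      case_tac i; case_tac j; case_tac k; case_tac l; simp add: fac_def pointwise algebra_simps)+

lemma al_al: "al * al = 0" and et_et: "et * et = 0" and be_be: "be * be = 0" and ga_ga: "ga * ga = 0"
  and et_al: "et * al = (-1) \<bullet> (al * et)"
  and be_al: "be * al = (- (p\<^sup>2)) \<bullet> (al * be)"
  and ga_al: "ga * al = (- (q\<^sup>2)) \<bullet> (al * ga)"
  and be_et: "be * et = (-1) \<bullet> (et * be)"
  and ga_et: "ga * et = (- (p\<^sup>2)) \<bullet> (et * ga)"
  and ga_be: "ga * be = (-1) \<bullet> (be * ga)"
  by (rule cell_eqI, simp only: pointwise prod.case,
      case_tac i; case_tac j; case_tac k; case_tac l; simp add: fac_def pointwise algebra_simps)+

section \<open>Powers of coordinates moved past forms\<close>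

lemmas scale_simps = lop.scale_mult_left lop.scale_mult_right lop.scale_scale lop.scale_right_distrib

lemma swap_pow:
  assumes "x * y = s \<bullet> (y * x)"
  shows "x ^ n * y = (s ^ n) \<bullet> (y * x ^ n)"
proof (induction n)
  case (Suc n)
  have "x ^ Suc n * y = x * (x ^ n * y)" by (simp add: mult.assoc)
  also have "\<dots> = s ^ n \<bullet> (x * y * x ^ n)" by (simp add: Suc scale_simps mult.assoc)
  also have "\<dots> = s ^ Suc n \<bullet> (y * x ^ Suc n)" by (simp add: assms scale_simps mult.assoc mult.commute)
  finally show ?case .
qed (simp add: lop.scale_one)

lemma swap_pow_right:
  assumes "x * y = s \<bullet> (y * x)"
  shows "x * y ^ n = (s ^ n) \<bullet> (y ^ n * x)"
proof (induction n)
  case (Suc n)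
  have "x * y ^ Suc n = (x * y) * y ^ n" by (simp add: mult.assoc)
  also have "\<dots> = s \<bullet> (y * (x * y ^ n))" by (simp add: assms scale_simps mult.assoc)
  also have "\<dots> = s ^ Suc n \<bullet> (y ^ Suc n * x)" by (simp add: Suc scale_simps mult.assoc)
  finally show ?case .
qed (simp add: lop.scale_one)

lemma swap1: "x * y = y * x \<Longrightarrow> x * y = 1 \<bullet> (y * x)" by (simp add: lop.scale_one)

lemma b_ai: "b * ai = p \<bullet> (ai * b)" and c_ai: "c * ai = p \<bullet> (ai * c)"
  by (rule cell_eqI, simp only: pointwise prod.case,
      case_tac i; case_tac j; case_tac k; case_tac l; simp add: fac_def pointwise algebra_simps)+

text \<open>The q-derivative in \<open>b\<close>: the phases of the \<open>n\<close> corrections add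
  up to a q-integer. The truncated exponent \<open>n - 1\<close> is harmless at \<open>n = 0\<close>
  because \<open>qint 0 = 0\<close>.\<close>

lemma b_pow_al: "b ^ n * al = q ^ n \<bullet> (al * b ^ n) + (\<mu> * qint n) \<bullet> (ga * ai * b ^ (n - 1))"
proof (induction n)
  case (Suc n)
  have "b ^ Suc n * al = b * (b ^ n * al)" by (simp add: mult.assoc)
  also have "\<dots> = q ^ n \<bullet> (b * al * b ^ n) + (\<mu> * qint n) \<bullet> (b * ga * ai * b ^ (n - 1))"
    by (simp add: Suc scale_simps mult.assoc distrib_left)
  also have "b * ga * ai * b ^ (n - 1) = p \<bullet> (ga * ai * (b * b ^ (n - 1)))"
    by (simp add: b_ga mult.assoc scale_simps) (simp add: b_ai scale_simps flip: mult.assoc)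
  also have "(\<mu> * qint n) \<bullet> p \<bullet> (ga * ai * (b * b ^ (n - 1))) = (\<mu> * qint n * p) \<bullet> (ga * ai * b ^ n)"
    by (cases n) (simp_all add: scale_simps)
  finally show ?case
    by (simp add: b_al scale_simps distrib_right mult.assoc qint_Suc(2) lop.scale_left_distrib algebra_simps)
qed (simp add: lop.scale_one)

lemma c_pow_al: "c ^ n * al = p ^ n \<bullet> (al * c ^ n) + (\<mu> * qint n) \<bullet> (be * a * c ^ (n - 1))"
proof (induction n)
  case (Suc n)
  have "c ^ Suc n * al = c * (c ^ n * al)" by (simp add: mult.assoc)
  also have "\<dots> = p ^ n \<bullet> (c * al * c ^ n) + (\<mu> * qint n) \<bullet> (c * be * a * c ^ (n - 1))"
    by (simp add: Suc scale_simps mult.assoc distrib_left)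
  also have "c * be * a * c ^ (n - 1) = q \<bullet> (be * a * (c * c ^ (n - 1)))"
    by (simp add: c_be mult.assoc scale_simps) (simp add: c_a scale_simps flip: mult.assoc)
  also have "(\<mu> * qint n) \<bullet> q \<bullet> (be * a * (c * c ^ (n - 1))) = (\<mu> * qint n * q) \<bullet> (be * a * c ^ n)"
    by (cases n) (simp_all add: scale_simps)
  finally show ?case
    by (simp add: c_al scale_simps distrib_right mult.assoc qint_Suc(1) lop.scale_left_distrib algebra_simps)
qed (simp add: lop.scale_one)

text \<open>The coefficient is the geometric sum \<open>q * \<mu> * (1 + p^2 + ...)\<close>, which
  telescopes because \<open>\<mu> = 1 - p^2\<close>; \<open>c_pow_ga\<close> has the same shape with
  \<open>q^2\<close>. It vanishes at \<open>n = r\<close>, so that \<open>b ^ r\<close> commutes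
  with \<beta>.\<close>

lemma b_pow_be: "b ^ n * be = be * b ^ n + (q * (1 - (p\<^sup>2) ^ n)) \<bullet> (et * ai * b ^ (n - 1))
   + (q * (1 - (p\<^sup>2) ^ n)) \<bullet> (ga * ai * c * ai * b ^ (n - 1))"
proof (induction n)
  case (Suc n)
  let ?s = "q * (1 - (p\<^sup>2) ^ n)"
  have "b ^ Suc n * be = b * (b ^ n * be)" by (simp add: mult.assoc)
  also have "\<dots> = b * be * b ^ n + ?s \<bullet> (b * et * ai * b ^ (n - 1)) + ?s \<bullet> (b * ga * ai * c * ai * b ^ (n - 1))"
    by (simp add: Suc scale_simps mult.assoc distrib_left)
  also have "b * et * ai * b ^ (n - 1) = (p * p) \<bullet> (et * ai * (b * b ^ (n - 1)))"
    by (simp add: b_et mult.assoc scale_simps) (simp add: b_ai scale_simps flip: mult.assoc)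
  also have "b * ga * ai * c * ai * b ^ (n - 1) = (p * p) \<bullet> (ga * ai * c * ai * (b * b ^ (n - 1)))"
  proof -
    have "b * ga * ai * c * ai * b ^ (n - 1) = ga * (b * ai) * c * ai * b ^ (n - 1)"
      by (simp add: b_ga mult.assoc)
    also have "\<dots> = p \<bullet> (ga * ai * (c * b) * ai * b ^ (n - 1))"
      by (simp add: b_ai c_b mult.assoc scale_simps)
    also have "\<dots> = p \<bullet> (ga * ai * c * (b * ai) * b ^ (n - 1))" by (simp add: mult.assoc)
    finally show ?thesis by (simp add: b_ai mult.assoc scale_simps)
  qed
  also have "?s \<bullet> (p * p) \<bullet> (et * ai * (b * b ^ (n - 1))) = (?s * (p * p)) \<bullet> (et * ai * b ^ n)"
    by (cases n) (simp_all add: scale_simps)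
  also have "?s \<bullet> (p * p) \<bullet> (ga * ai * c * ai * (b * b ^ (n - 1))) = (?s * (p * p)) \<bullet> (ga * ai * c * ai * b ^ n)"
    by (cases n) (simp_all add: scale_simps)
  finally have "b ^ Suc n * be = be * b ^ Suc n + (q * \<mu> + ?s * (p * p)) \<bullet> (et * ai * b ^ n)
     + (q * \<mu> + ?s * (p * p)) \<bullet> (ga * ai * c * ai * b ^ n)"
    by (simp add: b_be scale_simps distrib_right mult.assoc lop.scale_left_distrib)
  moreover have "q * \<mu> + ?s * (p * p) = q * (1 - (p\<^sup>2) ^ Suc n)"
    by (simp add: mu_eq qp algebra_simps power2_eq_square)
  ultimately show ?case by simp
qed (simp add: lop.scale_one)

lemma c_pow_ga: "c ^ n * ga = (q\<^sup>2) ^ n \<bullet> (ga * c ^ n) + (p * ((q\<^sup>2) ^ n - 1)) \<bullet> (et * a * c ^ (n - 1))"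
proof (induction n)
  case (Suc n)
  have "c ^ Suc n * ga = c * (c ^ n * ga)" by (simp add: mult.assoc)
  also have "\<dots> = (q\<^sup>2) ^ n \<bullet> (c * ga * c ^ n) + (p * ((q\<^sup>2) ^ n - 1)) \<bullet> (c * et * a * c ^ (n - 1))"
    by (simp add: Suc scale_simps mult.assoc distrib_left)
  also have "c * et * a * c ^ (n - 1) = 1 \<bullet> (et * a * (c * c ^ (n - 1)))"
    by (simp add: c_et mult.assoc scale_simps) (simp add: c_a scale_simps qp flip: mult.assoc)
  also have "(p * ((q\<^sup>2) ^ n - 1)) \<bullet> 1 \<bullet> (et * a * (c * c ^ (n - 1))) = (p * ((q\<^sup>2) ^ n - 1)) \<bullet> (et * a * c ^ n)"
    by (cases n) (simp_all add: scale_simps)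
  finally have "c ^ Suc n * ga = (q\<^sup>2) ^ Suc n \<bullet> (ga * c ^ Suc n) +
      ((q\<^sup>2) ^ n * q * \<mu> + p * ((q\<^sup>2) ^ n - 1)) \<bullet> (et * a * c ^ n)"
    by (simp add: c_ga scale_simps distrib_right mult.assoc lop.scale_left_distrib algebra_simps)
  moreover have "(q\<^sup>2) ^ n * q * \<mu> + p * ((q\<^sup>2) ^ n - 1) = p * ((q\<^sup>2) ^ Suc n - 1)"
    by (simp add: mu_eq qp algebra_simps power2_eq_square)
  ultimately show ?case by simp
qed (simp add: lop.scale_one)

end

section \<open>The relations for the powers of a, b and c\<close>

definition opt :: "bool \<Rightarrow> 'e::monoid_mult \<Rightarrow> 'e" where "opt i x = (if i then x else 1)"

lemma opt_simps [simp]: "opt True x = x" "opt False x = 1"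
  by (simp_all add: opt_def)

context root_calculus
begin

lemma a_pow_app: "app (a ^ n) f (False, False, False, False, x, u, v) = f (False, False, False, False, q ^ n * x, u, v)"
  by (induction n arbitrary: f x) (simp_all add: lop_app op_a.rep_eq fac_def mult_ac)

lemma b_pow_app: "app (b ^ n) f (False, False, False, False, x, u, v) =
   x ^ n * (\<Prod>i\<in>{u<..u+n}. chi r i) * f (False, False, False, False, x, u + n, v)"
proof (induction n arbitrary: f)
  case (Suc n)
  have "{u<..u + Suc n} = insert (u + Suc n) {u<..u+n}" by auto
  then show ?case by (simp add: Suc lop_app op_b.rep_eq fac_def mult_ac)
qed (simp add: lop_app)

lemma c_pow_app: "app (c ^ n) f (False, False, False, False, x, u, v) =
   x ^ n * (\<Prod>i\<in>{v<..v+n}. chi r i) * f (False, False, False, False, x, u, v + n)"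
proof (induction n arbitrary: f)
  case (Suc n)
  have "{v<..v + Suc n} = insert (v + Suc n) {v<..v+n}" by auto
  then show ?case by (simp add: Suc lop_app op_c.rep_eq fac_def mult_ac)
qed (simp add: lop_app)

lemma prod_chi_zero: "(\<Prod>i\<in>{u<..u+r}. chi r i) = 0"
proof -
  have "u < r * (u div r + 1)" "r * (u div r + 1) \<le> u + r"
    using r_ge by (simp_all add: dividend_less_times_div)
  then have "r * (u div r + 1) \<in> {u<..u+r}" by simp
  moreover have "chi r (r * (u div r + 1)) = 0" by (simp add: chi_def)
  ultimately show ?thesis by (auto intro!: prod_zero)
qed

definition form :: "bool \<Rightarrow> bool \<Rightarrow> bool \<Rightarrow> bool \<Rightarrow> cell lop" where
  "form i j k l = opt i al * opt j et * opt k be * opt l ga"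

lemma form_app: "app (form i j k l) f (False, False, False, False, z) = f (i, j, k, l, z)"
  by (cases i; cases j; cases k; cases l)
    (simp_all add: form_def lop_app op_al.rep_eq op_et.rep_eq op_be.rep_eq op_ga.rep_eq fac_def)

text \<open>The four forms lead from the cells without forms to all others, so an operator commuting
  with them is determined by its action on the former. There \<open>a\<close>, \<open>b\<close>,
  \<open>c\<close> act without correction terms, which makes their powers computable.\<close>

lemma central_eqI:
  assumes "\<And>x. x \<in> {al, et, be, ga} \<Longrightarrow> S * x = x * S"
    and "\<And>x. x \<in> {al, et, be, ga} \<Longrightarrow> T * x = x * T"
    and "\<And>f x u v. app S f (False, False, False, False, x, u, v) = app T f (False, False, False, False, x, u, v)"
  shows "S = T"
proof (rule cell_eqI)
  fix f i j k l x u v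
  have comm: "R * form i j k l = form i j k l * R"
    if "\<And>x. x \<in> {al, et, be, ga} \<Longrightarrow> R * x = x * R" for R
  proof -
    have "R * opt z x = opt z x * R" if "x \<in> {al, et, be, ga}" for z x
      using that \<open>\<And>x. x \<in> {al, et, be, ga} \<Longrightarrow> R * x = x * R\<close> by (cases z) auto
    then have "R * opt i al = opt i al * R" "R * opt j et = opt j et * R"
      "R * opt k be = opt k be * R" "R * opt l ga = opt l ga * R" by auto
    moreover have "R * (y * z) = y * z * R" if "R * y = y * R" "R * z = z * R" for y z
      using that by (metis mult.assoc)
    ultimately show ?thesis unfolding form_def by blast
  qed
  have "app R f (i, j, k, l, x, u, v) = app R (app (form i j k l) f) (False, False, False, False, x, u, v)"
    if "R * form i j k l = form i j k l * R" for R
    using arg_cong[OF that, of "\<lambda>R. app R f (False, False, False, False, x, u, v)"]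
    by (simp add: lop_app form_app)
  then show "app S f (i, j, k, l, x, u, v) = app T f (i, j, k, l, x, u, v)"
    using assms comm[of S] comm[of T] by metis
qed

lemma a_pow_r: "a ^ r = 1"
proof (rule central_eqI)
  fix x assume x: "x \<in> {al, et, be, ga}"
  have "a ^ r * al = al * a ^ r" "a ^ r * et = et * a ^ r" "a ^ r * be = be * a ^ r" "a ^ r * ga = ga * a ^ r"
    using swap_pow[OF a_al, of r] swap_pow[OF a_et, of r] swap_pow[OF swap1[OF a_be], of r]
      swap_pow[OF swap1[OF a_ga], of r]
    by (simp_all add: q_root p_r lop.scale_one)
  then show "a ^ r * x = x * a ^ r" using x by blast
qed (simp_all add: a_pow_app lop_app q_root)

text \<open>At the exponent \<open>r\<close> every correction coefficient vanishes and every phase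
  is 1, so the power commutes with the forms; on cells without forms one of \<open>r\<close>
  consecutive factors \<open>chi\<close> is 0.\<close>

lemma b_pow_r: "b ^ r = 0"
proof (rule central_eqI)
  fix x assume x: "x \<in> {al, et, be, ga}"
  have "(p\<^sup>2) ^ r = 1" by (metis p_r power_commutes power_mult mult.commute power_one)
  then have "b ^ r * al = al * b ^ r" "b ^ r * et = et * b ^ r" "b ^ r * be = be * b ^ r" "b ^ r * ga = ga * b ^ r"
    using b_pow_al[of r] swap_pow[OF b_et, of r] b_pow_be[of r] swap_pow[OF swap1[OF b_ga], of r]
    by (simp_all add: q_root p_r qint_r lop.scale_one)
  then show "b ^ r * x = x * b ^ r" using x by blast
qed (simp_all add: b_pow_app lop_app prod_chi_zero)

lemma c_pow_r: "c ^ r = 0"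
proof (rule central_eqI)
  fix x assume x: "x \<in> {al, et, be, ga}"
  have "(q\<^sup>2) ^ r = 1" by (metis q_root power_commutes power_mult mult.commute power_one)
  then have "c ^ r * al = al * c ^ r" "c ^ r * et = et * c ^ r" "c ^ r * be = be * c ^ r" "c ^ r * ga = ga * c ^ r"
    using c_pow_al[of r] swap_pow[OF c_et, of r] c_pow_ga[of r] swap_pow[OF swap1[OF c_be], of r]
    by (simp_all add: q_root p_r qint_r lop.scale_one)
  then show "c ^ r * x = x * c ^ r" using x by blast
qed (simp_all add: c_pow_app lop_app prod_chi_zero)

lemma ai_eq: "ai = a ^ (r - 1)"
proof -
  have "ai = a ^ r * ai" by (simp add: a_pow_r)
  also have "a ^ r = a ^ (r - 1) * a" using r_ge by (metis Suc_diff_1 not_less not_numeral_le_zero power_Suc2 gr0I)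
  finally show ?thesis by (simp add: mult.assoc a_ai)
qed

lemma a_pow_mod: "a ^ (n mod r) = a ^ n"
proof -
  have "a ^ n = (a ^ r) ^ (n div r) * a ^ (n mod r)" by (simp flip: power_mult power_add)
  then show ?thesis by (simp add: a_pow_r)
qed

section \<open>Monomials moved past the two parts of theta\<close>

definition mon :: "nat \<Rightarrow> nat \<Rightarrow> nat \<Rightarrow> cell lop" where
  "mon u v w = a ^ u * b ^ v * c ^ w"

lemma swap_assoc: "x * y = s \<bullet> (y * x) \<Longrightarrow> x * (y * z) = s \<bullet> (y * (x * z))"
  by (simp add: scale_simps flip: mult.assoc)

lemma mon_et: "mon u v w * et = (p ^ (u + v + w)) \<bullet> (et * mon u v w)"
  unfolding mon_def
  by (simp add: swap_pow[OF c_et] swap_assoc[OF swap_pow[OF b_et]] swap_assoc[OF swap_pow[OF a_et]]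
      scale_simps power_add mult_ac)

lemma a_ga_pow: "a ^ u * (ga * z) = ga * (a ^ u * z)"
  and a_be_pow: "a ^ u * (be * z) = be * (a ^ u * z)"
  and a_ai_pow: "a ^ u * (ai * z) = ai * (a ^ u * z)"
  using swap_assoc[OF swap_pow[OF swap1[OF a_ga]]] swap_assoc[OF swap_pow[OF swap1[OF a_be]]]
    swap_assoc[OF swap_pow[OF swap1, of a ai]] by (simp_all add: lop.scale_one a_ai ai_a)

text \<open>Passing \<open>c ^ w\<close>, \<alpha> creates \<beta>, which in turn creates \<eta> and
  \<gamma> on its way past \<open>b ^ v\<close>. Hence the \<gamma> term has two sources, which
  combine into a single q-integer.\<close>

lemma mon_al:
  "mon u v w * al =
    (q ^ u * q ^ v * p ^ w) \<bullet> (al * mon u v w)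
    + (\<mu> * qint w * q ^ v) \<bullet> (be * mon (Suc u) v (w - 1))
    + (\<mu> * qint v * q ^ w) \<bullet> (ga * ai * mon u (v - 1) w)
    + (\<mu> * qint w * (q ^ v - p ^ v) * p ^ u) \<bullet> (et * mon u (v - 1) (w - 1))"
proof -
  have ba: "b ^ n * a = q ^ n \<bullet> (a * b ^ n)" for n by (rule swap_pow[OF b_a])
  \<comment> \<open>The case \<open>v = 0\<close> is separate since the truncated
    \<open>b ^ (v - 1)\<close> is then 1; both coefficients vanish.\<close>
  have ai_ba: "(q * (1 - (p\<^sup>2) ^ v)) \<bullet> (ai * b ^ (v - 1) * a) = (q ^ v - p ^ v) \<bullet> b ^ (v - 1)"
  proof (cases v)
    case (Suc n)
    have "ai * b ^ n * a = q ^ n \<bullet> b ^ n"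
      by (simp add: mult.assoc ba scale_simps) (simp add: ai_a flip: mult.assoc)
    moreover have "q * (1 - (p\<^sup>2) ^ Suc n) * q ^ n = q ^ Suc n - p ^ Suc n"
    proof -
      have "q ^ Suc n * (p\<^sup>2) ^ Suc n = p ^ Suc n"
        by (simp only: power_mult_distrib[symmetric]) (simp add: power2_eq_square qp)
      then show ?thesis by (simp add: algebra_simps)
    qed
    ultimately show ?thesis by (simp add: Suc scale_simps)
  qed simp
  have ga_term: "(\<mu> * qint w) \<bullet> (c * b ^ (v - 1) * c ^ (w - 1)) = (\<mu> * qint w) \<bullet> (b ^ (v - 1) * c ^ w)"
  proof (cases w)
    case (Suc n)
    have "c * b ^ (v - 1) = b ^ (v - 1) * c" using swap_pow_right[OF swap1[OF c_b], of "v - 1"] by (simp add: lop.scale_one)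
    then show ?thesis by (simp add: Suc mult.assoc)
  qed simp
  \<comment> \<open>\<open>qint w * (q ^ v - p ^ v)\<close> is symmetric in \<open>v\<close> and
    \<open>w\<close>, being \<open>qint v * qint w * (q - p)\<close>.\<close>
  have coef: "p ^ w * qint v + qint w * (q ^ v - p ^ v) = qint v * q ^ w"
  proof -
    have "qint n * (q - p) = q ^ n - p ^ n" for n using q_minus_p by (simp add: qint_def)
    then have "qint w * (q ^ v - p ^ v) = qint v * (q ^ w - p ^ w)" by (metis mult.left_commute)
    then show ?thesis by (simp add: algebra_simps)
  qed
  have 1: "b ^ v * be * a * c ^ (w - 1) = q ^ v \<bullet> (be * a * b ^ v * c ^ (w - 1))
     + (q ^ v - p ^ v) \<bullet> (et * b ^ (v - 1) * c ^ (w - 1))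
     + (q ^ v - p ^ v) \<bullet> (ga * ai * (c * b ^ (v - 1) * c ^ (w - 1)))"
  proof -
    have "b ^ v * be * a * c ^ (w - 1) = be * (b ^ v * a) * c ^ (w - 1)
       + et * ((q * (1 - (p\<^sup>2) ^ v)) \<bullet> (ai * b ^ (v - 1) * a)) * c ^ (w - 1)
       + ga * ai * c * ((q * (1 - (p\<^sup>2) ^ v)) \<bullet> (ai * b ^ (v - 1) * a)) * c ^ (w - 1)"
      by (simp add: b_pow_be distrib_right scale_simps mult.assoc)
    then show ?thesis unfolding ai_ba ba by (simp add: scale_simps mult.assoc)
  qed
  have T1: "a ^ u * (b ^ v * (al * c ^ w)) = (q ^ v * q ^ u) \<bullet> (al * mon u v w) + (\<mu> * qint v) \<bullet> (ga * ai * mon u (v - 1) w)"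
    by (simp add: swap_assoc[OF swap_pow[OF a_al]] distrib_left distrib_right scale_simps mult.assoc mon_def a_ga_pow a_ai_pow
        mult.assoc[symmetric, of "b ^ v"] b_pow_al)
  have T2: "a ^ u * (b ^ v * (be * (a * c ^ (w - 1)))) = q ^ v \<bullet> (be * mon (Suc u) v (w - 1))
     + ((q ^ v - p ^ v) * p ^ u) \<bullet> (et * mon u (v - 1) (w - 1))
     + (q ^ v - p ^ v) \<bullet> (ga * ai * (a ^ u * (c * b ^ (v - 1) * c ^ (w - 1))))"
    using arg_cong[OF 1, of "\<lambda>x. a ^ u * x"]
    by (simp add: swap_assoc[OF swap_pow[OF a_et]] distrib_left scale_simps mult.assoc mon_def a_ga_pow a_ai_pow a_be_pow power_commutes)
       (simp add: power_commutes flip: mult.assoc)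
  have "mon u v w * al = p ^ w \<bullet> (a ^ u * (b ^ v * (al * c ^ w))) + (\<mu> * qint w) \<bullet> (a ^ u * (b ^ v * (be * (a * c ^ (w - 1)))))"
    by (simp add: mon_def mult.assoc c_pow_al distrib_left scale_simps)
  also have "\<dots> = (q ^ u * q ^ v * p ^ w) \<bullet> (al * mon u v w)
    + (\<mu> * qint w * q ^ v) \<bullet> (be * mon (Suc u) v (w - 1))
    + (\<mu> * qint w * (q ^ v - p ^ v) * p ^ u) \<bullet> (et * mon u (v - 1) (w - 1))
    + ((\<mu> * (p ^ w * qint v)) \<bullet> (ga * ai * mon u (v - 1) w)
    + (q ^ v - p ^ v) \<bullet> (ga * ai * (a ^ u * ((\<mu> * qint w) \<bullet> (c * b ^ (v - 1) * c ^ (w - 1))))))"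
    unfolding T1 T2 by (simp add: scale_simps mult_ac add_ac)
  also have "(\<mu> * (p ^ w * qint v)) \<bullet> (ga * ai * mon u (v - 1) w)
    + (q ^ v - p ^ v) \<bullet> (ga * ai * (a ^ u * ((\<mu> * qint w) \<bullet> (c * b ^ (v - 1) * c ^ (w - 1)))))
    = (\<mu> * (p ^ w * qint v + qint w * (q ^ v - p ^ v))) \<bullet> (ga * ai * mon u (v - 1) w)"
    unfolding ga_term by (simp add: mon_def scale_simps mult.assoc lop.scale_left_distrib distrib_left mult_ac)
  finally show ?thesis unfolding coef by (simp add: mult_ac add_ac)
qed

text \<open>\<open>d\<close> is the coordinate function \<open>a\<^sup>-\<^sup>1 (1 + q\<^sup>-\<^sup>1 b c)\<close>, and \<open>ga\<close> is itself \<open>e\<^sub>c\<close>.\<close>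

definition y :: "cell lop" where "y = ai * c"
definition d :: "cell lop" where "d = ai + p \<bullet> (ai * b * c)"
definition ed :: "cell lop" where "ed = et + ga * y"
definition eb :: "cell lop" where "eb = be - ed * y"
definition ea :: "cell lop" where "ea = al - \<mu> \<bullet> et - ga * y"

section \<open>The original generators and their relations\<close>

lemmas original_defs = y_def d_def ed_def eb_def ea_def

lemma coord_relations:
  "d * b = q \<bullet> (b * d)" "d * c = q \<bullet> (c * d)"
  "d * a = a * d + (q * \<mu>) \<bullet> (b * c)" "a * d = p \<bullet> (b * c) + 1"
  by (rule cell_eqI, simp only: original_defs pointwise prod.case,
      case_tac i; case_tac j; case_tac k; case_tac l; simp add: fac_def pointwise algebra_simps)+

lemma form_relations:
  "eb * eb = 0" "ed * ed = 0"
  "eb * ga = - (ga * eb)" "ed * ga = - (ga * ed)" "ed * eb = - (eb * ed)"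
  "ea * ea = \<mu> \<bullet> (eb * ga)"
  "ed * ea = - (ea * ed) - \<mu> \<bullet> (eb * ga)"
  "ea * eb = \<mu> \<bullet> (eb * ed) - q\<^sup>2 \<bullet> (eb * ea)"
  "ga * ea = - (\<mu> \<bullet> (ga * ed)) - q\<^sup>2 \<bullet> (ea * ga)"
  by (rule cell_eqI, simp only: original_defs pointwise prod.case,
      case_tac i; case_tac j; case_tac k; case_tac l; simp add: fac_def pointwise algebra_simps)+

lemma cross_relations_ac:
  "c * eb = eb * c" "a * ed = p \<bullet> (ed * a)" "c * ed = q \<bullet> (ed * c)"
  "a * eb = eb * a + (q * \<mu>) \<bullet> (ed * c)" "c * ga = ga * c + (q * \<mu>) \<bullet> (ed * a)"
  "c * ea = p \<bullet> (ea * c) + \<mu> \<bullet> (eb * a)"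
  "a * ea = q \<bullet> (ea * a) + \<mu> \<bullet> (ga * c) + (q * \<mu>\<^sup>2) \<bullet> (ed * a)"
  by (rule cell_eqI, simp only: original_defs pointwise prod.case,
      case_tac i; case_tac j; case_tac k; case_tac l; simp add: fac_def pointwise algebra_simps)+

lemma cross_relations_bd:
  "d * eb = eb * d" "b * ed = p \<bullet> (ed * b)" "d * ed = q \<bullet> (ed * d)"
  "b * eb = eb * b + (q * \<mu>) \<bullet> (ed * d)" "d * ga = ga * d + (q * \<mu>) \<bullet> (ed * b)"
  "d * ea = p \<bullet> (ea * d) + \<mu> \<bullet> (eb * b)"
  "b * ea = q \<bullet> (ea * b) + \<mu> \<bullet> (ga * d) + (q * \<mu>\<^sup>2) \<bullet> (ed * b)"
  by (rule cell_eqI, simp only: original_defs pointwise prod.case,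
      case_tac i; case_tac j; case_tac k; case_tac l; simp add: fac_def pointwise algebra_simps)+

section \<open>The relation for the power of d\<close>

definition dpoly :: "nat \<Rightarrow> complex poly" where
  "dpoly n = (\<Prod>i<n. [:1, p ^ (2 * i + 1):])"

definition eval_bc :: "complex poly \<Rightarrow> cell lop" where
  "eval_bc f = (\<Sum>i\<le>degree f. coeff f i \<bullet> (b * c) ^ i)"

lemma eval_bc: "degree f \<le> n \<Longrightarrow> eval_bc f = (\<Sum>i\<le>n. coeff f i \<bullet> (b * c) ^ i)"
  unfolding eval_bc_def by (rule sum.mono_neutral_left) (auto simp: coeff_eq_0)

lemma eval_bc_linear: "eval_bc ([:1, s:] * f) = (1 + s \<bullet> (b * c)) * eval_bc f"
proof -
  let ?n = "degree f"
  have "degree ([:1, s:] * f) \<le> Suc ?n"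
    by (rule order.trans[OF degree_mult_le]) simp
  then have "eval_bc ([:1, s:] * f) = (\<Sum>i\<le>Suc ?n. coeff ([:1, s:] * f) i \<bullet> (b * c) ^ i)"
    by (rule eval_bc)
  also have "\<dots> = (\<Sum>i\<le>Suc ?n. coeff f i \<bullet> (b * c) ^ i) + (\<Sum>i\<le>Suc ?n. (s * coeff (pCons 0 f) i) \<bullet> (b * c) ^ i)"
  proof -
    have "coeff ([:1, s:] * f) i = coeff f i + s * coeff (pCons 0 f) i" for i by (cases i) simp_all
    then show ?thesis by (simp only: lop.scale_left_distrib sum.distrib)
  qed
  also have "(\<Sum>i\<le>Suc ?n. coeff f i \<bullet> (b * c) ^ i) = eval_bc f" by (rule eval_bc[symmetric]) simp
  also have "(\<Sum>i\<le>Suc ?n. (s * coeff (pCons 0 f) i) \<bullet> (b * c) ^ i) = (\<Sum>i\<le>?n. (s * coeff f i) \<bullet> (b * c) ^ Suc i)"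
    by (subst sum.atMost_Suc_shift) simp
  also have "\<dots> = s \<bullet> (b * c) * eval_bc f"
    by (simp add: eval_bc_def sum_distrib_left scale_simps mult.assoc mult.commute[of s])
  finally show ?thesis by (simp add: distrib_right)
qed

lemma bc_pow_swap: "(b * c) * ai ^ n = (p\<^sup>2) ^ n \<bullet> (ai ^ n * (b * c))"
  by (rule swap_pow_right) (simp add: mult.assoc c_ai swap_assoc[OF b_ai] scale_simps power2_eq_square)

text \<open>Moving \<open>b * c\<close> past \<open>ai ^ n\<close> costs \<open>p ^ (2 * n)\<close>,
  so \<open>d ^ n\<close> splits into factors linear in \<open>b * c\<close> with roots in geometric
  progression. Collecting them in a polynomial makes the coefficients accessible.\<close>

lemma d_pow: "d ^ n = ai ^ n * eval_bc (dpoly n)"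
proof (induction n)
  case 0
  then show ?case by (simp add: dpoly_def eval_bc_def lop.scale_one)
next
  case (Suc n)
  have "d ^ Suc n = d * (ai ^ n * eval_bc (dpoly n))"
    by (simp add: Suc)
  also have "\<dots> = ai * (ai ^ n * eval_bc (dpoly n)) + p \<bullet> (ai * ((b * c) * ai ^ n) * eval_bc (dpoly n))"
    by (simp add: d_def distrib_right scale_simps mult.assoc)
  also have "\<dots> = ai ^ Suc n * ((1 + (p ^ (2 * n + 1)) \<bullet> (b * c)) * eval_bc (dpoly n))"
    unfolding bc_pow_swap
    by (simp add: distrib_right distrib_left scale_simps mult.assoc power_mult)
  also have "(1 + (p ^ (2 * n + 1)) \<bullet> (b * c)) * eval_bc (dpoly n) = eval_bc (dpoly (Suc n))"
    by (simp only: eval_bc_linear[symmetric] dpoly_def prod.lessThan_Suc mult.commute)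
  finally show ?case .
qed

text \<open>Substituting \<open>p\<^sup>2 X\<close> for \<open>X\<close> permutes the linear factors cyclically, so only the extreme coefficients survive.\<close>

lemma coeff_dpoly_r:
  assumes "0 < i" "i < r"
  shows "coeff (dpoly r) i = 0"
proof -
  have "poly (pcompose (dpoly r) [:0, p\<^sup>2:]) x = poly (dpoly r) x" for x
  proof -
    let ?g = "\<lambda>i. 1 + x * p ^ (2 * i + 1)"
    have "poly (pcompose (dpoly r) [:0, p\<^sup>2:]) x = (\<Prod>i<r. ?g (Suc i))"
      by (simp add: dpoly_def poly_pcompose poly_prod mult_ac power2_eq_square)
    also have "\<dots> = (\<Prod>i<r. ?g i)"
    proof -
      obtain k where k: "r = Suc k" using r_ge by (cases r) auto
      have "?g r = ?g 0" by (simp add: power_mult p_r mult.commute[of 2])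
      then have "(\<Prod>i<r. ?g (Suc i)) = ?g 0 * (\<Prod>i<k. ?g (Suc i))"
        unfolding k prod.lessThan_Suc by (simp only: mult.commute)
      also have "\<dots> = (\<Prod>i<r. ?g i)" unfolding k by (rule prod.lessThan_Suc_shift[symmetric])
      finally show ?thesis .
    qed
    also have "\<dots> = poly (dpoly r) x" by (simp add: dpoly_def poly_prod mult_ac)
    finally show ?thesis .
  qed
  then have "pcompose (dpoly r) [:0, p\<^sup>2:] = dpoly r" by (simp add: poly_eq_poly_eq_iff[symmetric] fun_eq_iff)
  then have "(p\<^sup>2) ^ i * coeff (dpoly r) i = coeff (dpoly r) i"
    by (metis coeff_pcompose_linear)
  moreover have "(p\<^sup>2) ^ i \<noteq> 1"
  proof
    assume "(p\<^sup>2) ^ i = 1"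
    then have "q ^ (2 * i) = 1" by (simp add: p_def power_inverse power_mult)
    then have "r dvd 2 * i" by (simp add: pow_eq_1_iff)
    then have "r dvd i" using r_odd by (metis coprime_dvd_mult_right_iff coprime_right_2_iff_odd)
    then show False using assms by (auto dest: dvd_imp_le)
  qed
  ultimately show ?thesis by simp
qed

lemma ai_pow_r: "ai ^ r = 1"
  by (metis a_pow_r ai_eq power_mult mult.commute power_one)

text \<open>Only the coefficients of degree 0 and \<open>r\<close> survive; the former is 1 and the
  latter multiplies \<open>(b * c) ^ r\<close>, which is 0.\<close>

lemma d_pow_r: "d ^ r = 1"
proof -
  have "degree (dpoly r) \<le> r"
    unfolding dpoly_def
    by (rule order.trans[OF degree_prod_sum_le]) (simp_all add: p_def q_nz)
  then have "eval_bc (dpoly r) = (\<Sum>i\<le>r. coeff (dpoly r) i \<bullet> (b * c) ^ i)" by (rule eval_bc)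
  also have "\<dots> = (\<Sum>i\<in>{0, r}. coeff (dpoly r) i \<bullet> (b * c) ^ i)"
    by (rule sum.mono_neutral_right) (auto simp: coeff_dpoly_r)
  finally have eval: "eval_bc (dpoly r) = (\<Sum>i\<in>{0, r}. coeff (dpoly r) i \<bullet> (b * c) ^ i)" .
  have "(b * c) ^ n = b ^ n * c ^ n" for n
  proof (induction n)
    case (Suc n)
    have "c * b ^ n = b ^ n * c"
      using swap_pow_right[OF swap1[OF c_b], of n] by (simp add: lop.scale_one)
    then have "b * (c * (b ^ n * c ^ n)) = b * (b ^ n * (c * c ^ n))" by (simp flip: mult.assoc)
    then show ?case by (simp add: Suc mult.assoc)
  qed simp
  then have "(b * c) ^ r = 0" by (simp add: b_pow_r)
  then have "(\<Sum>i\<in>{0, r}. coeff (dpoly r) i \<bullet> (b * c) ^ i) = coeff (dpoly r) 0 \<bullet> 1"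
    using r_ge by simp
  also have "coeff (dpoly r) 0 = 1"
    by (simp add: dpoly_def poly_prod flip: poly_0_coeff_0)
  finally show ?thesis by (simp add: eval d_pow ai_pow_r lop.scale_one)
qed

end

section \<open>The exterior derivative on basis forms\<close>

type_synonym code = "bool \<times> bool \<times> bool \<times> bool \<times> nat \<times> nat \<times> nat"

fun fdeg :: "code \<Rightarrow> nat" where
  "fdeg (i, j, k, l, _) = of_bool i + of_bool j + of_bool k + of_bool l"

definition sg :: "bool \<Rightarrow> complex" where "sg i = (if i then -1 else 1)"

context root_calculus
begin

fun bs :: "code \<Rightarrow> cell lop" where
  "bs (i, j, k, l, u, v, w) = form i j k l * mon u v w"

text \<open>The phase, up to the sign of the degree, of moving \<alpha> from the right end of a
  basis form to its left end.\<close>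

fun wt :: "code \<Rightarrow> complex" where
  "wt (i, j, k, l, u, v, w) = q ^ u * q ^ v * p ^ w * fac k (p\<^sup>2) * fac l (q\<^sup>2)"

definition codes :: "code set" where
  "codes = UNIV \<times> UNIV \<times> UNIV \<times> UNIV \<times> {..<r} \<times> {..<r} \<times> {..<r}"

lemma finite_codes: "finite codes"
  by (simp add: codes_def)

definition theta_op :: "cell lop" where "theta_op = al + p\<^sup>2 \<bullet> et"

definition dif :: "nat \<Rightarrow> cell lop \<Rightarrow> cell lop" where
  "dif n x = (-1) ^ n \<bullet> (x * theta_op) - theta_op * x"

lemma mon_app:
  assumes "u < r" "v < r" "w < r"
  shows "app (mon u v w) f (False, False, False, False, 1, 0, 0) = f (False, False, False, False, q ^ u, v, w)"
proof -
  have "prod (chi r) {0<..n} = 1" if "n < r" for n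
    using that by (intro prod.neutral) (auto simp: chi_def dest: dvd_imp_le)
  then show ?thesis using assms
    by (simp add: mon_def lop_app a_pow_app b_pow_app c_pow_app)
qed

lemma bs_app:
  assumes "(i, j, k, l, u, v, w) \<in> codes"
  shows "app (bs (i, j, k, l, u, v, w)) f (False, False, False, False, 1, 0, 0) = f (i, j, k, l, q ^ u, v, w)"
  using assms by (simp add: lop_app mon_app form_app codes_def)

lemma q_pow_inj: assumes "u < r" "v < r" "q ^ u = q ^ v" shows "u = v"
proof -
  have *: "s = t" if st: "s \<le> t" "t < r" "q ^ s = q ^ t" for s t
  proof -
    obtain n where n: "t = s + n" using st(1) by (auto simp: nat_le_iff_add)
    then have "q ^ n = 1" using st q_nz by (simp add: power_add)
    then show "s = t" using st n by (auto simp: pow_eq_1_iff dest: dvd_imp_le)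
  qed
  show ?thesis using *[of u v] *[of v u] assms by (cases "u \<le> v") auto
qed

lemma app_sum: "app (sum g S) f i = (\<Sum>x\<in>S. app (g x) f i)"
  by (induction S rule: infinite_finite_induct) (simp_all add: lop_app)

text \<open>As multiplication acts by its transpose, evaluating a basis form at the cell of 1
  returns the test function at the cell of that form. A delta function therefore isolates one
  coefficient.\<close>

lemma bs_indep:
  assumes "S \<subseteq> codes" and "(\<Sum>x\<in>S. g x \<bullet> bs x) = 0" and "z \<in> S"
  shows "g z = 0"
proof -
  obtain i j k l u v w where z: "z = (i, j, k, l, u, v, w)" by (cases z)
  define f :: "cell \<Rightarrow> complex" where "f = (\<lambda>c. of_bool (c = (i, j, k, l, q ^ u, v, w)))"
  have "finite S" using assms(1) finite_codes finite_subset by blast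
  have "app (bs x) f (False, False, False, False, 1, 0, 0) = of_bool (x = z)" if "x \<in> S" for x
  proof -
    obtain i' j' k' l' u' v' w' where x: "x = (i', j', k', l', u', v', w')" by (cases x)
    have "x \<in> codes" "z \<in> codes" using that assms by auto
    then show ?thesis unfolding x z
      by (subst bs_app) (auto simp: f_def codes_def dest: q_pow_inj)
  qed
  then have "(\<Sum>x\<in>S. g x * of_bool (x = z)) = app (\<Sum>x\<in>S. g x \<bullet> bs x) f (False, False, False, False, 1, 0, 0)"
    by (simp add: app_sum lop_app)
  then have "(\<Sum>x\<in>S. g x * of_bool (x = z)) = 0"
    by (simp add: assms(2) lop_app)
  then show ?thesis using \<open>finite S\<close> assms(3) by (simp add: of_bool_def if_distrib[of "(*) _"] cong: if_cong)
qed

lemmas form_swaps = al_al et_et be_be ga_ga et_al be_al ga_al be_et ga_et ga_be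

lemma assoc_swap: "x * x' = z \<Longrightarrow> x * (x' * t) = z * t" for x :: "'e::semigroup_mult" by (simp flip: mult.assoc)

lemmas form_swaps_assoc = form_swaps[THEN assoc_swap]

lemma p2q2: "q\<^sup>2 * p\<^sup>2 = 1" "q\<^sup>2 * (p\<^sup>2 * z) = z" "p\<^sup>2 * (q\<^sup>2 * z) = z"
proof -
  have "q\<^sup>2 * p\<^sup>2 = 1" using qp by (simp flip: power_mult_distrib)
  then show "q\<^sup>2 * p\<^sup>2 = 1" "q\<^sup>2 * (p\<^sup>2 * z) = z" "p\<^sup>2 * (q\<^sup>2 * z) = z"
    by (metis mult.assoc mult.commute mult_1)+
qed

text \<open>Both products with \<theta> are brought to normal order by \<open>mon_al\<close> and
  \<open>mon_et\<close>. The grading sign cancels the signs of the forms passed, which leaves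
  \<open>wt - 1\<close> in front of \<alpha>; the factors \<open>of_bool\<close> express that a
  repeated form gives 0.\<close>

lemma dif_bs:
  fixes i j k l u v w
  defines "s \<equiv> sg i * sg j * sg k * sg l"
  shows "dif (fdeg (i, j, k, l, u, v, w)) (bs (i, j, k, l, u, v, w)) =
     (of_bool (\<not> i) * (wt (i, j, k, l, u, v, w) - 1)) \<bullet> (form True j k l * mon u v w)
   + (of_bool (\<not> k) * (s * sg l * (\<mu> * qint w * q ^ v))) \<bullet> (form i j True l * mon (Suc u) v (w - 1))
   + (of_bool (\<not> l) * (s * (\<mu> * qint v * q ^ w))) \<bullet> (form i j k True * (ai * mon u (v - 1) w))
   + (of_bool (\<not> j) * (s * sg k * fac l (- (p\<^sup>2)) * p\<^sup>2 * p ^ (u + v + w) - p\<^sup>2 * sg i)) \<bullet> (form i True k l * mon u v w)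
   + (of_bool (\<not> j) * (s * sg k * fac l (- (p\<^sup>2)) * (\<mu> * qint w * (q ^ v - p ^ v) * p ^ u))) \<bullet> (form i True k l * mon u (v - 1) (w - 1))"
proof -
  \<comment> \<open>With coefficients and monomials opaque, each of the 16 cases is a mere
    reordering of forms.\<close>
  define S Bb G E W where "S = q ^ u * q ^ v * p ^ w" and "Bb = \<mu> * qint w * q ^ v" and "G = \<mu> * qint v * q ^ w"
    and "E = \<mu> * qint w * (q ^ v - p ^ v) * p ^ u" and "W = p ^ (u + v + w)"
  define M MB MG ME where "M = mon u v w" and "MB = mon (Suc u) v (w - 1)" and "MG = ai * mon u (v - 1) w"
    and "ME = mon u (v - 1) (w - 1)"
  have al': "M * al = S \<bullet> (al * M) + Bb \<bullet> (be * MB) + G \<bullet> (ga * MG) + E \<bullet> (et * ME)"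
    unfolding S_def Bb_def G_def E_def M_def MB_def MG_def ME_def by (simp add: mon_al mult.assoc)
  have et': "M * et = W \<bullet> (et * M)" unfolding W_def M_def by (rule mon_et)
  show ?thesis
    unfolding bs.simps wt.simps S_def[symmetric] Bb_def[symmetric] G_def[symmetric] E_def[symmetric]
      M_def[symmetric] MB_def[symmetric] MG_def[symmetric] ME_def[symmetric] W_def[symmetric]
    by (cases i; cases j; cases k; cases l;
        simp add: s_def sg_def fac_def form_def dif_def theta_op_def distrib_left distrib_right mult.assoc al' et'
         scale_simps form_swaps form_swaps_assoc lop.scale_minus_left lop.scale_minus_right
         lop.scale_left_diff_distrib lop.scale_right_diff_distrib right_diff_distrib left_diff_distrib lop.scale_one p2q2 mult_ac)
qed

end

section \<open>Linear algebra of finite indexed families\<close>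

context vector_space
begin

lemma span_family:
  assumes "finite S"
  shows "span (M ` S) = {\<Sum>x\<in>S. g x *s M x | g. True}"
proof
  show "span (M ` S) \<subseteq> {\<Sum>x\<in>S. g x *s M x | g. True}"
  proof (rule span_minimal)
    show "M ` S \<subseteq> {\<Sum>x\<in>S. g x *s M x | g. True}"
    proof (clarify)
      fix x assume "x \<in> S"
      then have "M x = (\<Sum>y\<in>S. (if y = x then 1 else 0) *s M y)"
        using assms by (simp add: if_distrib[of "\<lambda>c. c *s _"] cong: if_cong)
      then show "\<exists>g. M x = (\<Sum>y\<in>S. g y *s M y) \<and> True" by (intro exI[of _ "\<lambda>y. if y = x then 1 else 0"]) simp
    qed
    show "subspace {\<Sum>x\<in>S. g x *s M x | g. True}"
    proof (rule subspaceI)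
      show "0 \<in> {\<Sum>x\<in>S. g x *s M x | g. True}"
        by (rule CollectI, rule exI[of _ "\<lambda>_. 0"]) simp
    next
      fix u v assume "u \<in> {\<Sum>x\<in>S. g x *s M x | g. True}" "v \<in> {\<Sum>x\<in>S. g x *s M x | g. True}"
      then obtain g h where "u = (\<Sum>x\<in>S. g x *s M x)" "v = (\<Sum>x\<in>S. h x *s M x)" by blast
      then have "u + v = (\<Sum>x\<in>S. (g x + h x) *s M x)" by (simp add: scale_left_distrib sum.distrib)
      then show "u + v \<in> {\<Sum>x\<in>S. g x *s M x | g. True}"
        by (intro CollectI exI[of _ "\<lambda>x. g x + h x"]) simp
    next
      fix c u assume "u \<in> {\<Sum>x\<in>S. g x *s M x | g. True}"
      then obtain g where "u = (\<Sum>x\<in>S. g x *s M x)" by blast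
      then have "c *s u = (\<Sum>x\<in>S. (c * g x) *s M x)" by (simp add: scale_sum_right)
      then show "c *s u \<in> {\<Sum>x\<in>S. g x *s M x | g. True}"
        by (intro CollectI exI[of _ "\<lambda>x. c * g x"]) simp
    qed
  qed
  show "{\<Sum>x\<in>S. g x *s M x | g. True} \<subseteq> span (M ` S)"
  proof clarify
    fix g show "(\<Sum>x\<in>S. g x *s M x) \<in> span (M ` S)"
      by (intro span_sum span_scale span_base imageI)
  qed
qed

lemma family_independent:
  assumes fin: "finite S"
    and indep: "\<And>g x. (\<Sum>y\<in>S. g y *s N y) = 0 \<Longrightarrow> x \<in> S \<Longrightarrow> g x = 0"
  shows "inj_on N S" "independent (N ` S)"
proof -
  show inj: "inj_on N S"
  proof (rule inj_onI, rule ccontr)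
    fix u v assume uv: "u \<in> S" "v \<in> S" "N u = N v" "u \<noteq> v"
    let ?g = "\<lambda>y. (if y = u then 1 else 0) - (if y = v then 1 else 0) :: 'a"
    have "(\<Sum>y\<in>S. ?g y *s N y) = N u - N v"
      using fin uv by (simp add: scale_left_diff_distrib sum_subtractf if_distrib[of "\<lambda>c. c *s _"] cong: if_cong)
    also have "\<dots> = 0" using uv by simp
    finally have "?g u = 0" using indep[of ?g u] uv(1) by blast
    then show False using uv by simp
  qed
  show "independent (N ` S)"
  proof
    assume "dependent (N ` S)"
    then obtain h v where h: "v \<in> N ` S" "h v \<noteq> 0" "(\<Sum>v\<in>N ` S. h v *s v) = 0"
      using fin by (auto simp: dependent_finite)
    then have "(\<Sum>y\<in>S. h (N y) *s N y) = 0" by (simp add: sum.reindex inj)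
    then show False using h(1,2) indep[of "\<lambda>y. h (N y)"] by auto
  qed
qed

text \<open>The span of the family \<open>M\<close> contains \<open>card S\<close> independent
  vectors. A relation with a nonzero coefficient would let one member of \<open>M\<close> be
  dropped, leaving too few to span.\<close>

lemma spanning_family_indep:
  assumes fin: "finite S"
    and indep: "\<And>g x. (\<Sum>y\<in>S. g y *s N y) = 0 \<Longrightarrow> x \<in> S \<Longrightarrow> g x = 0"
    and span: "\<And>x. x \<in> S \<Longrightarrow> N x \<in> span (M ` S)"
    and rel: "(\<Sum>y\<in>S. g y *s M y) = 0" and x: "x \<in> S"
  shows "g x = 0"
proof (rule ccontr)
  assume gx: "g x \<noteq> 0"
  have inj: "inj_on N S" and ind: "independent (N ` S)"
    using family_independent[of S N] fin indep by blast+
  have eq: "g x *s M x + (\<Sum>y\<in>S - {x}. g y *s M y) = 0"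
    using rel by (simp add: sum.remove[OF fin x])
  have "M x = (- inverse (g x)) *s (\<Sum>y\<in>S - {x}. g y *s M y)"
    using gx arg_cong[OF eq[unfolded eq_neg_iff_add_eq_0[symmetric]], of "scale (inverse (g x))"]
    by simp
  moreover have "(- inverse (g x)) *s (\<Sum>y\<in>S - {x}. g y *s M y) \<in> span (M ` (S - {x}))"
    by (intro span_scale span_sum span_base) auto
  ultimately have "M x \<in> span (M ` (S - {x}))" by simp
  then have "M u \<in> span (M ` (S - {x}))" if "u \<in> S" for u
    using that by (cases "u = x") (auto intro: span_base)
  then have "M ` S \<subseteq> span (M ` (S - {x}))" by auto
  then have "N ` S \<subseteq> span (M ` (S - {x}))"
    using span span_minimal[OF _ subspace_span] by blast
  then have "card (N ` S) \<le> card (M ` (S - {x}))"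
    using independent_span_bound[of "M ` (S - {x})" "N ` S"] ind fin by simp
  also have "\<dots> \<le> card (S - {x})" using fin by (intro card_image_le) simp
  also have "\<dots> < card S" using fin x by (intro psubset_card_mono) auto
  finally show False using inj by (simp add: card_image)
qed

lemma spanning_family_span:
  assumes fin: "finite S"
    and indep: "\<And>g x. (\<Sum>y\<in>S. g y *s N y) = 0 \<Longrightarrow> x \<in> S \<Longrightarrow> g x = 0"
    and span: "\<And>x. x \<in> S \<Longrightarrow> N x \<in> span (M ` S)"
  shows "span (N ` S) = span (M ` S)"
proof
  have inj: "inj_on N S" and ind: "independent (N ` S)"
    using family_independent[of S N] fin indep by blast+
  show "span (N ` S) \<subseteq> span (M ` S)" using span by (intro span_minimal) auto
  have "M x \<in> span (N ` S)" if x: "x \<in> S" for x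
  proof (rule ccontr)
    assume M: "M x \<notin> span (N ` S)"
    then have "independent (insert (M x) (N ` S))" using ind by (intro independent_insertI)
    moreover have "insert (M x) (N ` S) \<subseteq> span (M ` S)" using span x by (auto intro: span_base)
    ultimately have "card (insert (M x) (N ` S)) \<le> card (M ` S)"
      using independent_span_bound[of "M ` S" "insert (M x) (N ` S)"] fin by simp
    moreover have "M x \<notin> N ` S" using M by (auto intro: span_base)
    ultimately have "Suc (card S) \<le> card S"
      using fin inj card_image_le[OF fin, of M] by (simp add: card_image)
    then show False by simp
  qed
  then show "span (M ` S) \<subseteq> span (N ` S)" by (intro span_minimal) auto
qed

end

context root_calculus
begin

section \<open>Cancelling basis forms in pairs\<close>

text \<open>The indices of the five terms of the derivative. The exponent of \<open>a\<close> is
  cyclic, with \<open>r - 1\<close> for -1; those of \<open>b\<close> and \<open>c\<close> are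
  truncated and meaningful only where the corresponding \<open>can_\<close> predicate holds.\<close>

fun al_code et_code et2_code be_code ga_code :: "code \<Rightarrow> code" where
  "al_code (i, j, k, l, u, v, w) = (True, j, k, l, u, v, w)"
| "et_code (i, j, k, l, u, v, w) = (i, True, k, l, u, v, w)"
| "et2_code (i, j, k, l, u, v, w) = (i, True, k, l, u, v - 1, w - 1)"
| "be_code (i, j, k, l, u, v, w) = (i, j, True, l, Suc u mod r, v, w - 1)"
| "ga_code (i, j, k, l, u, v, w) = (i, j, k, True, (u + (r - 1)) mod r, v - 1, w)"

fun can_et can_et2 can_be can_ga :: "code \<Rightarrow> bool" where
  "can_et (i, j, k, l, u, v, w) = (\<not> j)"
| "can_et2 (i, j, k, l, u, v, w) = (\<not> j \<and> 0 < v \<and> 0 < w)"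
| "can_be (i, j, k, l, u, v, w) = (\<not> k \<and> 0 < w)"
| "can_ga (i, j, k, l, u, v, w) = (\<not> l \<and> 0 < v)"

fun has_al has_et :: "code \<Rightarrow> bool" where
  "has_al (i, j, k, l, u, v, w) = i"
| "has_et (i, j, k, l, u, v, w) = j"

text \<open>The \<beta> and \<gamma> coefficients must be invertible where these terms are used for
  cancellation, hence the equivalences. For the \<eta> terms it is enough to know where they can
  occur.\<close>

lemma dif_code:
  assumes "x \<in> codes"
  obtains cb cg ce ce2 where
    "dif (fdeg x) (bs x) = (of_bool (\<not> has_al x) * (wt x - 1)) \<bullet> bs (al_code x) + cb \<bullet> bs (be_code x)
       + cg \<bullet> bs (ga_code x) + ce \<bullet> bs (et_code x) + ce2 \<bullet> bs (et2_code x)"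
    "cb \<noteq> 0 \<longleftrightarrow> can_be x" "cg \<noteq> 0 \<longleftrightarrow> can_ga x" "ce \<noteq> 0 \<Longrightarrow> can_et x" "ce2 \<noteq> 0 \<Longrightarrow> can_et2 x"
proof -
  obtain i j k l u v w where x: "x = (i, j, k, l, u, v, w)" by (cases x)
  have lt: "u < r" "v < r" "w < r" using assms by (auto simp: x codes_def)
  have 1: "mon (Suc u mod r) n n' = mon (Suc u) n n'" for n n'
    by (simp add: mon_def a_pow_mod del: power_Suc)
  have 2: "mon ((u + (r - 1)) mod r) n n' = ai * mon u n n'" for n n'
    by (simp only: mon_def a_pow_mod) (simp add: ai_eq power_add power_commutes mult.assoc add.commute[of u])
  have [simp]: "qint n \<noteq> 0 \<longleftrightarrow> 0 < n" if "n < r" for n using qint_nz[of n] that by (cases n) auto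
  let ?s = "sg i * sg j * sg k * sg l"
  let ?cb = "of_bool (\<not> k) * (?s * sg l * (\<mu> * qint w * q ^ v))"
  let ?cg = "of_bool (\<not> l) * (?s * (\<mu> * qint v * q ^ w))"
  let ?ce = "of_bool (\<not> j) * (?s * sg k * fac l (- (p\<^sup>2)) * p\<^sup>2 * p ^ (u + v + w) - p\<^sup>2 * sg i)"
  let ?ce2 = "of_bool (\<not> j) * (?s * sg k * fac l (- (p\<^sup>2)) * (\<mu> * qint w * (q ^ v - p ^ v) * p ^ u))"
  show ?thesis
  proof (rule that)
    show "dif (fdeg x) (bs x) = (of_bool (\<not> has_al x) * (wt x - 1)) \<bullet> bs (al_code x) + ?cb \<bullet> bs (be_code x)
       + ?cg \<bullet> bs (ga_code x) + ?ce \<bullet> bs (et_code x) + ?ce2 \<bullet> bs (et2_code x)"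
      using dif_bs[of i j k l u v w]
      by (simp only: x be_code.simps al_code.simps ga_code.simps et_code.simps et2_code.simps bs.simps 1 2 has_al.simps)
    show "?cb \<noteq> 0 \<longleftrightarrow> can_be x" "?cg \<noteq> 0 \<longleftrightarrow> can_ga x"
      using lt by (auto simp: x sg_def mu_nz q_nz)
    show "?ce \<noteq> 0 \<Longrightarrow> can_et x" "?ce2 \<noteq> 0 \<Longrightarrow> can_et2 x"
      using lt by (cases v; auto simp: x)+
  qed
qed

text \<open>Trading one \<open>c\<close> for \<beta> pairs all values of (\<open>k\<close>,
  \<open>w\<close>) except (no \<beta>, 0) and (\<beta>, r - 1). These unpaired values are singled
  out by \<open>wtop\<close>, and those for \<gamma> and \<open>b\<close> by
  \<open>vtop\<close>.\<close>

fun wtop vtop :: "code \<Rightarrow> bool" where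
  "wtop (i, j, k, l, u, v, w) = (w = (if k then r - 1 else 0))"
| "vtop (i, j, k, l, u, v, w) = (v = (if l then r - 1 else 0))"

fun bup cup :: "code \<Rightarrow> bool" where
  "bup (i, j, k, l, u, v, w) = (k \<and> w < r - 1)"
| "cup (i, j, k, l, u, v, w) = (l \<and> v < r - 1)"

text \<open>A matching in the sense of algebraic discrete Morse theory. At weight 1, \<beta> is
  tried first and \<gamma> only on what \<beta> leaves unmatched, so that no form is paired
  twice.\<close>

definition source :: "code \<Rightarrow> bool" where
  "source x \<longleftrightarrow> (if wt x \<noteq> 1 then \<not> has_al x else can_be x \<or> can_ga x \<and> wtop x)"

definition target :: "code \<Rightarrow> bool" where
  "target x \<longleftrightarrow> (if wt x \<noteq> 1 then has_al x else bup x \<or> cup x \<and> wtop x)"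

definition critical :: "code \<Rightarrow> bool" where
  "critical x \<longleftrightarrow> wt x = 1 \<and> wtop x \<and> vtop x"

definition up :: "code \<Rightarrow> code" where
  "up x = (if wt x \<noteq> 1 then al_code x else if can_be x then be_code x else ga_code x)"

fun un_al un_be un_ga :: "code \<Rightarrow> code" where
  "un_al (i, j, k, l, u, v, w) = (False, j, k, l, u, v, w)"
| "un_be (i, j, k, l, u, v, w) = (i, j, False, l, (u + (r - 1)) mod r, v, Suc w)"
| "un_ga (i, j, k, l, u, v, w) = (i, j, k, False, Suc u mod r, Suc v, w)"

definition down :: "code \<Rightarrow> code" where
  "down x = (if wt x \<noteq> 1 then un_al x else if bup x then un_be x else un_ga x)"

lemma trichotomy:
  assumes "x \<in> codes"
  shows "source x \<or> target x \<or> critical x" "\<not> (source x \<and> target x)" "\<not> (source x \<and> critical x)" "\<not> (target x \<and> critical x)"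
  using assms r_ge
  by (cases x; auto simp: source_def target_def critical_def codes_def split: if_splits)+

lemma q_mod1: "q ^ ((u + (r - 1)) mod r) = p * q ^ u" "q ^ (Suc u mod r) = q * q ^ u"
proof -
  have "q ^ (r - 1) = p"
    using q_root r_ge by (cases r) (auto simp: p_def field_simps q_nz)
  then show "q ^ ((u + (r - 1)) mod r) = p * q ^ u" by (simp only: pow_mod power_add mult.commute)
qed (simp add: pow_mod)

text \<open>In the \<beta> step \<open>p^2\<close> is compensated by one more \<open>a\<close> and
  one \<open>c\<close> less, in the \<gamma> step \<open>q^2\<close> by one \<open>a\<close> and one
  \<open>b\<close> less. So matched partners fall under the same case of \<open>source\<close> and
  \<open>target\<close>.\<close>

lemma wt_invariant:
  shows "wt (al_code x) = wt x" "wt (et_code x) = wt x" "can_et2 x \<Longrightarrow> wt (et2_code x) = wt x"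
    "can_be x \<Longrightarrow> wt (be_code x) = wt x" "can_ga x \<Longrightarrow> wt (ga_code x) = wt x"
    "wt (un_al x) = wt x" "bup x \<Longrightarrow> wt (un_be x) = wt x" "cup x \<Longrightarrow> wt (un_ga x) = wt x"
proof -
  have [simp]: "q ^ v * p ^ w = q ^ (v - 1) * p ^ (w - 1)" if "0 < v" "0 < w" for v w
    using that by (cases v; cases w) (auto simp: qp mult_ac)
  show "wt (al_code x) = wt x" "wt (et_code x) = wt x" "wt (un_al x) = wt x"
    by (cases x; simp)+
  show "can_et2 x \<Longrightarrow> wt (et2_code x) = wt x" by (cases x) (auto simp: mult.assoc)
  show "can_be x \<Longrightarrow> wt (be_code x) = wt x"
    by (cases x) (auto simp: q_mod1[unfolded One_nat_def] fac_def power2_eq_square gr0_conv_Suc qp mult_ac)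
  show "can_ga x \<Longrightarrow> wt (ga_code x) = wt x"
    by (cases x) (auto simp: q_mod1[unfolded One_nat_def] fac_def power2_eq_square gr0_conv_Suc qp mult_ac)
  show "bup x \<Longrightarrow> wt (un_be x) = wt x"
    by (cases x) (auto simp: q_mod1[unfolded One_nat_def] fac_def power2_eq_square gr0_conv_Suc qp mult_ac)
  show "cup x \<Longrightarrow> wt (un_ga x) = wt x"
    by (cases x) (auto simp: q_mod1[unfolded One_nat_def] fac_def power2_eq_square gr0_conv_Suc qp mult_ac)
qed

lemma mod_shift:
  assumes "u < r"
  shows "(Suc u mod r + r - Suc 0) mod r = u" "Suc ((u + r - Suc 0) mod r) mod r = u"
proof -
  have *: "(n + r - Suc 0) = n + (r - Suc 0)" "Suc (u + (r - Suc 0)) = u + r" "Suc u + (r - Suc 0) = u + r" for n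
    using r_ge by simp_all
  show "(Suc u mod r + r - Suc 0) mod r = u" "Suc ((u + r - Suc 0) mod r) mod r = u"
    using assms unfolding *(1) mod_add_left_eq mod_Suc_eq *(2,3) by simp_all
qed

lemma source_up:
  assumes "x \<in> codes" "source x"
  shows "up x \<in> codes" "target (up x)" "down (up x) = x" "fdeg (up x) = Suc (fdeg x)"
    "has_et (up x) = has_et x" "wt (up x) = wt x"
proof -
  obtain i j k l u v w where x: "x = (i, j, k, l, u, v, w)" by (cases x)
  have lt: "u < r" "v < r" "w < r" using assms by (auto simp: x codes_def)
  consider "wt x \<noteq> 1" "up x = al_code x" | "wt x = 1" "can_be x" "up x = be_code x"
    | "wt x = 1" "\<not> can_be x" "can_ga x" "wtop x" "up x = ga_code x"
    using assms(2) by (auto simp: source_def up_def split: if_splits)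
  then have "up x \<in> codes \<and> target (up x) \<and> down (up x) = x \<and> fdeg (up x) = Suc (fdeg x)
    \<and> has_et (up x) = has_et x \<and> wt (up x) = wt x"
  proof cases
    case 1
    then have "\<not> has_al x" using assms(2) by (simp add: source_def)
    then show ?thesis using 1 lt wt_invariant(1)[of x]
      by (auto simp: target_def down_def x codes_def simp del: wt.simps)
  next
    case 2
    then show ?thesis using lt wt_invariant(4)[of x]
      by (auto simp: target_def down_def x codes_def mod_shift simp del: wt.simps)
  next
    case 3
    then show ?thesis using lt wt_invariant(5)[of x]
      by (auto simp: target_def down_def x codes_def mod_shift simp del: wt.simps)
  qed
  then show "up x \<in> codes" "target (up x)" "down (up x) = x" "fdeg (up x) = Suc (fdeg x)"
    "has_et (up x) = has_et x" "wt (up x) = wt x" by auto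
qed

lemma target_down:
  assumes "x \<in> codes" "target x"
  shows "down x \<in> codes" "source (down x)" "up (down x) = x" "Suc (fdeg (down x)) = fdeg x"
proof -
  obtain i j k l u v w where x: "x = (i, j, k, l, u, v, w)" by (cases x)
  have lt: "u < r" "v < r" "w < r" using assms by (auto simp: x codes_def)
  consider "wt x \<noteq> 1" "has_al x" "down x = un_al x" | "wt x = 1" "bup x" "down x = un_be x"
    | "wt x = 1" "\<not> bup x" "cup x" "wtop x" "down x = un_ga x"
    using assms(2) by (auto simp: target_def down_def split: if_splits)
  then have "down x \<in> codes \<and> source (down x) \<and> up (down x) = x \<and> Suc (fdeg (down x)) = fdeg x"
  proof cases
    case 1
    then show ?thesis using lt wt_invariant(6)[of x]
      by (auto simp: source_def up_def x codes_def simp del: wt.simps)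
  next
    case 2
    then show ?thesis using lt wt_invariant(7)[of x]
      by (auto simp: source_def up_def x codes_def mod_shift simp del: wt.simps)
  next
    case 3
    then show ?thesis using lt wt_invariant(8)[of x]
      by (auto simp: source_def up_def x codes_def mod_shift simp del: wt.simps)
  qed
  then show "down x \<in> codes" "source (down x)" "up (down x) = x" "Suc (fdeg (down x)) = fdeg x" by auto
qed

text \<open>Relative to this rank the matching is triangular: the remaining terms of the derivative of a
  source are sources again, except for those containing \<open>\<eta>\<close>.\<close>

definition rank :: "code \<Rightarrow> nat" where
  "rank x = (if source x then 0 else if has_et x then 1 else 2)"

definition below :: "code \<Rightarrow> code set" where
  "below x = {z \<in> codes. fdeg z = fdeg x \<and> rank z < rank x}"

text \<open>The unmatched terms are lower for these reasons. At weight other than 1 the \<beta> and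
  \<gamma> terms still lack \<alpha> and are sources; in a \<beta> step the \<gamma> term can still
  be moved by \<beta>; in a \<gamma> step the \<beta> term is absent. The \<eta> terms occur only if
  \<open>x\<close> has no \<eta>, and then \<open>up x\<close> has rank 2.\<close>

lemma dif_source:
  assumes x: "x \<in> codes" "source x"
  shows "\<exists>c0 e. c0 \<noteq> 0 \<and> e \<in> lop.span (bs ` below (up x)) \<and> dif (fdeg x) (bs x) = c0 \<bullet> bs (up x) + e"
proof -
  obtain cb cg ce ce2 where dif:
    "dif (fdeg x) (bs x) = (of_bool (\<not> has_al x) * (wt x - 1)) \<bullet> bs (al_code x) + cb \<bullet> bs (be_code x)
       + cg \<bullet> bs (ga_code x) + ce \<bullet> bs (et_code x) + ce2 \<bullet> bs (et2_code x)"
    and cb: "cb \<noteq> 0 \<longleftrightarrow> can_be x" and cg: "cg \<noteq> 0 \<longleftrightarrow> can_ga x"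
    and ce: "ce \<noteq> 0 \<Longrightarrow> can_et x" and ce2: "ce2 \<noteq> 0 \<Longrightarrow> can_et2 x"
    using dif_code[OF x(1)] by metis
  obtain i j k l u v w where xe: "x = (i, j, k, l, u, v, w)" by (cases x)
  have lt: "u < r" "v < r" "w < r" using x by (auto simp: xe codes_def)
  note up = source_up[OF x]
  have rank_up: "rank (up x) = (if has_et x then 1 else 2)"
    using up trichotomy[OF up(1)] by (simp add: rank_def)
  have below: "z \<in> codes \<Longrightarrow> fdeg z = Suc (fdeg x) \<Longrightarrow> rank z < rank (up x) \<Longrightarrow> e \<bullet> bs z \<in> lop.span (bs ` below (up x))" for z e
    using up by (intro lop.span_scale lop.span_base imageI) (simp add: below_def)
  have rank0: "rank z < rank (up x)" if "source z" for z using that rank_up by (simp add: rank_def)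
  have et_rank: "rank z < rank (up x)" if "wt z = wt x" "has_et z" "has_al z = has_al x" "\<not> has_et x" for z
    using that x rank_up by (auto simp: rank_def source_def)
  have et: "ce \<bullet> bs (et_code x) \<in> lop.span (bs ` below (up x))"
  proof (cases "ce = 0")
    case False
    then have "can_et x" by (rule ce)
    then show ?thesis using lt wt_invariant(2)[of x]
      by (intro below et_rank) (auto simp: xe codes_def simp del: wt.simps)
  qed (simp add: lop.span_zero)
  have et2: "ce2 \<bullet> bs (et2_code x) \<in> lop.span (bs ` below (up x))"
  proof (cases "ce2 = 0")
    case False
    then have "can_et2 x" by (rule ce2)
    then show ?thesis using lt wt_invariant(3)[of x]
      by (intro below et_rank) (auto simp: xe codes_def simp del: wt.simps)
  qed (simp add: lop.span_zero)
  have be: "cb \<bullet> bs (be_code x) \<in> lop.span (bs ` below (up x))" if "wt x \<noteq> 1 \<or> \<not> can_be x"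
  proof (cases "cb = 0")
    case False
    then have "can_be x" "wt x \<noteq> 1" using cb that by auto
    then show ?thesis using lt wt_invariant(4)[of x] x(2)
      by (intro below rank0) (auto simp: source_def xe codes_def simp del: wt.simps)
  qed (simp add: lop.span_zero)
  have ga: "cg \<bullet> bs (ga_code x) \<in> lop.span (bs ` below (up x))" if "wt x \<noteq> 1 \<or> can_be x"
  proof (cases "cg = 0")
    case False
    then have "can_ga x" using cg by auto
    then show ?thesis using lt wt_invariant(5)[of x] x(2) that
      by (intro below rank0) (auto simp: source_def xe codes_def simp del: wt.simps)
  qed (simp add: lop.span_zero)
  consider "wt x \<noteq> 1" "up x = al_code x" "\<not> has_al x" | "wt x = 1" "can_be x" "up x = be_code x"
    | "wt x = 1" "\<not> can_be x" "can_ga x" "up x = ga_code x"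
    using x(2) by (auto simp: source_def up_def split: if_splits)
  then show ?thesis
  proof cases
    case 1
    show ?thesis
    proof (intro exI conjI)
      show "cb \<bullet> bs (be_code x) + (cg \<bullet> bs (ga_code x) + (ce \<bullet> bs (et_code x) + ce2 \<bullet> bs (et2_code x))) \<in> lop.span (bs ` below (up x))"
        using 1 by (intro lop.span_add be ga et et2) auto
      show "wt x - 1 \<noteq> 0" using 1 by simp
    qed (use 1 in \<open>simp add: dif\<close>)
  next
    case 2
    show ?thesis
    proof (intro exI conjI)
      show "cg \<bullet> bs (ga_code x) + (ce \<bullet> bs (et_code x) + ce2 \<bullet> bs (et2_code x)) \<in> lop.span (bs ` below (up x))"
        using 2 by (intro lop.span_add ga et et2) auto
      show "cb \<noteq> 0" using 2 cb by simp
    qed (use 2 in \<open>simp add: dif\<close>)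
  next
    case 3
    show ?thesis
    proof (intro exI conjI)
      show "cb \<bullet> bs (be_code x) + (ce \<bullet> bs (et_code x) + ce2 \<bullet> bs (et2_code x)) \<in> lop.span (bs ` below (up x))"
        using 3 by (intro lop.span_add be et et2) auto
      show "cg \<noteq> 0" using 3 cg by simp
    qed (use 3 in \<open>simp add: dif\<close>)
  qed
qed

section \<open>Splitting the complex along the matching\<close>

definition dcodes :: "nat \<Rightarrow> code set" where "dcodes n = {x \<in> codes. fdeg x = n}"
definition crit :: "nat \<Rightarrow> code set" where "crit n = {x \<in> dcodes n. critical x}"
definition forms :: "nat \<Rightarrow> cell lop set" where "forms n = lop.span (bs ` dcodes n)"
definition exact :: "nat \<Rightarrow> cell lop set" where
  "exact n = (case n of 0 \<Rightarrow> {0} | Suc k \<Rightarrow> dif k ` forms k)"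

lemma finite_dcodes [simp]: "finite (dcodes n)" and finite_crit [simp]: "finite (crit n)"
  using finite_codes by (simp_all add: dcodes_def crit_def)

lemma dif_add: "dif n (x + x') = dif n x + dif n x'"
  by (simp add: dif_def distrib_left distrib_right lop.scale_right_distrib)
lemma dif_scale: "dif n (s \<bullet> x) = s \<bullet> dif n x"
  by (simp add: dif_def scale_simps lop.scale_right_diff_distrib mult.commute)
lemma dif_0: "dif n 0 = 0" by (simp add: dif_def)
lemma dif_sum: "dif n (\<Sum>x\<in>S. g x \<bullet> M x) = (\<Sum>x\<in>S. g x \<bullet> dif n (M x))"
  by (induction S rule: infinite_finite_induct) (simp_all add: dif_0 dif_add dif_scale)

lemma theta_theta: "theta_op * theta_op = 0"
  by (simp add: theta_op_def distrib_left distrib_right scale_simps form_swaps)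

text \<open>A graded commutator with an odd element of square zero squares to zero.\<close>

lemma dif_dif: "dif (Suc n) (dif n x) = 0"
proof -
  have 1: "x * theta_op * theta_op = 0" "theta_op * (theta_op * x) = 0"
    by (simp_all add: mult.assoc theta_theta) (simp add: theta_theta flip: mult.assoc)
  show ?thesis
    by (cases "even n") (simp_all add: dif_def left_diff_distrib right_diff_distrib scale_simps 1
        lop.scale_right_diff_distrib mult.assoc theta_theta)
qed

text \<open>The splitting needs only closed representatives led by the critical forms. Keeping them
  as a parameter allows the forms of the theorem themselves to be inserted, without comparing two
  bases of the cohomology.\<close>

definition crit_rep :: "(code \<Rightarrow> cell lop) \<Rightarrow> bool" where
  "crit_rep z \<longleftrightarrow> (\<forall>x\<in>codes. critical x \<longrightarrow> dif (fdeg x) (z x) = 0 \<and>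
     (\<exists>s e. s \<noteq> 0 \<and> e \<in> lop.span (bs ` below x) \<and> z x = s \<bullet> bs x + e))"

text \<open>The basis in which the derivative becomes a partial bijection: sources, their derivatives, and
  closed representatives of the critical forms.\<close>

definition vf :: "(code \<Rightarrow> cell lop) \<Rightarrow> code \<Rightarrow> cell lop" where
  "vf z x = (if source x then bs x else if target x then dif (fdeg (down x)) (bs (down x)) else z x)"

lemma vf_step:
  assumes "crit_rep z" "x \<in> codes"
  shows "\<exists>s e. s \<noteq> 0 \<and> e \<in> lop.span (bs ` below x) \<and> vf z x = s \<bullet> bs x + e"
proof -
  consider "source x" | "target x" "\<not> source x" | "critical x" "\<not> source x" "\<not> target x"
    using trichotomy[OF assms(2)] by blast
  then show ?thesis
  proof cases
    case 1
    then show ?thesis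
      by (intro exI[of _ 1] exI[of _ 0]) (simp add: vf_def lop.span_zero lop.scale_one)
  next
    case 2
    note t = target_down[OF assms(2) 2(1)]
    show ?thesis using dif_source[OF t(1,2)] 2 unfolding t(3) by (simp add: vf_def)
  next
    case 3
    then show ?thesis using assms by (auto simp: vf_def crit_rep_def)
  qed
qed

text \<open>Induction on the rank inverts the triangular system given by
  \<open>vf_step\<close>.\<close>

lemma bs_in_span_vf:
  assumes z: "crit_rep z" and x: "x \<in> dcodes n"
  shows "bs x \<in> lop.span (vf z ` dcodes n)"
  using x
proof (induction "rank x" arbitrary: x rule: less_induct)
  case less
  have "x \<in> codes" using less.prems by (simp add: dcodes_def)
  then obtain s e where se: "s \<noteq> 0" "e \<in> lop.span (bs ` below x)" "vf z x = s \<bullet> bs x + e"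
    using vf_step[OF z] by blast
  have "bs ` below x \<subseteq> lop.span (vf z ` dcodes n)"
    using less by (auto simp: below_def dcodes_def)
  then have "e \<in> lop.span (vf z ` dcodes n)"
    using se(2) lop.span_minimal[OF _ lop.subspace_span] by blast
  moreover have "vf z x \<in> lop.span (vf z ` dcodes n)"
    using less.prems by (intro lop.span_base imageI)
  moreover have "bs x = inverse s \<bullet> (vf z x - e)" using se by (simp add: lop.scale_one)
  ultimately show ?case by (metis lop.span_scale lop.span_diff)
qed

lemma vf_indep:
  assumes "crit_rep z" "(\<Sum>x\<in>dcodes n. g x \<bullet> vf z x) = 0" "x \<in> dcodes n"
  shows "g x = 0"
  by (rule lop.spanning_family_indep[OF finite_dcodes _ bs_in_span_vf[OF assms(1)] assms(2,3)])
    (auto intro: bs_indep[of "dcodes n"] simp: dcodes_def)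

lemma forms_vf:
  assumes "crit_rep z" "x \<in> forms n"
  obtains g where "x = (\<Sum>u\<in>dcodes n. g u \<bullet> vf z u)"
proof -
  have "x \<in> lop.span (vf z ` dcodes n)"
    using assms(2) unfolding forms_def
    by (rule rev_subsetD) (intro lop.span_minimal lop.subspace_span image_subsetI bs_in_span_vf assms)
  then show ?thesis using that by (auto simp: lop.span_family)
qed

lemma sum_dcodes_split:
  "(\<Sum>x\<in>dcodes n. f x :: 'e::comm_monoid_add) = (\<Sum>x\<in>{x \<in> dcodes n. source x}. f x)
    + (\<Sum>x\<in>{x \<in> dcodes n. target x}. f x) + (\<Sum>x\<in>crit n. f x)"
proof -
  have codes: "dcodes n \<subseteq> codes" by (auto simp: dcodes_def)
  have "dcodes n = {x \<in> dcodes n. source x} \<union> {x \<in> dcodes n. target x} \<union> crit n"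
    using codes trichotomy(1) unfolding crit_def by blast
  moreover have "{x \<in> dcodes n. source x} \<inter> {x \<in> dcodes n. target x} = {}"
    "({x \<in> dcodes n. source x} \<union> {x \<in> dcodes n. target x}) \<inter> crit n = {}"
    using codes trichotomy(2-4) unfolding crit_def by blast+
  ultimately show ?thesis by (metis (no_types, lifting) sum.union_disjoint finite_Un finite_dcodes)
qed

text \<open>Vectors at targets are killed because the derivative squares to zero, those at critical
  codes because the representatives are closed; the sources are reindexed along
  \<open>up\<close>.\<close>

lemma dif_vf_sum:
  assumes "crit_rep z"
  shows "dif n (\<Sum>x\<in>dcodes n. g x \<bullet> vf z x) =
    (\<Sum>x\<in>{x \<in> dcodes (Suc n). target x}. g (down x) \<bullet> vf z x)"
proof -
  have "dif n (\<Sum>x\<in>dcodes n. g x \<bullet> vf z x) = (\<Sum>x\<in>dcodes n. g x \<bullet> dif n (vf z x))" by (rule dif_sum)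
  also have "\<dots> = (\<Sum>x\<in>{x \<in> dcodes n. source x}. g x \<bullet> dif n (vf z x))"
  proof -
    have "dif n (vf z x) = 0" if "x \<in> dcodes n" "target x" for x
    proof -
      have x: "x \<in> codes" "fdeg x = n" using that by (auto simp: dcodes_def)
      have "\<not> source x" using trichotomy(2)[OF x(1)] that by blast
      then show ?thesis
        using target_down(4)[OF x(1) that(2)] that(2) x(2) dif_dif[of "fdeg (down x)"] by (simp add: vf_def)
    qed
    moreover have "dif n (vf z x) = 0" if "x \<in> crit n" for x
    proof -
      have x: "x \<in> codes" "fdeg x = n" "critical x" using that by (auto simp: dcodes_def crit_def)
      have "\<not> source x" "\<not> target x" using trichotomy(3,4)[OF x(1)] x by blast+
      then show ?thesis using assms x by (auto simp: vf_def crit_rep_def)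
    qed
    ultimately show ?thesis unfolding sum_dcodes_split[of _ n] by simp
  qed
  also have "\<dots> = (\<Sum>x\<in>{x \<in> dcodes (Suc n). target x}. g (down x) \<bullet> vf z x)"
  proof (rule sum.reindex_bij_witness[of _ down up])
    fix x assume "x \<in> {x \<in> dcodes n. source x}"
    then have x: "x \<in> codes" "source x" "fdeg x = n" by (auto simp: dcodes_def)
    note up = source_up[OF x(1,2)]
    show "down (up x) = x" "up x \<in> {x \<in> dcodes (Suc n). target x}"
      using up x by (auto simp: dcodes_def)
    have "\<not> source (up x)" using trichotomy(2)[OF up(1)] up by blast
    then show "g (down (up x)) \<bullet> vf z (up x) = g x \<bullet> dif n (vf z x)"
      using up x by (simp add: vf_def)
  next
    fix x assume "x \<in> {x \<in> dcodes (Suc n). target x}"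
    then have x: "x \<in> codes" "target x" "fdeg x = Suc n" by (auto simp: dcodes_def)
    show "up (down x) = x" "down x \<in> {x \<in> dcodes n. source x}"
      using target_down[OF x(1,2)] x by (auto simp: dcodes_def)
  qed
  finally show ?thesis .
qed

lemma closed_decomp:
  assumes z: "crit_rep z" and x: "x \<in> forms n" "dif n x = 0"
  obtains g where "x - (\<Sum>u\<in>crit n. g u \<bullet> z u) \<in> exact n"
proof -
  obtain g where g: "x = (\<Sum>u\<in>dcodes n. g u \<bullet> vf z u)" using forms_vf[OF z x(1)] .
  \<comment> \<open>The coefficients of \<open>dif n x\<close> one degree higher; by independence
    there, closedness kills the source coefficients of \<open>x\<close>.\<close>
  let ?h = "\<lambda>u. if target u then g (down u) else 0 :: complex"
  have "(\<Sum>u\<in>dcodes (Suc n). ?h u \<bullet> vf z u) = (\<Sum>u\<in>{u \<in> dcodes (Suc n). target u}. g (down u) \<bullet> vf z u)"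
    by (simp add: if_distrib[of "\<lambda>s. s \<bullet> _"] sum.inter_filter cong: if_cong)
  also have "\<dots> = 0" using dif_vf_sum[OF z, of n g] x(2) g by simp
  finally have h: "?h u = 0" if "u \<in> dcodes (Suc n)" for u using vf_indep[OF z, of ?h "Suc n"] that by blast
  have "g u = 0" if "u \<in> dcodes n" "source u" for u
  proof -
    have u: "u \<in> codes" "fdeg u = n" using that by (auto simp: dcodes_def)
    note up = source_up[OF u(1) that(2)]
    have "up u \<in> dcodes (Suc n)" using up u by (simp add: dcodes_def)
    then show ?thesis using h[of "up u"] up by simp
  qed
  then have "x - (\<Sum>u\<in>crit n. g u \<bullet> vf z u) = (\<Sum>u\<in>{u \<in> dcodes n. target u}. g u \<bullet> vf z u)"
    unfolding g sum_dcodes_split[of _ n] by simp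
  also have "\<dots> \<in> exact n"
  proof (cases n)
    case 0
    \<comment> \<open>A target has a partner of smaller degree, so degree 0 has none.\<close>
    have "{u \<in> dcodes n. target u} = {}" using target_down(4) 0 by (fastforce simp: dcodes_def)
    then show ?thesis by (simp only: exact_def 0) simp
  next
    case (Suc k)
    have t: "u \<in> codes" "target u" "\<not> source u" "fdeg (down u) = k" "down u \<in> dcodes k"
      if "u \<in> {u \<in> dcodes n. target u}" for u
      using that target_down[of u] trichotomy(2)[of u] Suc by (auto simp: dcodes_def)
    have "(\<Sum>u\<in>{u \<in> dcodes n. target u}. g u \<bullet> vf z u) = (\<Sum>u\<in>{u \<in> dcodes n. target u}. g u \<bullet> dif k (bs (down u)))"
    proof (rule sum.cong[OF refl])
      fix u assume "u \<in> {u \<in> dcodes n. target u}"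
      from t[OF this] show "g u \<bullet> vf z u = g u \<bullet> dif k (bs (down u))" by (simp add: vf_def)
    qed
    also have "\<dots> = dif k (\<Sum>u\<in>{u \<in> dcodes n. target u}. g u \<bullet> bs (down u))" by (rule dif_sum[symmetric])
    also have "\<dots> \<in> exact n"
      unfolding Suc exact_def forms_def nat.case
      by (intro imageI lop.span_sum lop.span_scale lop.span_base) (use t Suc in blast)
    finally show ?thesis .
  qed
  finally have "x - (\<Sum>u\<in>crit n. g u \<bullet> vf z u) \<in> exact n" .
  moreover have "vf z u = z u" if "u \<in> crit n" for u
    using that trichotomy(3,4)[of u] by (auto simp: vf_def crit_def dcodes_def)
  ultimately show ?thesis using that[of g] by (simp cong: sum.cong)
qed

lemma crit_indep:
  assumes z: "crit_rep z" and ex: "(\<Sum>u\<in>crit n. g u \<bullet> z u) \<in> exact n" and u: "u \<in> crit n"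
  shows "g u = 0"
proof -
  have crit: "vf z u = z u" "\<not> target u" "\<not> source u" if "u \<in> crit n" for u
    using that trichotomy(3,4)[of u] by (auto simp: vf_def crit_def dcodes_def)
  \<comment> \<open>Exact forms are combinations of the vectors at targets alone.\<close>
  obtain h where h: "(\<Sum>u\<in>crit n. g u \<bullet> z u) = (\<Sum>u\<in>{u \<in> dcodes n. target u}. h u \<bullet> vf z u)"
  proof (cases n)
    case 0
    then show ?thesis using ex that[of "\<lambda>_. 0"] by (simp add: exact_def)
  next
    case (Suc k)
    then obtain x where x: "x \<in> forms k" "(\<Sum>u\<in>crit n. g u \<bullet> z u) = dif k x"
      using ex by (auto simp: exact_def)
    obtain h where "x = (\<Sum>u\<in>dcodes k. h u \<bullet> vf z u)" using forms_vf[OF z x(1)] .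
    then have "(\<Sum>u\<in>crit n. g u \<bullet> z u) = (\<Sum>u\<in>{u \<in> dcodes n. target u}. h (down u) \<bullet> vf z u)"
      using dif_vf_sum[OF z, of k h] x(2) unfolding Suc by simp
    then show ?thesis by (rule that)
  qed
  \<comment> \<open>The difference of the two expansions, as one combination over all codes of
    degree \<open>n\<close>.\<close>
  let ?f = "\<lambda>u. if target u then - h u else if source u then 0 else g u :: complex"
  have "(\<Sum>u\<in>dcodes n. ?f u \<bullet> vf z u) = 0"
  proof -
    have "(\<Sum>u\<in>{u \<in> dcodes n. source u}. ?f u \<bullet> vf z u) = 0"
      using trichotomy(2) by (intro sum.neutral) (auto simp: dcodes_def)
    moreover have "(\<Sum>u\<in>{u \<in> dcodes n. target u}. ?f u \<bullet> vf z u) = - (\<Sum>u\<in>{u \<in> dcodes n. target u}. h u \<bullet> vf z u)"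
      by (simp add: sum_negf lop.scale_minus_left)
    moreover have "(\<Sum>u\<in>crit n. ?f u \<bullet> vf z u) = (\<Sum>u\<in>crit n. g u \<bullet> z u)"
      using crit by (intro sum.cong) simp_all
    ultimately show ?thesis unfolding sum_dcodes_split[of _ n] h by simp
  qed
  then have "?f u = 0" using u vf_indep[OF z, of ?f n u] by (auto simp: crit_def)
  then show ?thesis using crit[OF u] by simp
qed

end

section \<open>Spanning sets of presented algebras\<close>

lemma poly_mapping_expand: "f = (\<Sum>w\<in>Poly_Mapping.keys f. Poly_Mapping.single w (Poly_Mapping.lookup f w))"
  by (rule poly_mapping_eqI) (simp add: lookup_sum lookup_single when_def in_keys_iff)

lemma poly_mapping_single_induct [case_names single add]:
  fixes f :: "'k \<Rightarrow>\<^sub>0 'v::comm_monoid_add"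
  assumes "\<And>k v. Q (Poly_Mapping.single k v)" "\<And>f h. Q f \<Longrightarrow> Q h \<Longrightarrow> Q (f + h)"
  shows "Q f"
proof -
  have "Q (\<Sum>w\<in>S. Poly_Mapping.single w (Poly_Mapping.lookup f w))" if "finite S" for S
    using that
  proof (induction S rule: finite_induct)
    case empty
    show ?case using assms(1)[of _ 0] by simp
  qed (simp add: assms)
  then show ?thesis using poly_mapping_expand[of f] by (metis finite_keys)
qed

interpretation fa: complex_algebra "\<lambda>s f. scal s * f :: 'g free_alg"
proof -
  have comm: "f * scal s = scal s * f" for s and f :: "'g free_alg"
  proof (induction f rule: poly_mapping_single_induct)
    case (single k v)
    then show ?case by (simp add: scal_def mult_single mult.commute)
  qed (simp add: distrib_left distrib_right)
  show "complex_algebra (\<lambda>s f. scal s * f :: 'g free_alg)"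
  proof unfold_locales
    fix s t :: complex and x x' :: "'g free_alg"
    show "scal (s + t) * x = scal s * x + scal t * x" by (simp add: scal_def single_add distrib_right)
    show "scal s * (scal t * x) = scal (s * t) * x" by (simp add: scal_def mult_single flip: mult.assoc)
    show "scal 1 * x = x" by (simp add: scal_def)
    show "x * (scal s * x') = scal s * (x * x')" by (simp add: comm flip: mult.assoc)
  qed (simp_all add: distrib_left mult.assoc)
qed

text \<open>The algebra homomorphism out of the free algebra that sends the generators to
  \<open>g\<close>.\<close>

definition ev :: "('g \<Rightarrow> 'i lop) \<Rightarrow> 'g free_alg \<Rightarrow> 'i lop" where
  "ev g f = (\<Sum>w\<in>Poly_Mapping.keys f. cscale (Poly_Mapping.lookup f w) (prod_list (map g (letters w))))"

lemma ev_superset: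
  assumes "finite S" "Poly_Mapping.keys f \<subseteq> S"
  shows "ev g f = (\<Sum>w\<in>S. cscale (Poly_Mapping.lookup f w) (prod_list (map g (letters w))))"
  unfolding ev_def using assms by (intro sum.mono_neutral_left) (auto simp: in_keys_iff)

lemma ev_0 [simp]: "ev g 0 = 0" by (simp add: ev_def)

lemma ev_add: "ev g (f + h) = ev g f + ev g h"
proof -
  let ?S = "Poly_Mapping.keys f \<union> Poly_Mapping.keys h"
  have "Poly_Mapping.keys (f + h) \<subseteq> ?S" by (rule Poly_Mapping.keys_add)
  then show ?thesis
    by (simp add: ev_superset[of ?S] lookup_add lop.scale_left_distrib sum.distrib)
qed

lemma ev_single: "ev g (Poly_Mapping.single w s) = cscale s (prod_list (map g (letters w)))"
  by (simp add: ev_def)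

lemma ev_mult: "ev g (f * h) = ev g f * ev g h"
proof (induction f rule: poly_mapping_single_induct)
  case (single u s)
  show ?case
  proof (induction h rule: poly_mapping_single_induct)
    case (single v t)
    show ?case
      by (simp add: mult_single ev_single plus_fword_def lop.scale_mult_left lop.scale_mult_right)
  qed (simp add: ev_add distrib_left)
qed (simp add: ev_add distrib_right)

lemma ev_gen [simp]: "ev g (gen x) = g x" by (simp add: gen_def ev_single lop.scale_one)
lemma ev_scal [simp]: "ev g (scal s) = cscale s 1" by (simp add: scal_def ev_single zero_fword_def)
lemma ev_1 [simp]: "ev g 1 = 1" using ev_scal[of g 1] by (simp add: scal_def lop.scale_one)
lemma ev_uminus: "ev g (- f) = - ev g f"
  using ev_add[of g f "- f"] by (simp add: eq_neg_iff_add_eq_0 add.commute)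
lemma ev_diff: "ev g (f - h) = ev g f - ev g h"
  using ev_add[of g f "- h"] by (simp add: ev_uminus)
lemma ev_power: "ev g (f ^ n) = ev g f ^ n" by (induction n) (simp_all add: ev_mult)
lemma ev_sum: "ev g (sum F S) = (\<Sum>x\<in>S. ev g (F x))"
  by (induction S rule: infinite_finite_induct) (simp_all add: ev_add)
lemma ev_opt: "ev g (opt i f) = opt i (ev g f)" by (simp add: opt_def)
lemma ev_scale: "ev g (scal s * f) = cscale s (ev g f)" by (simp add: ev_mult lop.scale_mult_left)

lemmas ev_simps = ev_add ev_mult ev_uminus ev_diff ev_power ev_opt ev_scale

lemma ev_span: "f \<in> fa.span S \<Longrightarrow> ev g f \<in> lop.span (ev g ` S)"
proof (induction rule: fa.span_induct_alt)
  case (step s x f)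
  then show ?case by (simp add: ev_add ev_scale lop.span_add lop.span_scale lop.span_base)
qed (simp add: lop.span_zero)

definition homog :: "('g \<Rightarrow> bool) \<Rightarrow> nat \<Rightarrow> 'g free_alg set" where
  "homog P n = {f. \<forall>w\<in>Poly_Mapping.keys f. length (filter P (letters w)) = n}"

lemma homog_add: "f \<in> homog P n \<Longrightarrow> h \<in> homog P n \<Longrightarrow> f + h \<in> homog P n"
  using Poly_Mapping.keys_add[of f h] by (auto simp: homog_def)
lemma homog_0: "0 \<in> homog P n" by (simp add: homog_def)
lemma homog_mult: "f \<in> homog P n \<Longrightarrow> h \<in> homog P k \<Longrightarrow> f * h \<in> homog P (n + k)"
  using Poly_Mapping.keys_mult[of f h] by (fastforce simp: homog_def plus_fword_def)
lemma homog_scal: "scal s \<in> homog P 0"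
  by (simp add: homog_def scal_def zero_fword_def)
lemma homog_1: "1 \<in> homog P 0" by (simp add: homog_def zero_fword_def)
lemma homog_scale: "f \<in> homog P n \<Longrightarrow> scal s * f \<in> homog P n"
  using homog_mult[OF homog_scal] by fastforce
lemma homog_gen: "gen x \<in> homog P (if P x then 1 else 0)"
  by (simp add: homog_def gen_def)
lemma homog_power: "f \<in> homog P 0 \<Longrightarrow> f ^ n \<in> homog P 0"
  by (induction n) (auto simp: homog_1 dest: homog_mult)
lemma homog_span: "S \<subseteq> homog P n \<Longrightarrow> fa.span S \<subseteq> homog P n"
  by (rule fa.span_minimal) (auto simp: fa.subspace_def homog_0 homog_add homog_scale)

lemma single_word: "Poly_Mapping.single w s = scal s * prod_list (map gen (letters w))"
proof -
  have "prod_list (map gen l) = Poly_Mapping.single (FWord l) (1::complex)" for l :: "'a list"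
    by (induction l) (simp_all add: gen_def mult_single plus_fword_def flip: zero_fword_def)
  then show ?thesis by (simp add: scal_def mult_single)
qed

section \<open>Spans modulo a two-sided ideal\<close>

locale two_sided_ideal =
  fixes J :: "'g free_alg set"
  assumes zero: "0 \<in> J" and add: "f \<in> J \<Longrightarrow> h \<in> J \<Longrightarrow> f + h \<in> J"
    and left: "f \<in> J \<Longrightarrow> h * f \<in> J" and right: "f \<in> J \<Longrightarrow> f * h \<in> J"
begin

lemma subspace: "fa.subspace J"
  by (simp add: fa.subspace_def zero add left)

text \<open>A span in the quotient by \<open>J\<close>, kept in the free algebra so that words are
  rewritten without passing to cosets.\<close>

definition spn :: "'g free_alg set \<Rightarrow> 'g free_alg set" where "spn S = fa.span (S \<union> J)"

lemma spn_base: "f \<in> S \<Longrightarrow> f \<in> spn S" and spn_J: "f \<in> J \<Longrightarrow> f \<in> spn S"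
  and spn_add: "f \<in> spn S \<Longrightarrow> h \<in> spn S \<Longrightarrow> f + h \<in> spn S"
  and spn_diff: "f \<in> spn S \<Longrightarrow> h \<in> spn S \<Longrightarrow> f - h \<in> spn S"
  and spn_uminus: "f \<in> spn S \<Longrightarrow> - f \<in> spn S"
  and spn_scale: "f \<in> spn S \<Longrightarrow> scal s * f \<in> spn S"
  unfolding spn_def by (auto intro: fa.span_base fa.span_add fa.span_diff fa.span_neg fa.span_scale)

lemma spn_0: "0 \<in> spn S" by (simp add: spn_J zero)

lemma spn_minimal: "f \<in> spn S \<Longrightarrow> S \<subseteq> spn S' \<Longrightarrow> f \<in> spn S'"
  unfolding spn_def by (rule rev_subsetD[of _ "fa.span _"], assumption)
    (rule fa.span_minimal, auto intro: fa.span_base)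

lemma spn_induct [consumes 1, case_names base ideal add scale]:
  assumes "f \<in> spn S" "\<And>f. f \<in> S \<Longrightarrow> Q f" "\<And>f. f \<in> J \<Longrightarrow> Q f"
    "\<And>f h. Q f \<Longrightarrow> Q h \<Longrightarrow> Q (f + h)" "\<And>s f. Q f \<Longrightarrow> Q (scal s * f)"
  shows "Q f"
  using assms(1) unfolding spn_def
proof (induction rule: fa.span_induct_alt)
  case base
  show ?case using assms(3) zero by blast
qed (use assms in blast)

lemma spn_left:
  assumes "f \<in> spn S" "\<And>h. h \<in> S \<Longrightarrow> x * h \<in> spn S'"
  shows "x * f \<in> spn S'"
  using assms(1)
proof (induction rule: spn_induct)
  case (scale s f)
  then show ?case using spn_scale[of "x * f" S' s] by (simp add: fa.scale_mult_right)
qed (auto simp: distrib_left spn_add assms left spn_J)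

lemma spn_right:
  assumes "f \<in> spn S" "\<And>h. h \<in> S \<Longrightarrow> h * x \<in> spn S'"
  shows "f * x \<in> spn S'"
  using assms(1)
proof (induction rule: spn_induct)
  case (scale s f)
  then show ?case using spn_scale[of "f * x" S' s] by (simp add: mult.assoc)
qed (auto simp: distrib_right spn_add assms right spn_J)

lemma spn_cong: "f - h \<in> J \<Longrightarrow> f \<in> spn S \<longleftrightarrow> h \<in> spn S"
  using spn_add[of "f - h" S h] spn_diff[of f S "f - h"] spn_J[of "f - h" S] by auto

lemma spn_cong_mult: "f - h \<in> J \<Longrightarrow> x * f * z \<in> spn S \<longleftrightarrow> x * h * z \<in> spn S"
  by (rule spn_cong) (metis left right left_diff_distrib right_diff_distrib)

lemma spn_decomp:
  assumes "f \<in> spn S" obtains h where "h \<in> fa.span S" "f - h \<in> J"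
  using assms unfolding spn_def fa.span_Un fa.span_eq_iff[THEN iffD2, OF subspace]
  by auto

end

section \<open>Normal ordering of forms\<close>

definition form_word :: "(idx \<Rightarrow> 'g free_alg) \<Rightarrow> bool \<times> bool \<times> bool \<times> bool \<Rightarrow> 'g free_alg" where
  "form_word e = (\<lambda>(i, j, k, l). opt i (e A) * (opt j (e B) * (opt k (e C) * opt l (e D))))"

definition bits :: "nat \<Rightarrow> (bool \<times> bool \<times> bool \<times> bool) set" where
  "bits n = {(i, j, k, l). of_bool i + of_bool j + of_bool k + of_bool l = n}"

text \<open>\<open>J\<close> and \<open>e\<close> are left open because the same ordering is used in
  \<Lambda> itself and in the full calculus.\<close>

locale form_ideal = two_sided_ideal J for J :: "'g free_alg set" +
  fixes q :: complex and e :: "idx \<Rightarrow> 'g free_alg"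
  assumes q_nz: "q \<noteq> 0" and form_rels: "form_rels q e \<subseteq> J"
begin

text \<open>The relations as rewriting rules towards the order A, B, C, D. Solving for the product
  of B and A requires division by \<open>q ^ 2\<close>.\<close>

lemma rels:
  "i \<in> {B, C, D} \<Longrightarrow> e i * e i - 0 \<in> J"
  "e C * e B - - (e B * e C) \<in> J" "e D * e B - - (e B * e D) \<in> J" "e D * e C - - (e C * e D) \<in> J"
  "e A * e A - scal (mu q) * e B * e C \<in> J"
  "e D * e A - (- (e A * e D) - scal (mu q) * e B * e C) \<in> J"
  "e B * e A - scal (inverse q ^ 2) * (scal (mu q) * e B * e D - e A * e B) \<in> J"
  "e C * e A - (- (scal (mu q) * e C * e D) - scal (q ^ 2) * e A * e C) \<in> J"
proof -
  note R = subsetD[OF form_rels]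
  show "i \<in> {B, C, D} \<Longrightarrow> e i * e i - 0 \<in> J" by (rule R) (auto simp: form_rels_def)
  have anti: "e i * e j + e j * e i \<in> J" if "i \<in> {B, C, D}" "j \<in> {B, C, D}" "i \<noteq> j" for i j
    by (rule R) (use that in \<open>auto simp: form_rels_def\<close>)
  show "e C * e B - - (e B * e C) \<in> J" "e D * e B - - (e B * e D) \<in> J" "e D * e C - - (e C * e D) \<in> J"
    using anti[of C B] anti[of D B] anti[of D C] by simp_all
  show "e A * e A - scal (mu q) * e B * e C \<in> J" by (rule R) (simp add: form_rels_def)
  have "e A * e D + e D * e A + scal (mu q) * e B * e C \<in> J" by (rule R) (simp add: form_rels_def)
  then show "e D * e A - (- (e A * e D) - scal (mu q) * e B * e C) \<in> J" by (simp add: algebra_simps)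
  have "e C * e A + scal (q ^ 2) * e A * e C + scal (mu q) * e C * e D \<in> J" by (rule R) (simp add: form_rels_def)
  then show "e C * e A - (- (scal (mu q) * e C * e D) - scal (q ^ 2) * e A * e C) \<in> J" by (simp add: algebra_simps)
  have "e A * e B + scal (q ^ 2) * e B * e A - scal (mu q) * e B * e D \<in> J" by (rule R) (simp add: form_rels_def)
  then have "scal (inverse q ^ 2) * (e A * e B + scal (q ^ 2) * (e B * e A) - scal (mu q) * e B * e D) \<in> J"
    by (simp add: left mult.assoc)
  then show "e B * e A - scal (inverse q ^ 2) * (scal (mu q) * e B * e D - e A * e B) \<in> J"
    using q_nz fa.scale_scale[of "inverse q ^ 2" "q ^ 2" "e B * e A"]
    by (simp add: distrib_left right_diff_distrib power_inverse fa.scale_one algebra_simps)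
qed

end

context two_sided_ideal
begin

lemma rel_step: "f - h \<in> J \<Longrightarrow> h * z \<in> spn S \<Longrightarrow> f * z \<in> spn S"
  using spn_cong_mult[of f h 1 z S] by simp

lemma pow_rel:
  assumes "x * z - scal s * (z * x) \<in> J"
  shows "x * z ^ n - scal (s ^ n) * (z ^ n * x) \<in> J"
proof (induction n)
  case 0
  show ?case by (simp add: fa.scale_one zero)
next
  case (Suc n)
  have "scal (s ^ Suc n) * (z ^ Suc n * x) = scal s * (z * (scal (s ^ n) * (z ^ n * x)))"
    by (simp only: fa.scale_mult_right[of z] fa.scale_scale power_Suc mult.assoc)
  then have "x * z ^ Suc n - scal (s ^ Suc n) * (z ^ Suc n * x) =
      (x * z - scal s * (z * x)) * z ^ n + scal s * (z * (x * z ^ n - scal (s ^ n) * (z ^ n * x)))"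
    by (simp only: left_diff_distrib right_diff_distrib mult.assoc power_Suc) simp
  then show ?case using Suc assms by (simp add: add left right)
qed

end

context form_ideal
begin

text \<open>Rules among C, D produce only these letters, and likewise among B, C, D. Hence ordering
  can proceed in three stages, with B and then A put in front.\<close>

definition cd_words :: "nat \<Rightarrow> 'g free_alg set" where
  "cd_words n = {opt k (e C) * opt l (e D) | k l. of_bool k + of_bool l = n}"
definition bcd_words :: "nat \<Rightarrow> 'g free_alg set" where
  "bcd_words n = {opt j (e B) * (opt k (e C) * opt l (e D)) | j k l. of_bool j + of_bool k + of_bool l = n}"
definition words :: "nat \<Rightarrow> 'g free_alg set" where
  "words n = form_word e ` bits n"

lemma cd_wordsI: "of_bool k + of_bool l = n \<Longrightarrow> opt k (e C) * opt l (e D) \<in> cd_words n"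
  unfolding cd_words_def by blast

lemma cd_left:
  assumes "i \<in> {C, D}" "f \<in> spn (cd_words n)"
  shows "e i * f \<in> spn (cd_words (Suc n))"
  using assms(2)
proof (rule spn_left)
  fix h assume "h \<in> cd_words n"
  then obtain k l where h: "h = opt k (e C) * opt l (e D)" and n: "of_bool k + of_bool l = n"
    unfolding cd_words_def by blast
  show "e i * h \<in> spn (cd_words (Suc n))"
  proof (cases "i = C")
    case True
    show ?thesis
    proof (cases k)
      case True
      have "e C * e C * opt l (e D) \<in> spn (cd_words (Suc n))"
        by (rule rel_step[OF rels(1)]) (simp_all add: spn_0)
      then show ?thesis using True \<open>i = C\<close> by (simp add: h mult.assoc)
    next
      case False
      then show ?thesis using \<open>i = C\<close> n cd_wordsI[of True l "Suc n"] by (simp add: h spn_base)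
    qed
  next
    case False
    then have i: "i = D" using assms(1) by auto
    have DD: "e D * e D \<in> J" using rels(1)[of D] by simp
    show ?thesis
    proof (cases k)
      case True
      have "e D * e C * opt l (e D) \<in> spn (cd_words (Suc n))"
      proof (rule rel_step[OF rels(4)])
        have "e C * (e D * opt l (e D)) \<in> spn (cd_words (Suc n))"
          using n True cd_wordsI[of True True "Suc n"] DD
          by (cases l) (auto intro: spn_base spn_J left)
        then show "- (e C * e D) * opt l (e D) \<in> spn (cd_words (Suc n))"
          by (simp add: mult.assoc spn_uminus)
      qed
      then show ?thesis using True i by (simp add: h mult.assoc)
    next
      case False
      then show ?thesis using i n cd_wordsI[of False True "Suc n"] DD
        by (cases l) (auto simp: h intro: spn_base spn_J)
    qed
  qed
qed

lemma bcd_cases: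
  assumes "h \<in> bcd_words n"
  obtains "h \<in> cd_words n" | h' k where "h = e B * h'" "h' \<in> cd_words k" "n = Suc k"
proof -
  obtain j k l where h: "h = opt j (e B) * (opt k (e C) * opt l (e D))" "of_bool j + of_bool k + of_bool l = n"
    using assms unfolding bcd_words_def by blast
  show ?thesis
  proof (cases j)
    case True
    then show ?thesis using h that(2)[of "opt k (e C) * opt l (e D)" "of_bool k + of_bool l"] by (simp add: cd_wordsI)
  next
    case False
    then show ?thesis using h that(1) by (simp add: cd_wordsI)
  qed
qed

lemma cd_bcd: "cd_words n \<subseteq> bcd_words n"
proof
  fix h assume "h \<in> cd_words n"
  then obtain k l where "h = opt False (e B) * (opt k (e C) * opt l (e D))" "of_bool False + of_bool k + of_bool l = n"
    unfolding cd_words_def by auto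
  then show "h \<in> bcd_words n" unfolding bcd_words_def by blast
qed

lemma b_cd: "f \<in> spn (cd_words n) \<Longrightarrow> e B * f \<in> spn (bcd_words (Suc n))"
proof (erule spn_left)
  fix h assume "h \<in> cd_words n"
  then obtain k l where "e B * h = opt True (e B) * (opt k (e C) * opt l (e D))" "of_bool True + of_bool k + of_bool l = Suc n"
    unfolding cd_words_def by auto
  then show "e B * h \<in> spn (bcd_words (Suc n))" unfolding bcd_words_def by (blast intro: spn_base)
qed

lemma spn_mono: "f \<in> spn S \<Longrightarrow> S \<subseteq> S' \<Longrightarrow> f \<in> spn S'"
  by (erule spn_minimal) (auto intro: spn_base)

lemma bcd_left:
  assumes "i \<in> {B, C, D}" "f \<in> spn (bcd_words n)"
  shows "e i * f \<in> spn (bcd_words (Suc n))"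
  using assms(2)
proof (rule spn_left)
  fix h assume "h \<in> bcd_words n"
  then show "e i * h \<in> spn (bcd_words (Suc n))"
  proof (cases rule: bcd_cases)
    case 1
    then show ?thesis
    proof (cases "i = B")
      case False
      then have "e i * h \<in> spn (cd_words (Suc n))" using assms(1) 1 by (intro cd_left spn_base) auto
      then show ?thesis using spn_mono cd_bcd by blast
    qed (auto intro: b_cd spn_base)
  next
    case (2 h' k)
    have "e i * e B * h' \<in> spn (bcd_words (Suc n))"
    proof (cases "i = B")
      case True
      then show ?thesis using rel_step[OF rels(1), of B h'] by (simp add: spn_0)
    next
      case False
      then have i: "i \<in> {C, D}" using assms(1) by auto
      then have "e i * e B - - (e B * e i) \<in> J" using rels(2,3) by auto
      moreover have "e B * (e i * h') \<in> spn (bcd_words (Suc n))"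
        using b_cd[OF cd_left[OF i spn_base[OF 2(2)]]] 2(3) by simp
      ultimately show ?thesis
        by (intro rel_step[of "e i * e B" "- (e B * e i)" h']) (simp_all add: mult.assoc spn_uminus)
    qed
    then show ?thesis using 2 by (simp add: mult.assoc)
  qed
qed

lemma words_cases:
  assumes "h \<in> words n"
  obtains "h \<in> bcd_words n" | h' k where "h = e A * h'" "h' \<in> bcd_words k" "n = Suc k"
proof -
  obtain i j k l where h: "h = opt i (e A) * (opt j (e B) * (opt k (e C) * opt l (e D)))"
      "of_bool i + of_bool j + of_bool k + of_bool l = n"
    using assms by (auto simp: words_def form_word_def bits_def)
  show ?thesis
  proof (cases i)
    case True
    have "opt j (e B) * (opt k (e C) * opt l (e D)) \<in> bcd_words (of_bool j + of_bool k + of_bool l)"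
      unfolding bcd_words_def by blast
    then show ?thesis using True h that(2) by simp
  next
    case False
    have "opt j (e B) * (opt k (e C) * opt l (e D)) \<in> bcd_words (of_bool j + of_bool k + of_bool l)"
      unfolding bcd_words_def by blast
    then show ?thesis using False h that(1) by simp
  qed
qed

lemma bcd_words_words: "bcd_words n \<subseteq> words n"
proof
  fix h assume "h \<in> bcd_words n"
  then obtain j k l where "h = form_word e (False, j, k, l)" "(False, j, k, l) \<in> bits n"
    by (auto simp: bcd_words_def form_word_def bits_def)
  then show "h \<in> words n" by (auto simp: words_def)
qed

lemma a_bcd: "f \<in> spn (bcd_words n) \<Longrightarrow> e A * f \<in> spn (words (Suc n))"
proof (erule spn_left)
  fix h assume "h \<in> bcd_words n"
  then obtain j k l where "e A * h = form_word e (True, j, k, l)" "(True, j, k, l) \<in> bits (Suc n)"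
    by (auto simp: bcd_words_def form_word_def bits_def)
  then show "e A * h \<in> spn (words (Suc n))" by (auto simp: words_def intro!: spn_base)
qed

text \<open>Every rule for \<open>e i * e A\<close> leaves at most one A, and that in front; what
  remains to be ordered consists of B, C, D and is covered by \<open>bcd_left\<close>.\<close>

lemma words_left:
  assumes "f \<in> spn (words n)"
  shows "e i * f \<in> spn (words (Suc n))"
  using assms
proof (rule spn_left)
  fix h assume "h \<in> words n"
  then show "e i * h \<in> spn (words (Suc n))"
  proof (cases rule: words_cases)
    case 1
    then show ?thesis
      using bcd_left[of i h n] a_bcd[of h n] spn_mono[OF _ bcd_words_words] by (cases i) (auto intro: spn_base)
  next
    case (2 h' k)
    have bcd: "e i * f \<in> spn (words (Suc n))" if "i \<in> {B, C, D}" "f \<in> spn (bcd_words n)" for i f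
      using bcd_left[OF that] spn_mono[OF _ bcd_words_words] by blast
    have bcd': "e i * h' \<in> spn (bcd_words n)" if "i \<in> {B, C, D}" for i
      using bcd_left[OF that] 2 by (auto intro: spn_base)
    have abcd: "e A * f \<in> spn (words (Suc n))" if "f \<in> spn (bcd_words n)" for f
      using a_bcd[OF that] .
    have ab: "scal s * e i * e j * h' \<in> spn (words (Suc n))" if "i \<in> {B, C, D}" "j \<in> {B, C, D}" for i j s
      using bcd[OF that(1) bcd'[OF that(2)]] by (simp add: mult.assoc spn_scale)
    have ab2: "e A * e j * h' \<in> spn (words (Suc n))" if "j \<in> {B, C, D}" for j
      using abcd[OF bcd'[OF that]] by (simp add: mult.assoc)
    have ab': "scal s * e A * e j * h' \<in> spn (words (Suc n))" if "j \<in> {B, C, D}" for j s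
      using abcd[OF bcd'[OF that]] by (simp add: mult.assoc spn_scale)
    have sub: "(f - f') * h' \<in> spn (words (Suc n))"
      if "f * h' \<in> spn (words (Suc n))" "f' * h' \<in> spn (words (Suc n))" for f f'
      using that by (simp add: left_diff_distrib spn_diff)
    have neg: "(- f) * h' \<in> spn (words (Suc n))" if "f * h' \<in> spn (words (Suc n))" for f
      using that by (simp add: spn_uminus)
    have scl: "scal s * f * h' \<in> spn (words (Suc n))" if "f * h' \<in> spn (words (Suc n))" for f s
      using that by (simp add: spn_scale mult.assoc)
    have "e i * e A * h' \<in> spn (words (Suc n))"
    proof (cases i)
      case A
      show ?thesis unfolding A by (rule rel_step[OF rels(5)], rule ab) simp_all
    next
      case B
      show ?thesis unfolding B by (rule rel_step[OF rels(7)], rule scl, rule sub, rule ab, simp, simp, rule ab2, simp)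
    next
      case C
      show ?thesis unfolding C by (rule rel_step[OF rels(8)], rule sub, rule neg, rule ab, simp, simp, rule ab', simp)
    next
      case D
      show ?thesis unfolding D by (rule rel_step[OF rels(6)], rule sub, rule neg, rule ab2, simp, rule ab, simp, simp)
    qed
    then show ?thesis using 2 by (simp add: mult.assoc)
  qed
qed

lemma one_words: "1 \<in> spn (words 0)"
proof -
  have "form_word e (False, False, False, False) = 1" by (simp add: form_word_def)
  moreover have "(False, False, False, False) \<in> bits 0" by (simp add: bits_def)
  ultimately show ?thesis unfolding words_def by (metis imageI spn_base)
qed

lemma prod_words: "prod_list (map e l) \<in> spn (words (length l))"
  by (induction l) (simp_all add: one_words words_left)

end

section \<open>Normal ordering in the full calculus\<close>

locale omega_ideal = root_calculus q r + two_sided_ideal J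
  for q :: complex and r :: nat and J :: "calc_gen free_alg set" +
  assumes omega_rels: "Omega_rels q r \<subseteq> J"

sublocale omega_ideal \<subseteq> form_ideal J q "\<lambda>i. gen (Form i)"
  by unfold_locales (use omega_rels q_nz in \<open>auto simp: Omega_rels_def\<close>)

context omega_ideal
begin

abbreviation "xc i \<equiv> gen (Coord i) :: calc_gen free_alg"
abbreviation "xf i \<equiv> gen (Form i) :: calc_gen free_alg"

lemma crels:
  "xc B * xc A - scal q * (xc A * xc B) \<in> J" "xc C * xc A - scal q * (xc A * xc C) \<in> J"
  "xc C * xc B - scal 1 * (xc B * xc C) \<in> J" "xc A * xc D - (scal (inverse q) * xc B * xc C + 1) \<in> J"
  "xc A ^ r - 1 \<in> J" "xc B ^ r \<in> J" "xc C ^ r \<in> J"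
proof -
  note R = subsetD[OF omega_rels[unfolded Omega_rels_def coord_rels_def Let_def]]
  show "xc B * xc A - scal q * (xc A * xc B) \<in> J" "xc C * xc A - scal q * (xc A * xc C) \<in> J"
    "xc C * xc B - scal 1 * (xc B * xc C) \<in> J" "xc A * xc D - (scal (inverse q) * xc B * xc C + 1) \<in> J"
    "xc A ^ r - 1 \<in> J" "xc B ^ r \<in> J" "xc C ^ r \<in> J"
    by (rule R, simp add: mult.assoc fa.scale_one diff_diff_eq)+
qed

definition abc_words :: "calc_gen free_alg set" where
  "abc_words = {xc A ^ u * (xc B ^ v * xc C ^ w) | u v w. u < r \<and> v < r \<and> w < r}"

lemma mono_spn:
  assumes "u \<le> r" "v \<le> r" "w \<le> r"
  shows "xc A ^ u * (xc B ^ v * xc C ^ w) \<in> spn abc_words"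
proof -
  have 1: "xc A ^ u * (xc B ^ v * xc C ^ w) \<in> spn abc_words" if "u < r" for u
  proof (cases "v = r \<or> w = r")
    case True
    then have "xc B ^ v * xc C ^ w \<in> J" using crels(6,7) left right by blast
    then show ?thesis by (rule spn_J[OF left])
  next
    case False
    then have "v < r" "w < r" using assms by auto
    then show ?thesis using that unfolding abc_words_def by (blast intro: spn_base)
  qed
  show ?thesis
  proof (cases "u = r")
    case True
    have "1 * (xc B ^ v * xc C ^ w) \<in> spn abc_words" using 1[of 0] r_ge by simp
    then show ?thesis unfolding True by (rule rel_step[OF crels(5)])
  next
    case False
    then show ?thesis using assms by (intro 1) simp
  qed
qed

lemma coord_left_abc:
  assumes "f \<in> spn abc_words" "i \<in> {A, B, C}"
  shows "xc i * f \<in> spn abc_words"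
  using assms(1)
proof (rule spn_left)
  fix h assume "h \<in> abc_words"
  then obtain u v w where h: "h = xc A ^ u * (xc B ^ v * xc C ^ w)" and lt: "u < r" "v < r" "w < r"
    by (auto simp: abc_words_def)
  consider "i = A" | "i = B" | "i = C" using assms(2) by auto
  then show "xc i * h \<in> spn abc_words"
  proof cases
    case 1
    then show ?thesis using mono_spn[of "Suc u" v w] lt by (simp add: h mult.assoc)
  next
    case 2
    have "xc B * xc A ^ u * (xc B ^ v * xc C ^ w) \<in> spn abc_words"
      using mono_spn[of u "Suc v" w] lt
      by (intro rel_step[OF pow_rel[OF crels(1)]]) (simp add: mult.assoc spn_scale)
    then show ?thesis using 2 by (simp add: h mult.assoc)
  next
    case 3
    have "xc C * xc A ^ u * (xc B ^ v * xc C ^ w) \<in> spn abc_words"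
    proof (rule rel_step[OF pow_rel[OF crels(2)]])
      have "xc A ^ u * (xc C * xc B ^ v) * xc C ^ w \<in> spn abc_words"
        using mono_spn[of u v "Suc w"] lt
        by (subst spn_cong_mult[OF pow_rel[OF crels(3)]]) (simp add: mult.assoc fa.scale_one)
      then show "scal (q ^ u) * (xc A ^ u * xc C) * (xc B ^ v * xc C ^ w) \<in> spn abc_words"
        by (simp add: mult.assoc spn_scale)
    qed
    then show ?thesis using 3 by (simp add: h mult.assoc)
  qed
qed

lemma coord_left:
  assumes f: "f \<in> spn abc_words"
  shows "xc i * f \<in> spn abc_words"
proof (cases "i = D")
  case True
  have pow: "xc A ^ n * f \<in> spn abc_words" if "f \<in> spn abc_words" for n f
    using that by (induction n arbitrary: f) (auto simp: mult.assoc power_Suc2 simp del: power_Suc intro: coord_left_abc)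
  \<comment> \<open>The generator \<open>d\<close> does not occur in normal words. Since
    \<open>a ^ r = 1\<close>, it equals \<open>a ^ (r - 1) * (a * d)\<close>, and
    \<open>a * d\<close> is expressed by \<open>b\<close> and \<open>c\<close>.\<close>
  have "xc A ^ (r - 1) * (xc A * xc D) * f \<in> spn abc_words"
  proof (subst spn_cong_mult[OF crels(4)])
    have "scal (inverse q) * (xc B * (xc C * f)) + f \<in> spn abc_words"
      using f by (auto intro!: spn_add spn_scale coord_left_abc)
    then show "xc A ^ (r - 1) * (scal (inverse q) * xc B * xc C + 1) * f \<in> spn abc_words"
      using pow by (simp add: mult.assoc distrib_right)
  qed
  also have "xc A ^ (r - 1) * (xc A * xc D) = xc A ^ r * xc D"
    using r_ge power_Suc2[of "xc A" "r - 1"] by (simp flip: mult.assoc)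
  finally have "xc A ^ r * (xc D * f) \<in> spn abc_words" by (simp add: mult.assoc)
  then have "1 * xc D * f \<in> spn abc_words"
    using spn_cong_mult[OF crels(5), of 1 "xc D * f"] by (simp add: mult.assoc)
  then show ?thesis using True by simp
next
  case False
  then show ?thesis using f by (intro coord_left_abc) (cases i; auto)+
qed

text \<open>Forms precede coordinates but are not yet ordered among themselves; this separates the
  use of the cross relations from that of the relations of \<Lambda>.\<close>

fun layer :: "nat \<Rightarrow> calc_gen free_alg set" where
  "layer 0 = spn abc_words"
| "layer (Suc n) = spn {xf i * f | i f. f \<in> layer n}"

lemma cross_rels:
  assumes "(u, v) \<in> {(A, C), (B, D)}"
  shows "xc v * xf B - xf B * xc v \<in> J" "xc u * xf C - xf C * xc u \<in> J"
    "xc u * xf D - scal (inverse q) * xf D * xc u \<in> J" "xc v * xf D - scal q * xf D * xc v \<in> J"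
    "xc u * xf B - (xf B * xc u + scal (q * mu q) * xf D * xc v) \<in> J"
    "xc v * xf C - (xf C * xc v + scal (q * mu q) * xf D * xc u) \<in> J"
    "xc v * xf A - (scal (inverse q) * xf A * xc v + scal (mu q) * xf B * xc u) \<in> J"
    "xc u * xf A - (scal q * xf A * xc u + scal (mu q) * xf C * xc v + scal (q * mu q ^ 2) * xf D * xc u) \<in> J"
proof -
  have "cross_rels q xc xf \<subseteq> J" using omega_rels unfolding Omega_rels_def by blast
  have cross: "(\<Union>(u, v)\<in>{(xc A, xc C), (xc B, xc D)}. F u v) \<subseteq> J \<Longrightarrow> F (xc u) (xc v) \<subseteq> J" for F
    using assms by auto
  note R = subsetD[OF cross[OF \<open>cross_rels q xc xf \<subseteq> J\<close>[unfolded cross_rels_def]], unfolded insert_iff]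
  show "xc v * xf B - xf B * xc v \<in> J" "xc u * xf C - xf C * xc u \<in> J"
    "xc u * xf D - scal (inverse q) * xf D * xc u \<in> J" "xc v * xf D - scal q * xf D * xc v \<in> J"
    "xc u * xf B - (xf B * xc u + scal (q * mu q) * xf D * xc v) \<in> J"
    "xc v * xf C - (xf C * xc v + scal (q * mu q) * xf D * xc u) \<in> J"
    "xc v * xf A - (scal (inverse q) * xf A * xc v + scal (mu q) * xf B * xc u) \<in> J"
    "xc u * xf A - (scal q * xf A * xc u + scal (mu q) * xf C * xc v + scal (q * mu q ^ 2) * xf D * xc u) \<in> J"
    by (rule R, blast)+
qed

text \<open>Each cross relation turns a coordinate before a form into combinations of a form before
  a coordinate; for spanning, the particular ones do not matter.\<close>

lemma cross:
  assumes "\<And>j k. xf j * (xc k * h) \<in> spn S"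
  shows "xc x * (xf i * h) \<in> spn S"
proof -
  have rel: "xc x * (xf i * h) \<in> spn S" if "xc x * xf i - s \<in> J" "s * h \<in> spn S" for s x i
    using rel_step[OF that] by (simp add: mult.assoc)
  have ok: "(f + f') * h \<in> spn S" if "f * h \<in> spn S" "f' * h \<in> spn S" for f f'
    using that by (simp add: distrib_right spn_add)
  have ok1: "xf j * xc k * h \<in> spn S" "scal s * xf j * xc k * h \<in> spn S" for j k s
    using assms by (simp_all add: mult.assoc spn_scale)
  have uv: "xc u * (xf i * h) \<in> spn S \<and> xc v * (xf i * h) \<in> spn S" if "(u, v) \<in> {(A, C), (B, D)}" for u v
    using rel[OF cross_rels(1)[OF that]] rel[OF cross_rels(2)[OF that]] rel[OF cross_rels(3)[OF that]]
      rel[OF cross_rels(4)[OF that]] rel[OF cross_rels(5)[OF that]] rel[OF cross_rels(6)[OF that]]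
      rel[OF cross_rels(7)[OF that]] rel[OF cross_rels(8)[OF that]]
    by (cases i) (simp_all add: ok ok1)
  show ?thesis using uv[of A C] uv[of B D] by (cases x) simp_all
qed

lemma coord_layer: "f \<in> layer n \<Longrightarrow> xc i * f \<in> layer n"
proof (induction n arbitrary: f i)
  case 0
  then show ?case by (simp add: coord_left)
next
  case (Suc n)
  have "f \<in> spn {xf i * f | i f. f \<in> layer n}" using Suc.prems by simp
  then have "xc i * f \<in> spn {xf i * f | i f. f \<in> layer n}"
  proof (rule spn_left)
    fix h assume "h \<in> {xf i * f | i f. f \<in> layer n}"
    then obtain j f where h: "h = xf j * f" "f \<in> layer n" by blast
    show "xc i * h \<in> spn {xf i * f | i f. f \<in> layer n}"
      unfolding h(1) by (rule cross, rule spn_base) (use Suc.IH[OF h(2)] in blast)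
  qed
  then show ?case by simp
qed

definition basis_word :: "code \<Rightarrow> calc_gen free_alg" where
  "basis_word = (\<lambda>(i, j, k, l, u, v, w). form_word xf (i, j, k, l) * (xc A ^ u * (xc B ^ v * xc C ^ w)))"

lemma words_abc:
  assumes "f \<in> spn (words n)" "h \<in> spn abc_words"
  shows "f * h \<in> spn (basis_word ` dcodes n)"
  using assms(1)
proof (rule spn_right)
  fix f assume "f \<in> words n"
  then obtain i j k l where f: "f = form_word xf (i, j, k, l)" "(i, j, k, l) \<in> bits n"
    by (auto simp: words_def)
  show "f * h \<in> spn (basis_word ` dcodes n)"
    using assms(2)
  proof (rule spn_left)
    fix h assume "h \<in> abc_words"
    then obtain u v w where "h = xc A ^ u * (xc B ^ v * xc C ^ w)" "u < r" "v < r" "w < r"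
      by (auto simp: abc_words_def)
    then have "f * h = basis_word (i, j, k, l, u, v, w)" "(i, j, k, l, u, v, w) \<in> dcodes n"
      using f by (auto simp: basis_word_def dcodes_def codes_def bits_def)
    then show "f * h \<in> spn (basis_word ` dcodes n)" by (metis imageI spn_base)
  qed
qed

lemma form_basis:
  assumes "f \<in> spn (basis_word ` dcodes n)"
  shows "xf i * f \<in> spn (basis_word ` dcodes (Suc n))"
  using assms
proof (rule spn_left)
  fix h assume "h \<in> basis_word ` dcodes n"
  then obtain t u v w where h: "h = form_word xf t * (xc A ^ u * (xc B ^ v * xc C ^ w))" "t \<in> bits n"
    and lt: "u < r" "v < r" "w < r"
    by (auto simp: basis_word_def dcodes_def codes_def bits_def)
  have "xf i * form_word xf t \<in> spn (words (Suc n))"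
    using h(2) by (intro words_left spn_base) (simp add: words_def)
  moreover have "xc A ^ u * (xc B ^ v * xc C ^ w) \<in> spn abc_words" using lt by (intro mono_spn) simp_all
  ultimately show "xf i * h \<in> spn (basis_word ` dcodes (Suc n))"
    using words_abc by (simp add: h mult.assoc[symmetric, of "xf i"])
qed

lemma layer_basis: "f \<in> layer n \<Longrightarrow> f \<in> spn (basis_word ` dcodes n)"
proof (induction n arbitrary: f)
  case 0
  then show ?case using words_abc[OF one_words, of f] by simp
next
  case (Suc n)
  then have "f \<in> spn {xf i * f | i f. f \<in> layer n}" by simp
  then show ?case by (rule spn_minimal) (use Suc.IH form_basis in blast)
qed

lemma word_layer: "prod_list (map gen l) \<in> layer (length (filter is_form l))"
proof (induction l)
  case Nil
  show ?case using mono_spn[of 0 0 0] by simp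
next
  case (Cons x l)
  show ?case
  proof (cases x)
    case (Coord i)
    then show ?thesis using Cons coord_layer by simp
  next
    case (Form i)
    have "xf i * prod_list (map gen l) \<in> spn {xf i * f | i f. f \<in> layer (length (filter is_form l))}"
      using Cons by (intro spn_base) blast
    then show ?thesis using Form by simp
  qed
qed

lemma homog_spn:
  assumes "f \<in> homog is_form n"
  shows "f \<in> spn (basis_word ` dcodes n)"
proof -
  have "Poly_Mapping.single w s \<in> spn (basis_word ` dcodes n)" if "w \<in> Poly_Mapping.keys f" for w s
  proof -
    have "length (filter is_form (letters w)) = n" using that assms by (simp add: homog_def)
    then show ?thesis using layer_basis[OF word_layer[of "letters w"]] by (simp add: single_word spn_scale)
  qed
  note single = this
  have "(\<Sum>w\<in>S. Poly_Mapping.single w (Poly_Mapping.lookup f w)) \<in> spn (basis_word ` dcodes n)"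
    if "finite S" "S \<subseteq> Poly_Mapping.keys f" for S
    using that by (induction S rule: finite_induct) (auto simp: spn_0 intro!: spn_add single)
  then show ?thesis by (metis poly_mapping_expand finite_keys order_refl)
qed

end

section \<open>Ideals of the free algebra and kernels of evaluations\<close>

lemma free_algebra_simps:
  "carrier free_algebra = UNIV" "f \<otimes>\<^bsub>free_algebra\<^esub> h = f * h" "\<one>\<^bsub>free_algebra\<^esub> = 1"
  "\<zero>\<^bsub>free_algebra\<^esub> = 0" "f \<oplus>\<^bsub>free_algebra\<^esub> h = f + h" "s \<odot>\<^bsub>free_algebra\<^esub> f = scal s * f"
  by (simp_all add: free_algebra_def ring.extend_def module.fields_def ring_of_type_algebra_def)

lemma ring_free_algebra: "ring free_algebra"
proof (rule ringI)
  show "abelian_group (free_algebra :: (complex, 'g free_alg) module)"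
    by (rule abelian_groupI) (auto simp: free_algebra_simps algebra_simps intro: exI[of _ "- x" for x])
  show "Group.monoid (free_algebra :: (complex, 'g free_alg) module)"
    by (rule monoidI) (auto simp: free_algebra_simps mult.assoc)
qed (auto simp: free_algebra_simps distrib_left distrib_right)

lemma two_sided_ideal_genideal: "two_sided_ideal (Idl\<^bsub>free_algebra\<^esub> R)"
proof -
  interpret ideal "Idl\<^bsub>free_algebra\<^esub> R" free_algebra
    by (rule ring.genideal_ideal[OF ring_free_algebra]) (simp add: free_algebra_simps)
  show ?thesis
  proof
    fix f h assume f: "f \<in> Idl\<^bsub>free_algebra\<^esub> R"
    show "h * f \<in> Idl\<^bsub>free_algebra\<^esub> R" "f * h \<in> Idl\<^bsub>free_algebra\<^esub> R"
      using I_l_closed[OF f, of h] I_r_closed[OF f, of h] by (simp_all add: free_algebra_simps)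
    assume "h \<in> Idl\<^bsub>free_algebra\<^esub> R"
    then show "f + h \<in> Idl\<^bsub>free_algebra\<^esub> R" using additive_subgroup.a_closed[OF additive_subgroup_axioms f] by (simp add: free_algebra_simps)
  qed (use additive_subgroup.zero_closed[OF additive_subgroup_axioms] in \<open>simp add: free_algebra_simps\<close>)
qed

lemma genideal_superset: "R \<subseteq> Idl\<^bsub>free_algebra\<^esub> R"
  by (rule ring.genideal_self[OF ring_free_algebra]) (simp add: free_algebra_simps)

lemma genideal_kernel:
  assumes "\<And>f. f \<in> R \<Longrightarrow> ev g f = 0"
  shows "Idl\<^bsub>free_algebra\<^esub> R \<subseteq> {f. ev g f = 0}"
proof (rule ring.genideal_minimal[OF ring_free_algebra])
  show "ideal {f. ev g f = 0} free_algebra"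
  proof (rule idealI[OF ring_free_algebra])
    show "subgroup {f. ev g f = 0} (add_monoid free_algebra)"
    proof (rule group.subgroupI)
      show "Group.group (add_monoid (free_algebra :: (complex, 'a free_alg) module))"
        using abelian_group.a_group[OF ring.is_abelian_group[OF ring_free_algebra]] .
      have inv: "inv\<^bsub>add_monoid free_algebra\<^esub> f = - f" for f :: "'a free_alg"
        using ring.is_abelian_group[OF ring_free_algebra]
        by (intro group.inv_equality[OF abelian_group.a_group]) (simp_all add: free_algebra_simps)
      show "inv\<^bsub>add_monoid free_algebra\<^esub> f \<in> {f. ev g f = 0}" if "f \<in> {f. ev g f = 0}" for f
        using that by (simp add: inv ev_uminus)
    qed (auto simp: free_algebra_simps ev_add intro: exI[of _ 0])
  qed (auto simp: free_algebra_simps ev_mult)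
qed (use assms in auto)

section \<open>Faithfulness of the model\<close>

context root_calculus
begin

fun gm :: "calc_gen \<Rightarrow> cell lop" where
  "gm (Coord A) = a" | "gm (Coord B) = b" | "gm (Coord C) = c" | "gm (Coord D) = d"
| "gm (Form A) = ea" | "gm (Form B) = eb" | "gm (Form C) = ga" | "gm (Form D) = ed"

lemmas gm_relations = b_a c_a c_b coord_relations a_pow_r b_pow_r c_pow_r d_pow_r
  form_relations ga_ga cross_relations_ac cross_relations_bd a_ga b_ga

lemma ev_form_rels:
  assumes "f \<in> form_rels q e" "\<And>i. ev g (e i) = gm (Form i)"
  shows "ev g f = 0"
  using assms(1)
  by (auto simp: form_rels_def ev_simps assms(2) gm_relations scale_simps lop.scale_right_diff_distrib)

lemma ev_omega_rels:
  assumes "f \<in> Omega_rels q r" shows "ev gm f = 0"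
proof -
  have "ev gm f = 0" if "f \<in> coord_rels q r (\<lambda>i. gen (Coord i))" for f
    using that by (auto simp: coord_rels_def Let_def ev_simps gm_relations scale_simps p_def)
  moreover have "ev gm f = 0" if "f \<in> cross_rels q (\<lambda>i. gen (Coord i)) (\<lambda>i. gen (Form i))" for f
    using that by (auto simp: cross_rels_def ev_simps gm_relations scale_simps simp flip: p_def)
  ultimately show ?thesis using assms ev_form_rels[of f "\<lambda>i. gen (Form i)" gm] by (auto simp: Omega_rels_def)
qed

end

sublocale root_calculus \<subseteq> om: omega_ideal q r "Idl\<^bsub>free_algebra\<^esub> (Omega_rels q r)"
  by (intro omega_ideal.intro root_calculus_axioms two_sided_ideal_genideal omega_ideal_axioms.intro genideal_superset)

context root_calculus
begin

abbreviation "xc i \<equiv> gen (Coord i) :: calc_gen free_alg"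
abbreviation "xf i \<equiv> gen (Form i) :: calc_gen free_alg"

lemma ev_ideal: "f \<in> Idl\<^bsub>free_algebra\<^esub> (Omega_rels q r) \<Longrightarrow> ev gm f = 0"
  using genideal_kernel[of "Omega_rels q r" gm] ev_omega_rels by auto

text \<open>This and the next three definitions lift the adapted generators to the free algebra, by
  solving \<open>original_defs\<close> for them; the exponent \<open>r - 1\<close> stands for
  -1.\<close>

definition yf :: "calc_gen free_alg" where "yf = xc A ^ (r - 1) * xc C"
definition etf :: "calc_gen free_alg" where "etf = xf D - xf C * yf"
definition bef :: "calc_gen free_alg" where "bef = xf B + xf D * yf"
definition alf :: "calc_gen free_alg" where "alf = xf A + scal \<mu> * etf + xf C * yf"

lemma ev_adapted: "ev gm yf = y" "ev gm etf = et" "ev gm bef = be" "ev gm alf = al"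
  by (simp_all add: yf_def etf_def bef_def alf_def ev_simps y_def ai_eq ed_def eb_def ea_def scale_simps)

lemma homog_diff: "f \<in> homog P n \<Longrightarrow> h \<in> homog P n \<Longrightarrow> f - h \<in> homog P n"
  using homog_add[of f P n "scal (-1) * h"] homog_scale[of h P n "-1"] by (simp add: fa.scale_minus_left fa.scale_one)

lemma homog_xf: "xf i \<in> homog is_form 1" and homog_xc: "xc i \<in> homog is_form 0"
  using homog_gen[of "Form i" is_form] homog_gen[of "Coord i" is_form] by simp_all

lemma homog_adapted: "yf \<in> homog is_form 0" "etf \<in> homog is_form 1" "bef \<in> homog is_form 1" "alf \<in> homog is_form 1"
proof -
  show y: "yf \<in> homog is_form 0"
    unfolding yf_def using homog_mult[OF homog_power[OF homog_xc] homog_xc] by simp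
  have ys: "xf i * yf \<in> homog is_form 1" for i using homog_mult[OF homog_xf y] by simp
  then show "etf \<in> homog is_form 1" "bef \<in> homog is_form 1" "alf \<in> homog is_form 1"
    unfolding alf_def etf_def bef_def by (intro homog_add homog_diff homog_scale homog_xf ys)+
qed

lemma homog_opt: "f \<in> homog P 1 \<Longrightarrow> h \<in> homog P n \<Longrightarrow> opt i f * h \<in> homog P (of_bool i + n)"
  using homog_mult[of f P 1 h n] by (cases i) simp_all

lemma homog_mono: "xc A ^ u * (xc B ^ v * xc C ^ w) \<in> homog is_form 0"
  using homog_mult[OF homog_power[OF homog_xc] homog_mult[OF homog_power[OF homog_xc] homog_power[OF homog_xc]]] by simp

text \<open>Being images of homogeneous elements, the adapted basis forms lie in the span of the
  images of the normal words, as the counting argument requires.\<close>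

lemma bs_ev: "\<exists>f \<in> homog is_form (fdeg x). ev gm f = bs x"
proof -
  obtain i j k l u v w where x: "x = (i, j, k, l, u, v, w)" by (cases x)
  let ?f = "opt i alf * (opt j etf * (opt k bef * (opt l (xf C) * (xc A ^ u * (xc B ^ v * xc C ^ w)))))"
  have "?f \<in> homog is_form (of_bool i + (of_bool j + (of_bool k + (of_bool l + 0))))"
    by (intro homog_opt homog_adapted homog_xf homog_mono)
  moreover have "ev gm ?f = bs x"
    by (simp add: x ev_simps ev_adapted form_def mon_def mult.assoc)
  ultimately show ?thesis by (auto simp: x add_ac intro!: bexI[of _ ?f])
qed

lemma basis_word_homog: "x \<in> dcodes n \<Longrightarrow> om.basis_word x \<in> homog is_form n"
proof -
  assume x: "x \<in> dcodes n"
  obtain i j k l u v w where xe: "x = (i, j, k, l, u, v, w)" by (cases x)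
  have "opt i (xf A) * (opt j (xf B) * (opt k (xf C) * (opt l (xf D) * (xc A ^ u * (xc B ^ v * xc C ^ w)))))
     \<in> homog is_form (of_bool i + (of_bool j + (of_bool k + (of_bool l + 0))))"
    by (intro homog_opt homog_xf homog_mono)
  then show ?thesis using x by (simp add: xe om.basis_word_def form_word_def dcodes_def add_ac mult.assoc)
qed

lemma ev_spn: "f \<in> om.spn S \<Longrightarrow> ev gm f \<in> lop.span (ev gm ` S)"
proof (elim om.spn_decomp)
  fix h assume h: "h \<in> fa.span S" "f - h \<in> Idl\<^bsub>free_algebra\<^esub> (Omega_rels q r)"
  then have "ev gm f = ev gm h" using ev_ideal[of "f - h"] by (simp add: ev_diff)
  then show "ev gm f \<in> lop.span (ev gm ` S)" using ev_span[OF h(1)] by simp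
qed

lemma bs_span_words: "x \<in> dcodes n \<Longrightarrow> bs x \<in> lop.span ((\<lambda>x. ev gm (om.basis_word x)) ` dcodes n)"
  using bs_ev[of x] ev_spn[OF om.homog_spn] by (fastforce simp: dcodes_def image_image)

lemma forms_words: "forms n = lop.span ((\<lambda>x. ev gm (om.basis_word x)) ` dcodes n)"
proof -
  have "dcodes n \<subseteq> codes" by (auto simp: dcodes_def)
  from bs_indep[OF this] show ?thesis
    unfolding forms_def by (rule lop.spanning_family_span[OF finite_dcodes _ bs_span_words])
qed

lemma words_indep:
  assumes "(\<Sum>x\<in>codes. g x \<bullet> ev gm (om.basis_word x)) = 0" "x \<in> codes"
  shows "g x = 0"
proof (rule lop.spanning_family_indep[OF finite_codes _ _ assms])
  fix x assume "x \<in> codes"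
  then have "bs x \<in> lop.span ((\<lambda>x. ev gm (om.basis_word x)) ` dcodes (fdeg x))"
    by (intro bs_span_words) (simp add: dcodes_def)
  then show "bs x \<in> lop.span ((\<lambda>x. ev gm (om.basis_word x)) ` codes)"
    by (rule rev_subsetD) (intro lop.span_mono, auto simp: dcodes_def)
qed (use bs_indep in blast)

lemma ev_homog: "ev gm ` homog is_form n = forms n"
proof
  show "ev gm ` homog is_form n \<subseteq> forms n"
    using ev_spn[OF om.homog_spn] by (fastforce simp: forms_words image_image)
  show "forms n \<subseteq> ev gm ` homog is_form n"
  proof
    fix z assume "z \<in> forms n"
    then obtain g where "z = (\<Sum>x\<in>dcodes n. g x \<bullet> ev gm (om.basis_word x))"
      unfolding forms_words by (auto simp: lop.span_family)
    then have "z = ev gm (\<Sum>x\<in>dcodes n. scal (g x) * om.basis_word x)" by (simp add: ev_sum ev_scale)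
    moreover have "(\<Sum>x\<in>dcodes n. scal (g x) * om.basis_word x) \<in> fa.span (om.basis_word ` dcodes n)"
      by (intro fa.span_sum fa.span_scale fa.span_base imageI)
    then have "(\<Sum>x\<in>dcodes n. scal (g x) * om.basis_word x) \<in> homog is_form n"
      by (rule rev_subsetD) (intro homog_span, auto intro: basis_word_homog)
    ultimately show "z \<in> ev gm ` homog is_form n" by blast
  qed
qed

text \<open>Modulo the ideal every element is a combination of normal words; if it evaluates to 0,
  independence of their images makes the combination trivial.\<close>

lemma kernel_Omega: "Idl\<^bsub>free_algebra\<^esub> (Omega_rels q r) = {f. ev gm f = 0}"
proof (intro equalityI subsetI)
  fix f assume "f \<in> {f. ev gm f = 0}"
  then have f0: "ev gm f = 0" by simp
  have "Poly_Mapping.single w s \<in> om.spn (om.basis_word ` codes)" for w s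
  proof -
    have "Poly_Mapping.single w s \<in> homog is_form (length (filter is_form (letters w)))"
      by (simp add: homog_def)
    then show ?thesis by (rule om.spn_mono[OF om.homog_spn]) (intro image_mono, simp add: dcodes_def)
  qed
  then have "f \<in> om.spn (om.basis_word ` codes)"
    by (induction f rule: poly_mapping_single_induct) (auto intro: om.spn_add)
  then obtain h where h: "h \<in> fa.span (om.basis_word ` codes)" "f - h \<in> Idl\<^bsub>free_algebra\<^esub> (Omega_rels q r)"
    by (rule om.spn_decomp)
  then obtain g where g: "h = (\<Sum>x\<in>codes. scal (g x) * om.basis_word x)"
    by (auto simp: fa.span_family finite_codes)
  have "ev gm h = 0" using ev_ideal[OF h(2)] f0 by (simp add: ev_diff)
  then have "g x = 0" if "x \<in> codes" for x
    using words_indep[of g x] that by (simp add: g ev_sum ev_scale)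
  then have "h = 0" by (simp add: g fa.scale_zero_left)
  then show "f \<in> Idl\<^bsub>free_algebra\<^esub> (Omega_rels q r)" using h by simp
qed (use ev_ideal in simp)

end

section \<open>Passing to quotient modules\<close>

definition cls :: "('g \<Rightarrow> 'i lop) \<Rightarrow> 'i lop \<Rightarrow> 'g free_alg set" where
  "cls g x = {f. ev g f = x}"

text \<open>Once the ideal is a kernel, its cosets are the fibres \<open>cls\<close> of the
  evaluation, and operations on cosets become operations on operators.\<close>

locale presentation =
  fixes g :: "'g \<Rightarrow> 'i lop" and R :: "'g free_alg set"
  assumes kernel: "Idl\<^bsub>free_algebra\<^esub> R = {f. ev g f = 0}"
begin

abbreviation "P \<equiv> presented_algebra R"

lemma coset: "(Idl\<^bsub>free_algebra\<^esub> R) +>\<^bsub>free_algebra\<^esub> f = cls g (ev g f)"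
proof -
  have "h \<in> (\<Union>h\<in>{f. ev g f = 0}. {h + f}) \<longleftrightarrow> ev g h = ev g f" for h
    by (auto simp: ev_add ev_diff intro: exI[of _ "h - f"])
  then show ?thesis
    by (auto simp: a_r_coset_def' kernel free_algebra_simps cls_def)
qed

lemma presented_class_eq: "presented_class R f = cls g (ev g f)"
  by (simp add: presented_class_def coset)

lemma cls_eq_iff: "cls g (ev g f) = cls g x \<longleftrightarrow> ev g f = x"
  by (auto simp: cls_def)

lemma carrier_P: "carrier P = cls g ` range (ev g)"
  by (auto simp: presented_algebra_def quot_module_def ring.extend_def FactRing_def A_RCOSETS_def'
      coset free_algebra_simps)

lemma zero_P: "\<zero>\<^bsub>P\<^esub> = cls g 0"
  by (simp add: presented_algebra_def quot_module_def ring.extend_def FactRing_def kernel cls_def)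

lemma add_P:
  assumes "x \<in> range (ev g)" "x' \<in> range (ev g)"
  shows "cls g x \<oplus>\<^bsub>P\<^esub> cls g x' = cls g (x + x')"
proof -
  obtain f h where fh: "x = ev g f" "x' = ev g h" using assms by auto
  have "cls g x \<oplus>\<^bsub>P\<^esub> cls g x' = (\<Union>f\<in>cls g x. \<Union>h\<in>cls g x'. {f + h})"
    by (simp add: presented_algebra_def quot_module_def ring.extend_def FactRing_def set_add_def set_mult_def free_algebra_simps)
  also have "\<dots> = cls g (x + x')"
  proof (intro equalityI subsetI)
    fix s assume "s \<in> cls g (x + x')"
    then have "s = (s - h) + h" "s - h \<in> cls g x" "h \<in> cls g x'" by (auto simp: cls_def ev_diff fh)
    then show "s \<in> (\<Union>f\<in>cls g x. \<Union>h\<in>cls g x'. {f + h})" by blast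
  qed (auto simp: cls_def ev_add)
  finally show ?thesis .
qed

lemma mult_P:
  assumes "x \<in> range (ev g)" "x' \<in> range (ev g)"
  shows "cls g x \<otimes>\<^bsub>P\<^esub> cls g x' = cls g (x * x')"
proof -
  obtain f h where fh: "x = ev g f" "x' = ev g h" using assms by auto
  have "cls g x \<otimes>\<^bsub>P\<^esub> cls g x' = (\<Union>f\<in>cls g x. \<Union>h\<in>cls g x'. cls g (ev g f * ev g h))"
    by (simp add: presented_algebra_def quot_module_def ring.extend_def FactRing_def rcoset_mult_def free_algebra_simps coset ev_mult)
  also have "\<dots> = cls g (x * x')" using fh by (auto simp: cls_def)
  finally show ?thesis .
qed

lemma smult_P:
  assumes "x \<in> range (ev g)"
  shows "s \<odot>\<^bsub>P\<^esub> cls g x = cls g (cscale s x)"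
proof -
  obtain f where f: "x = ev g f" using assms by auto
  have "s \<odot>\<^bsub>P\<^esub> cls g x = (\<Union>f\<in>cls g x. cls g (cscale s (ev g f)))"
    by (simp add: presented_algebra_def quot_module_def ring.extend_def module.fields_def free_algebra_simps coset ev_scale)
  also have "\<dots> = cls g (cscale s x)" using f by (auto simp: cls_def)
  finally show ?thesis .
qed

lemma range_ev:
  "x \<in> range (ev g) \<Longrightarrow> x' \<in> range (ev g) \<Longrightarrow> x + x' \<in> range (ev g)"
  "x \<in> range (ev g) \<Longrightarrow> x' \<in> range (ev g) \<Longrightarrow> x - x' \<in> range (ev g)"
  "x \<in> range (ev g) \<Longrightarrow> x' \<in> range (ev g) \<Longrightarrow> x * x' \<in> range (ev g)"
  "x \<in> range (ev g) \<Longrightarrow> - x \<in> range (ev g)"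
  "x \<in> range (ev g) \<Longrightarrow> cscale s x \<in> range (ev g)"
  "0 \<in> range (ev g)"
  by (auto simp flip: ev_add ev_diff ev_mult ev_uminus ev_scale simp del: ev_0) (metis ev_0 rangeI)

lemma minus_P:
  assumes "x \<in> range (ev g)" "x' \<in> range (ev g)"
  shows "\<ominus>\<^bsub>P\<^esub> cls g x = cls g (- x)" "cls g x \<ominus>\<^bsub>P\<^esub> cls g x' = cls g (x - x')"
proof -
  have inv: "\<ominus>\<^bsub>P\<^esub> cls g x = cls g (- x)" if x: "x \<in> range (ev g)" for x
    unfolding a_inv_def m_inv_def
  proof (rule the_equality)
    show "cls g (- x) \<in> carrier (add_monoid P) \<and> cls g x \<otimes>\<^bsub>add_monoid P\<^esub> cls g (- x) = \<one>\<^bsub>add_monoid P\<^esub>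
       \<and> cls g (- x) \<otimes>\<^bsub>add_monoid P\<^esub> cls g x = \<one>\<^bsub>add_monoid P\<^esub>"
      using x range_ev(4)[OF x] by (auto simp: carrier_P add_P zero_P)
  next
    fix t assume t: "t \<in> carrier (add_monoid P) \<and> cls g x \<otimes>\<^bsub>add_monoid P\<^esub> t = \<one>\<^bsub>add_monoid P\<^esub>
       \<and> t \<otimes>\<^bsub>add_monoid P\<^esub> cls g x = \<one>\<^bsub>add_monoid P\<^esub>"
    then obtain f where f: "t = cls g (ev g f)" by (auto simp: carrier_P)
    obtain h where h: "x = ev g h" using x by auto
    have "cls g (ev g (h + f)) = cls g 0" using t f h by (simp add: add_P zero_P ev_add)
    then have "ev g (h + f) = 0" by (simp only: cls_eq_iff)
    then have "- x = ev g f" using h by (simp add: ev_add minus_unique)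
    then show "t = cls g (- x)" using f by simp
  qed
  show "\<ominus>\<^bsub>P\<^esub> cls g x = cls g (- x)" using inv assms by blast
  show "cls g x \<ominus>\<^bsub>P\<^esub> cls g x' = cls g (x - x')"
    unfolding a_minus_def using inv assms by (simp add: add_P range_ev(4))
qed

end

text \<open>\<open>T\<close> is thought of as a quotient map from \<open>Z\<close> with kernel
  \<open>W\<close>. As \<open>Q\<close> is only a record, the monoid structure needed for its finite
  sums is carried over along \<open>T\<close>.\<close>

lemma is_basis_transfer:
  fixes Q :: "(complex, 's) module" and T :: "'i lop \<Rightarrow> 's"
  assumes sub: "lop.subspace Z" and W: "lop.subspace W"
    and carrier: "carrier Q = T ` Z"
    and add: "\<And>x x'. x \<in> Z \<Longrightarrow> x' \<in> Z \<Longrightarrow> T x \<oplus>\<^bsub>Q\<^esub> T x' = T (x + x')"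
    and zero: "\<zero>\<^bsub>Q\<^esub> = T 0"
    and smult: "\<And>s x. x \<in> Z \<Longrightarrow> s \<odot>\<^bsub>Q\<^esub> T x = T (cscale s x)"
    and eq: "\<And>x x'. x \<in> Z \<Longrightarrow> x' \<in> Z \<Longrightarrow> T x = T x' \<longleftrightarrow> x - x' \<in> W"
    and xs: "set xs \<subseteq> Z"
    and span: "\<And>x. x \<in> Z \<Longrightarrow> \<exists>s. x - (\<Sum>i<length xs. cscale (s i) (xs ! i)) \<in> W"
    and indep: "\<And>s i. (\<Sum>i<length xs. cscale (s i) (xs ! i)) \<in> W \<Longrightarrow> i < length xs \<Longrightarrow> s i = 0"
  shows "is_basis Q (map T xs)"
proof -
  have Z: "0 \<in> Z" "\<And>x x'. x \<in> Z \<Longrightarrow> x' \<in> Z \<Longrightarrow> x + x' \<in> Z" "\<And>s x. x \<in> Z \<Longrightarrow> cscale s x \<in> Z"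
    using sub by (auto simp: lop.subspace_def)
  have "abelian_monoid Q"
    by (rule abelian_monoidI) (auto simp: carrier add zero Z add_ac)
  then interpret abelian_monoid Q .
  have finsum: "(\<Oplus>\<^bsub>Q\<^esub>i\<in>I. T (h i)) = T (\<Sum>i\<in>I. h i)"
    if "finite I" "\<And>i. i \<in> I \<Longrightarrow> h i \<in> Z" for h :: "nat \<Rightarrow> 'i lop" and I
    using that
  proof (induction I rule: finite_induct)
    case (insert i I)
    then have Zi: "h i \<in> Z" "(\<Sum>i\<in>I. h i) \<in> Z" by (auto intro: lop.subspace_sum[OF sub])
    have "(\<Oplus>\<^bsub>Q\<^esub>i\<in>insert i I. T (h i)) = T (h i) \<oplus>\<^bsub>Q\<^esub> (\<Oplus>\<^bsub>Q\<^esub>i\<in>I. T (h i))"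
      using insert.prems insert.hyps by (intro finsum_insert) (auto simp: carrier)
    then show ?case using insert Zi by (simp add: add)
  qed (simp add: zero)
  have xs_Z: "cscale s (xs ! i) \<in> Z" if "i < length xs" for s i
    using that xs by (intro Z(3)) (auto simp: subset_iff)
  have comb: "(\<Oplus>\<^bsub>Q\<^esub>i\<in>{..<length (map T xs)}. s i \<odot>\<^bsub>Q\<^esub> (map T xs ! i)) = T (\<Sum>i<length xs. cscale (s i) (xs ! i))"
    "(\<Sum>i<length xs. cscale (s i) (xs ! i)) \<in> Z" for s
  proof -
    have "(\<Oplus>\<^bsub>Q\<^esub>i\<in>{..<length (map T xs)}. s i \<odot>\<^bsub>Q\<^esub> (map T xs ! i)) = (\<Oplus>\<^bsub>Q\<^esub>i\<in>{..<length xs}. T (cscale (s i) (xs ! i)))"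
      using xs xs_Z by (intro finsum_cong') (auto simp: carrier smult subset_iff)
    then show "(\<Oplus>\<^bsub>Q\<^esub>i\<in>{..<length (map T xs)}. s i \<odot>\<^bsub>Q\<^esub> (map T xs ! i)) = T (\<Sum>i<length xs. cscale (s i) (xs ! i))"
      using finsum[of "{..<length xs}"] xs_Z by simp
    show "(\<Sum>i<length xs. cscale (s i) (xs ! i)) \<in> Z"
      by (rule lop.subspace_sum[OF sub]) (use xs_Z in simp)
  qed
  show ?thesis
    unfolding is_basis_def
  proof (intro conjI ballI)
    show "set (map T xs) \<subseteq> carrier Q" using xs by (auto simp: carrier)
    fix t assume "t \<in> carrier Q"
    then obtain x where x: "x \<in> Z" "t = T x" by (auto simp: carrier)
    obtain s where s: "x - (\<Sum>i<length xs. cscale (s i) (xs ! i)) \<in> W" using span[OF x(1)] by blast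
    \<comment> \<open>Coordinate families have to be extensional for uniqueness to hold.\<close>
    let ?s = "restrict s {..<length xs}"
    show "\<exists>!s. s \<in> {..<length (map T xs)} \<rightarrow>\<^sub>E UNIV \<and> t = (\<Oplus>\<^bsub>Q\<^esub>i\<in>{..<length (map T xs)}. s i \<odot>\<^bsub>Q\<^esub> (map T xs ! i))"
    proof (rule ex1I[of _ ?s])
      have "(\<Sum>i<length xs. cscale (?s i) (xs ! i)) = (\<Sum>i<length xs. cscale (s i) (xs ! i))"
        by (intro sum.cong) auto
      then show "?s \<in> {..<length (map T xs)} \<rightarrow>\<^sub>E UNIV \<and> t = (\<Oplus>\<^bsub>Q\<^esub>i\<in>{..<length (map T xs)}. ?s i \<odot>\<^bsub>Q\<^esub> (map T xs ! i))"
        using s x comb[of ?s] eq[of x] by auto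
    next
      fix s' assume s': "s' \<in> {..<length (map T xs)} \<rightarrow>\<^sub>E UNIV \<and> t = (\<Oplus>\<^bsub>Q\<^esub>i\<in>{..<length (map T xs)}. s' i \<odot>\<^bsub>Q\<^esub> (map T xs ! i))"
      have "x - (\<Sum>i<length xs. cscale (s' i) (xs ! i)) \<in> W"
        using s' x comb[of s'] eq[of x] by auto
      from lop.subspace_diff[OF W this s] have "(\<Sum>i<length xs. cscale (s i - s' i) (xs ! i)) \<in> W"
        by (simp add: lop.scale_left_diff_distrib sum_subtractf)
      from indep[OF this] have "s' i = ?s i" if "i < length xs" for i using that by simp
      then show "s' = ?s" using s' by (intro extensionalityI[of s' "{..<length xs}"]) (auto simp: PiE_def)
    qed
  qed
qed

context root_calculus
begin

section \<open>Explicit representatives\<close>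

lemma form_products:
  "eb * ed = - (et * be) + be * ga * y"
  "ea * eb = al * be - \<mu> \<bullet> (et * be) - al * et * y - al * ga * y * y + be * ga * y - p\<^sup>2 \<bullet> (et * ga * y * y)"
  "ea * ga = al * ga" "ga * ed = (- (p\<^sup>2)) \<bullet> (et * ga)"
  "ea * ed = al * et + al * ga * y + p\<^sup>2 \<bullet> (et * ga * y)"
  by (rule cell_eqI, simp only: original_defs pointwise prod.case,
      case_tac i; case_tac j; case_tac k; case_tac l; simp add: fac_def pointwise algebra_simps)+

lemma form_products3:
  "eb * ga * ed = p\<^sup>2 \<bullet> (et * be * ga)"
  "ea * ga * ed = (- (p\<^sup>2)) \<bullet> (al * et * ga)"
  "ea * eb * ed = - (al * et * be) + al * be * ga * y + p\<^sup>2 \<bullet> (et * be * ga * y)"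
  "ea * eb * ga * ed = p\<^sup>2 \<bullet> (al * et * be * ga)"
  by (rule cell_eqI, simp only: original_defs pointwise prod.case,
      case_tac i; case_tac j; case_tac k; case_tac l; simp add: fac_def pointwise algebra_simps)+

text \<open>The exponent of \<open>a\<close> is the one that makes the weight 1:
  \<open>b ^ (r - 1)\<close> has phase \<open>p\<close> against \<open>q^2\<close> for \<gamma>, and
  \<open>c ^ (r - 1)\<close> has phase \<open>q\<close> against \<open>p^2\<close> for
  \<beta>.\<close>

definition crit_code :: "bool \<times> bool \<times> bool \<times> bool \<Rightarrow> code" where
  "crit_code = (\<lambda>(i, j, k, l). (i, j, k, l, if k \<and> \<not> l then 1 else if l \<and> \<not> k then r - 1 else 0,
      if l then r - 1 else 0, if k then r - 1 else 0))"

lemma top_powers: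
  obtains t where "r = Suc (Suc t)" "q ^ t = p\<^sup>2" "p ^ t = q\<^sup>2" "q ^ Suc t = p" "p ^ Suc t = q"
    "qint (Suc t) = -1"
proof -
  define t where "t = r - 2"
  have t: "r = Suc (Suc t)" using r_ge by (simp add: t_def)
  have "q * q ^ Suc t = 1" "p * p ^ Suc t = 1" using q_root p_r unfolding t by simp_all
  moreover have "q ^ Suc t = p * (q * q ^ Suc t)" "p ^ Suc t = q * (p * p ^ Suc t)" by (simp_all only: qp(3,4))
  ultimately have s: "q ^ Suc t = p" "p ^ Suc t = q" by simp_all
  have "q ^ t = p * (q ^ Suc t)" "p ^ t = q * (p ^ Suc t)" by (simp_all only: power_Suc qp(3,4))
  then have "q ^ t = p\<^sup>2" "p ^ t = q\<^sup>2" unfolding s by (simp_all only: power2_eq_square)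
  moreover have "qint (Suc t) = -1"
    using q_minus_p unfolding qint_def s by (subst nonzero_divide_eq_eq) simp_all
  ultimately show ?thesis using t s that by blast
qed

lemma crit_code_props:
  "crit_code (i, j, k, l) \<in> codes" "critical (crit_code (i, j, k, l))"
  "fdeg (crit_code (i, j, k, l)) = of_bool i + of_bool j + of_bool k + of_bool l"
proof -
  obtain t where t: "r = Suc (Suc t)" "q ^ Suc t = p" "p ^ Suc t = q" using top_powers .
  show "crit_code (i, j, k, l) \<in> codes" "fdeg (crit_code (i, j, k, l)) = of_bool i + of_bool j + of_bool k + of_bool l"
    using r_ge by (auto simp: crit_code_def codes_def)
  have t': "r - 1 = Suc t" using t by simp
  show "critical (crit_code (i, j, k, l))"
    unfolding critical_def crit_code_def t'
    by (cases k; cases l; simp only: prod.case wt.simps vtop.simps wtop.simps if_True if_False simp_thms t' t(2,3) fac_def)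
      (simp_all add: power2_eq_square qp mult_ac)
qed

text \<open>The exponents of \<open>b\<close> and \<open>c\<close> are forced by \<open>vtop\<close>
  and \<open>wtop\<close>; weight 1 then determines \<open>q ^ u\<close> and, as
  \<open>u < r\<close>, also \<open>u\<close>.\<close>

lemma crit_eq: "crit n = crit_code ` bits n"
proof (intro equalityI subsetI)
  fix x assume "x \<in> crit_code ` bits n"
  then show "x \<in> crit n" using crit_code_props by (auto simp: crit_def dcodes_def bits_def)
next
  fix x assume "x \<in> crit n"
  then have x: "x \<in> codes" "critical x" "fdeg x = n" by (auto simp: crit_def dcodes_def)
  obtain i j k l u v w where xe: "x = (i, j, k, l, u, v, w)" by (cases x)
  obtain u' where c: "crit_code (i, j, k, l) = (i, j, k, l, u', v, w)"
    using x(2) by (auto simp: xe critical_def crit_code_def)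
  have lt: "u < r" "u' < r" using x(1) crit_code_props(1)[of i j k l] by (auto simp: c xe codes_def)
  define K where "K = q ^ v * p ^ w * fac k (p\<^sup>2) * fac l (q\<^sup>2)"
  have "wt x = q ^ u * K" "wt (crit_code (i, j, k, l)) = q ^ u' * K"
    by (simp_all add: xe c K_def mult.assoc)
  moreover have "wt x = 1" "wt (crit_code (i, j, k, l)) = 1"
    using x(2) crit_code_props(2)[of i j k l] by (simp_all add: critical_def)
  ultimately have K: "q ^ u * K = 1" "q ^ u' * K = 1" by simp_all
  then have "K \<noteq> 0" by auto
  with K have "q ^ u = q ^ u'" by (metis mult_right_cancel)
  then have "u = u'" using q_pow_inj lt by blast
  then have "x = crit_code (i, j, k, l)" by (simp add: xe c)
  moreover have "(i, j, k, l) \<in> bits n" using x(3) by (simp add: xe bits_def)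
  ultimately show "x \<in> crit_code ` bits n" by blast
qed

text \<open>The \<beta> term drops out because either \<beta> is present or the exponent of
  \<open>c\<close> is 0, and similarly for \<gamma>. The first \<eta> coefficient cancels, and the
  second needs both \<open>b\<close> and \<open>c\<close>; only \<beta> \<gamma> without \<eta>
  escapes.\<close>

lemma dif_crit:
  assumes "j \<or> \<not> k \<or> \<not> l"
  shows "dif (fdeg (crit_code (i, j, k, l))) (bs (crit_code (i, j, k, l))) = 0"
proof -
  obtain t where t: "r = Suc (Suc t)" "q ^ t = p\<^sup>2" "p ^ t = q\<^sup>2" "q ^ Suc t = p" "p ^ Suc t = q" using top_powers .
  have t': "r - 1 = Suc t" by (simp add: t(1))
  have wt: "wt (crit_code (i, j, k, l)) = 1" using crit_code_props(2)[of i j k l] by (simp add: critical_def)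
  obtain u v w where c: "crit_code (i, j, k, l) = (i, j, k, l, u, v, w)" by (simp add: crit_code_def)
  have uvw: "u = (if k \<and> \<not> l then 1 else if l \<and> \<not> k then Suc t else 0)" "v = (if l then Suc t else 0)" "w = (if k then Suc t else 0)"
    using c t' by (auto simp: crit_code_def)
  show ?thesis
    unfolding c dif_bs using assms wt[unfolded c]
    by (cases i; cases j; cases k; cases l)
      (simp_all add: uvw sg_def fac_def power_add t(2,3) power2_eq_square qp del: wt.simps)
qed

text \<open>The derivative of \<beta> \<gamma> b^(r-1) c^(r-1) is a nonzero multiple of \<eta>
  \<beta> \<gamma> b^(r-2) c^(r-2), and the two further terms have derivatives proportional to the
  same form. The coefficients are those of m_6 in the adapted basis: \<open>- q^2\<close> is
  \<open>q^4\<close> times the \<open>- p^2\<close> of \<open>ga * ed\<close>.\<close>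

definition mixed_rep :: "cell lop" where
  "mixed_rep = q \<bullet> bs (False, False, True, True, 0, r - 1, r - 1) - bs (False, True, True, False, 1, r - 1, r - 2)
     - q\<^sup>2 \<bullet> bs (False, True, False, True, r - 1, r - 2, r - 1)"

lemma dif_diff: "dif n (x - x') = dif n x - dif n x'"
  by (simp add: dif_def left_diff_distrib right_diff_distrib lop.scale_right_diff_distrib)

lemma dif_mixed: "dif 2 mixed_rep = 0"
proof -
  obtain t where t: "r = Suc (Suc t)" "q ^ t = p\<^sup>2" "p ^ t = q\<^sup>2" "q ^ Suc t = p" "p ^ Suc t = q" "qint (Suc t) = -1"
    using top_powers .
  have t': "r - 1 = Suc t" "r - 2 = t" using t by simp_all
  let ?e = "form False True True True * mon 0 t t"
  have 1: "dif 2 (bs (False, False, True, True, 0, Suc t, Suc t)) = (- (p\<^sup>2 * \<mu> * (p - q))) \<bullet> ?e"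
  proof -
    have "wt (False, False, True, True, 0, Suc t, Suc t) = 1"
      by (simp add: t(2,3) fac_def power2_eq_square qp mult.assoc)
    then show ?thesis
      using dif_bs[of False False True True 0 "Suc t" "Suc t"]
      by (simp add: sg_def fac_def power_add t(2,3,6) power2_eq_square qp mult_ac del: wt.simps flip: numeral_2_eq_2)
  qed
  have 2: "dif 2 (bs (False, True, True, False, 1, Suc t, t)) = (- (\<mu> * p\<^sup>2)) \<bullet> ?e"
  proof -
    have "wt (False, True, True, False, 1, Suc t, t) = 1"
      by (simp add: t(2,3) fac_def power2_eq_square qp mult.assoc)
    moreover have "ai * mon (Suc 0) t t = mon 0 t t" by (simp add: mon_def ai_a flip: mult.assoc)
    ultimately show ?thesis
      using dif_bs[of False True True False 1 "Suc t" t]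
      by (simp add: sg_def fac_def t(2,3,6) del: wt.simps flip: numeral_2_eq_2)
  qed
  have 3: "dif 2 (bs (False, True, False, True, Suc t, t, Suc t)) = (\<mu> * p\<^sup>2) \<bullet> ?e"
  proof -
    have "wt (False, True, False, True, Suc t, t, Suc t) = 1"
      by (simp add: t(2,3) fac_def power2_eq_square qp mult.assoc)
    moreover have "mon (Suc (Suc t)) t t = mon 0 t t"
      unfolding t(1)[symmetric] mon_def a_pow_r by simp
    ultimately show ?thesis
      using dif_bs[of False True False True "Suc t" t "Suc t"]
      by (simp add: sg_def fac_def t(2,3,6) del: wt.simps flip: numeral_2_eq_2)
  qed
  \<comment> \<open>Given the first two coefficients, this identity forces \<open>q^2\<close> in the
    third term and thus \<open>q^4\<close> in the stated form.\<close>
  have coef: "q * (- (p\<^sup>2 * \<mu> * (p - q))) - (- (\<mu> * p\<^sup>2)) - q\<^sup>2 * (\<mu> * p\<^sup>2) = 0"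
    by (simp add: power2_eq_square qp algebra_simps mu_eq)
  then show ?thesis
    by (simp only: mixed_rep_def t' dif_diff dif_scale 1 2 3 lop.scale_scale
        lop.scale_left_diff_distrib[symmetric] coef lop.scale_zero_left)
qed

text \<open>\<alpha> anticommutes with \<theta>, so multiplication by it preserves closedness; this
  carries the closed form m_6 over to degree 3.\<close>

lemma dif_al: "dif (Suc n) (al * x) = - (al * dif n x)"
proof -
  have "theta_op * (al * x) = - (al * (theta_op * x))"
    by (simp add: theta_op_def distrib_left distrib_right scale_simps form_swaps form_swaps_assoc mult.assoc lop.scale_one lop.scale_minus_left)
  then show ?thesis by (simp add: dif_def right_diff_distrib scale_simps mult.assoc)
qed

text \<open>The scalars that arise when the stated products of forms are written with \<alpha>,
  \<eta>, \<beta>, \<gamma>, as computed in \<open>form_products\<close> and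
  \<open>form_products3\<close>.\<close>

definition rep_coeff :: "bool \<times> bool \<times> bool \<times> bool \<Rightarrow> complex" where
  "rep_coeff t = (if t \<in> {(True, True, False, False), (False, True, True, False), (True, True, True, False)} then -1
     else if t \<in> {(False, True, False, True), (True, True, False, True)} then - (p\<^sup>2)
     else if t \<in> {(False, True, True, True), (True, True, True, True)} then p\<^sup>2 else 1)"

text \<open>In degrees 2 to 4 these are the forms of the theorem, expanded in the adapted basis.\<close>

definition rep :: "code \<Rightarrow> cell lop" where
  "rep = (\<lambda>(i, j, k, l, _).
     if \<not> j \<and> k \<and> l then (if i then al * mixed_rep + p \<bullet> bs (False, True, True, True, 0, r - 1, r - 1) else mixed_rep)
     else if (i, j, k, l) = (True, False, True, False)
       then bs (True, False, True, False, 1, 0, r - 1) - \<mu> \<bullet> bs (False, True, True, False, 1, 0, r - 1)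
     else rep_coeff (i, j, k, l) \<bullet> bs (crit_code (i, j, k, l)))"

text \<open>Any terms besides the leading one contain an \<eta> that the critical form lacks, which
  puts them into lower rank.\<close>

lemma crit_rep_rep: "crit_rep rep"
  unfolding crit_rep_def
proof (intro ballI impI)
  fix x assume x: "x \<in> codes" "critical x"
  then have "x \<in> crit (fdeg x)" by (simp add: crit_def dcodes_def)
  then obtain i j k l where xe: "x = crit_code (i, j, k, l)" unfolding crit_eq by auto
  have rep: "rep x = (if \<not> j \<and> k \<and> l then (if i then al * mixed_rep + p \<bullet> bs (False, True, True, True, 0, r - 1, r - 1) else mixed_rep)
     else if (i, j, k, l) = (True, False, True, False)
       then bs (True, False, True, False, 1, 0, r - 1) - \<mu> \<bullet> bs (False, True, True, False, 1, 0, r - 1)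
     else rep_coeff (i, j, k, l) \<bullet> bs x)"
    by (simp add: xe rep_def crit_code_def)
  have deg: "fdeg x = of_bool i + of_bool j + of_bool k + of_bool l" unfolding xe by (rule crit_code_props)
  have below: "z \<in> below x" if "z \<in> codes" "fdeg z = fdeg x" "has_et z" "\<not> has_et x" for z
    using that x trichotomy(3)[OF x(1)] by (auto simp: below_def rank_def)
  have lt: "0 < r" "Suc 0 < r" "r - Suc 0 < r" "r - 2 < r" using r_ge by simp_all
  consider (mixed) "\<not> i" "\<not> j" "k" "l" | (mixed_al) "i" "\<not> j" "k" "l" | (ab) "i" "\<not> j" "k" "\<not> l"
    | (other) "j \<or> \<not> k \<or> \<not> l" "(i, j, k, l) \<noteq> (True, False, True, False)" by auto
  then show "dif (fdeg x) (rep x) = 0 \<and> (\<exists>s e. s \<noteq> 0 \<and> e \<in> lop.span (bs ` below x) \<and> rep x = s \<bullet> bs x + e)"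
  proof cases
    case mixed
    have "x = (False, False, True, True, 0, r - 1, r - 1)" using mixed by (simp add: xe crit_code_def)
    note xx = this
    let ?e = "- bs (False, True, True, False, 1, r - 1, r - 2) - q\<^sup>2 \<bullet> bs (False, True, False, True, r - 1, r - 2, r - 1)"
    have e: "?e \<in> lop.span (bs ` below x)"
      using mixed lt by (intro lop.span_diff lop.span_neg lop.span_scale lop.span_base imageI below)
        (auto simp: deg codes_def xe crit_code_def)
    have "rep x = mixed_rep" using mixed by (simp add: rep)
    then have re: "rep x = q \<bullet> bs x + ?e"
      unfolding mixed_rep_def xx by (simp del: bs.simps)
    have "fdeg x = 2" using mixed by (simp add: deg)
    then have "dif (fdeg x) (rep x) = 0" using mixed dif_mixed by (simp add: rep)
    then show ?thesis using re e q_nz by blast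
  next
    case mixed_al
    have xx: "x = (True, False, True, True, 0, r - 1, r - 1)" using mixed_al by (simp add: xe crit_code_def)
    let ?e = "- bs (True, True, True, False, 1, r - 1, r - 2) - q\<^sup>2 \<bullet> bs (True, True, False, True, r - 1, r - 2, r - 1)
       + p \<bullet> bs (False, True, True, True, 0, r - 1, r - 1)"
    have e: "?e \<in> lop.span (bs ` below x)"
      using mixed_al lt by (intro lop.span_add lop.span_diff lop.span_neg lop.span_scale lop.span_base imageI below)
        (auto simp: deg codes_def xe crit_code_def)
    have al_bs: "al * bs (False, j, k, l, u, v, w) = bs (True, j, k, l, u, v, w)" for j k l u v w
      by (simp add: form_def mult.assoc)
    have rep_x: "rep x = al * mixed_rep + p \<bullet> bs (False, True, True, True, 0, r - 1, r - 1)"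
      using mixed_al by (simp add: rep del: bs.simps)
    then have re: "rep x = q \<bullet> bs x + ?e"
      unfolding xx mixed_rep_def right_diff_distrib scale_simps al_bs by (simp del: bs.simps)
    have "dif (Suc 2) (bs (crit_code (False, True, True, True))) = 0"
      using dif_crit[of True True True False] by (simp add: crit_code_props numeral_3_eq_3)
    then have c3: "dif (Suc 2) (bs (False, True, True, True, 0, r - 1, r - 1)) = 0" by (simp add: crit_code_def)
    have dg: "fdeg x = Suc 2" using mixed_al by (simp add: deg)
    have "dif (fdeg x) (rep x) = 0"
      unfolding dg rep_x by (simp only: dif_add dif_scale dif_al dif_mixed c3) simp
    then show ?thesis using re e q_nz by blast
  next
    case ab
    have xx: "x = (True, False, True, False, 1, 0, r - 1)" using ab by (simp add: xe crit_code_def)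
    have e: "- (\<mu> \<bullet> bs (False, True, True, False, 1, 0, r - 1)) \<in> lop.span (bs ` below x)"
      using ab lt by (intro lop.span_neg lop.span_scale lop.span_base imageI below)
        (auto simp: deg codes_def xe crit_code_def)
    have re: "rep x = 1 \<bullet> bs x + - (\<mu> \<bullet> bs (False, True, True, False, 1, 0, r - 1))"
      using ab rep by (simp add: xx lop.scale_one del: bs.simps)
    have "dif 2 (bs (crit_code (True, False, True, False))) = 0" "dif 2 (bs (crit_code (False, True, True, False))) = 0"
      using dif_crit[of False True False True] dif_crit[of True True False False] by (simp_all add: crit_code_props numeral_2_eq_2)
    then have c2: "dif 2 (bs (True, False, True, False, 1, 0, r - 1)) = 0" "dif 2 (bs (False, True, True, False, 1, 0, r - 1)) = 0"
      by (simp_all add: crit_code_def)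
    have dg: "fdeg x = 2" using ab by (simp add: deg)
    have "dif (fdeg x) (rep x) = 0"
      unfolding dg re unfolding xx by (simp only: add_uminus_conv_diff dif_diff dif_scale c2) simp
    then show ?thesis using re e by (metis zero_neq_one)
  next
    case other
    have "rep x = rep_coeff (i, j, k, l) \<bullet> bs x" using other by (auto simp: rep)
    moreover have "rep_coeff (i, j, k, l) \<noteq> 0" by (simp add: rep_coeff_def p_def q_nz)
    moreover have "dif (fdeg x) (bs x) = 0" using dif_crit[OF other(1), of i] by (simp add: xe)
    ultimately show ?thesis using lop.span_zero[of "bs ` below x"] by (intro conjI exI[of _ "rep_coeff (i, j, k, l)"] exI[of _ 0]) (simp_all add: dif_scale)
  qed
qed

end

sublocale root_calculus \<subseteq> pres: presentation gm "Omega_rels q r"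
  by unfold_locales (rule kernel_Omega)

section \<open>The cohomology expressed in the model\<close>

context root_calculus
begin

lemma forms_range: "forms n \<subseteq> range (ev gm)"
  by (auto simp flip: ev_homog)

lemma Omega_part_carrier: "carrier (Omega_part q r n) = cls gm ` forms n"
  by (simp add: Omega_part_def graded_part_def pres.presented_class_eq image_image flip: ev_homog homog_def)

lemma theta_op_eq: "ea + ed = theta_op"
proof -
  have "ea + ed = al + (et - \<mu> \<bullet> et)" by (simp add: ea_def ed_def)
  also have "et - \<mu> \<bullet> et = (1 - \<mu>) \<bullet> et" by (simp only: lop.scale_left_diff_distrib lop.scale_one)
  also have "1 - \<mu> = p\<^sup>2" by (simp add: mu_eq)
  finally show ?thesis by (simp add: theta_op_def)
qed

lemma theta_class: "theta q r = cls gm theta_op"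
  by (simp add: theta_def Omega_class_def pres.presented_class_eq ev_add theta_op_eq)

lemma theta_range: "theta_op \<in> range (ev gm)"
  unfolding theta_op_eq[symmetric] using ev_add[of gm "xf A" "xf D"] by (metis ev_gen gm.simps(5,8) rangeI)

lemma dif_range: "x \<in> range (ev gm) \<Longrightarrow> dif n x \<in> range (ev gm)"
  unfolding dif_def by (intro pres.range_ev theta_range)

lemma ext_d_cls:
  assumes x: "x \<in> range (ev gm)"
  shows "ext_d q r n (cls gm x) = cls gm (dif n x)"
proof -
  note R = pres.range_ev theta_range x
  have "ext_d q r n (cls gm x) = cls gm (- (theta_op * x - (-1) ^ n \<bullet> (x * theta_op)))"
    unfolding ext_d_def theta_class Omega_def
    using R(3)[OF R(7,8)] R(3)[OF R(8,7)] R(5)[OF R(3)[OF R(8,7)], of "(-1) ^ n"]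
      R(2)[OF R(3)[OF R(7,8)] R(5)[OF R(3)[OF R(8,7)], of "(-1) ^ n"]] R(7,8)
    by (simp only: pres.mult_P pres.smult_P pres.minus_P)
  then show ?thesis by (simp add: dif_def)
qed

lemma closed_forms_eq: "closed_forms q r n = cls gm ` {x \<in> forms n. dif n x = 0}"
proof -
  have "ext_d q r n (cls gm x) = \<zero>\<^bsub>Omega q r\<^esub> \<longleftrightarrow> dif n x = 0" if "x \<in> forms n" for x
  proof -
    have x: "x \<in> range (ev gm)" using that forms_range by blast
    obtain f where "dif n x = ev gm f" using dif_range[OF x, of n] by blast
    then show ?thesis using pres.cls_eq_iff[of f 0] by (simp add: ext_d_cls[OF x] Omega_def pres.zero_P)
  qed
  then show ?thesis unfolding closed_forms_def Omega_part_carrier by blast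
qed

lemma exact_forms_eq: "exact_forms q r n = cls gm ` exact n"
proof (cases n)
  case 0
  then show ?thesis by (simp add: exact_forms_def exact_def Omega_def pres.zero_P)
next
  case (Suc k)
  have "ext_d q r k ` cls gm ` forms k = cls gm ` dif k ` forms k"
    unfolding image_image using ext_d_cls forms_range by (intro image_cong refl) blast
  then show ?thesis by (simp add: Suc exact_forms_def exact_def Omega_part_carrier)
qed

lemma forms_subspace: "lop.subspace (forms n)"
  unfolding forms_def by (rule lop.subspace_span)

lemma closed_subspace: "lop.subspace {x \<in> forms n. dif n x = 0}"
  using forms_subspace[of n] by (auto simp: lop.subspace_def dif_0 dif_add dif_scale)

lemma exact_subspace: "lop.subspace (exact n)"
proof (cases n)
  case (Suc k)
  show ?thesis
    unfolding Suc exact_def nat.case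
  proof (rule lop.subspaceI)
    note F = forms_subspace[of k]
    show "0 \<in> dif k ` forms k" using lop.subspace_0[OF F] by (force simp: dif_0)
    fix x x' assume "x \<in> dif k ` forms k" "x' \<in> dif k ` forms k"
    then show "x + x' \<in> dif k ` forms k" using lop.subspace_add[OF F] by (auto simp flip: dif_add)
  next
    fix s x assume "x \<in> dif k ` forms k"
    then show "s \<bullet> x \<in> dif k ` forms k" using lop.subspace_scale[OF forms_subspace[of k]] by (auto simp flip: dif_scale)
  qed
qed (simp add: exact_def lop.subspace_def)

lemma exact_range: "exact n \<subseteq> range (ev gm)"
  using dif_range forms_range by (cases n) (auto simp: exact_def intro: pres.range_ev(6), blast)

text \<open>A coset of the exact forms; its members are in turn cosets of the ideal, that is, fibres
  of the evaluation.\<close>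

definition coh_class :: "nat \<Rightarrow> cell lop \<Rightarrow> calc_gen free_alg set set" where
  "coh_class n x = {cls gm (e + x) | e. e \<in> exact n}"

lemma coh_coset: "x \<in> range (ev gm) \<Longrightarrow> exact_forms q r n +>\<^bsub>Omega q r\<^esub> cls gm x = coh_class n x"
  unfolding a_r_coset_def' exact_forms_eq coh_class_def Omega_def
  using exact_range pres.add_P by blast

lemma coh_class_eq_iff:
  assumes "x \<in> range (ev gm)" "x' \<in> range (ev gm)"
  shows "coh_class n x = coh_class n x' \<longleftrightarrow> x - x' \<in> exact n"
proof
  assume "coh_class n x = coh_class n x'"
  moreover have "cls gm x \<in> coh_class n x"
    unfolding coh_class_def using lop.subspace_0[OF exact_subspace[of n]] by force
  ultimately obtain e where e: "e \<in> exact n" "cls gm x = cls gm (e + x')" unfolding coh_class_def by auto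
  obtain f where "x = ev gm f" using assms by blast
  then have "x = e + x'" using e(2) pres.cls_eq_iff[of f "e + x'"] by simp
  then show "x - x' \<in> exact n" using e by simp
next
  assume d: "x - x' \<in> exact n"
  have "coh_class n x \<subseteq> coh_class n x'" if "x - x' \<in> exact n" for x x'
  proof
    fix t assume "t \<in> coh_class n x"
    then obtain e where "e \<in> exact n" "t = cls gm (e + x)" by (auto simp: coh_class_def)
    then have "e + (x - x') \<in> exact n" "t = cls gm ((e + (x - x')) + x')"
      using lop.subspace_add[OF exact_subspace, of e n "x - x'"] that by simp_all
    then show "t \<in> coh_class n x'" unfolding coh_class_def by blast
  qed
  moreover have "x' - x \<in> exact n" using lop.subspace_neg[OF exact_subspace d] by simp
  ultimately show "coh_class n x = coh_class n x'" using d by blast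
qed

abbreviation "Z n \<equiv> {x \<in> forms n. dif n x = 0}"

lemma Z_range: "x \<in> Z n \<Longrightarrow> x \<in> range (ev gm)"
  using forms_range by blast

lemma coh_coset_Z: "x \<in> Z n \<Longrightarrow> exact_forms q r n +>\<^bsub>(Omega q r)\<lparr>carrier := closed_forms q r n\<rparr>\<^esub> cls gm x = coh_class n x"
  using coh_coset[OF Z_range, of x n] by (simp add: a_r_coset_def')

lemma coh_carrier: "carrier (cohomology q r n) = coh_class n ` Z n"
proof -
  have "carrier (cohomology q r n) = (\<Union>t\<in>closed_forms q r n. {exact_forms q r n +>\<^bsub>(Omega q r)\<lparr>carrier := closed_forms q r n\<rparr>\<^esub> t})"
    by (simp add: cohomology_def quot_module_def ring.extend_def FactRing_def A_RCOSETS_def')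
  also have "\<dots> = (\<Union>x\<in>Z n. {coh_class n x})"
    unfolding closed_forms_eq[of n] using coh_coset_Z[of _ n] by (simp add: closed_forms_eq)
  finally show ?thesis by auto
qed

lemma coh_zero: "\<zero>\<^bsub>cohomology q r n\<^esub> = coh_class n 0"
  by (auto simp: cohomology_def quot_module_def ring.extend_def FactRing_def coh_class_def exact_forms_eq)

lemma coh_add:
  assumes "x \<in> Z n" "x' \<in> Z n"
  shows "coh_class n x \<oplus>\<^bsub>cohomology q r n\<^esub> coh_class n x' = coh_class n (x + x')"
proof -
  note R = Z_range[OF assms(1)] Z_range[OF assms(2)]
  have "coh_class n x \<oplus>\<^bsub>cohomology q r n\<^esub> coh_class n x' = (\<Union>s\<in>coh_class n x. \<Union>t\<in>coh_class n x'. {s \<oplus>\<^bsub>Omega q r\<^esub> t})"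
    by (simp add: cohomology_def quot_module_def ring.extend_def FactRing_def set_add_def set_mult_def)
  also have "\<dots> = {cls gm ((e + x) + (e' + x')) | e e'. e \<in> exact n \<and> e' \<in> exact n}"
  proof -
    have add: "cls gm (e + x) \<oplus>\<^bsub>Omega q r\<^esub> cls gm (e' + x') = cls gm ((e + x) + (e' + x'))"
      if "e \<in> exact n" "e' \<in> exact n" for e e'
      unfolding Omega_def using that exact_range R by (intro pres.add_P pres.range_ev(1)) auto
    show ?thesis
    proof (intro equalityI subsetI)
      fix s assume "s \<in> (\<Union>s\<in>coh_class n x. \<Union>t\<in>coh_class n x'. {s \<oplus>\<^bsub>Omega q r\<^esub> t})"
      then obtain e e' where "e \<in> exact n" "e' \<in> exact n" "s = cls gm (e + x) \<oplus>\<^bsub>Omega q r\<^esub> cls gm (e' + x')"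
        unfolding coh_class_def by blast
      then show "s \<in> {cls gm ((e + x) + (e' + x')) | e e'. e \<in> exact n \<and> e' \<in> exact n}" using add by blast
    next
      fix s assume "s \<in> {cls gm ((e + x) + (e' + x')) | e e'. e \<in> exact n \<and> e' \<in> exact n}"
      then obtain e e' where e: "e \<in> exact n" "e' \<in> exact n" "s = cls gm (e + x) \<oplus>\<^bsub>Omega q r\<^esub> cls gm (e' + x')"
        using add by blast
      then show "s \<in> (\<Union>s\<in>coh_class n x. \<Union>t\<in>coh_class n x'. {s \<oplus>\<^bsub>Omega q r\<^esub> t})"
        unfolding coh_class_def by blast
    qed
  qed
  also have "\<dots> = coh_class n (x + x')"
  proof (intro equalityI subsetI)
    fix s assume "s \<in> {cls gm ((e + x) + (e' + x')) | e e'. e \<in> exact n \<and> e' \<in> exact n}"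
    then obtain e e' where e: "e \<in> exact n" "e' \<in> exact n" "s = cls gm ((e + e') + (x + x'))"
      by (auto simp: add_ac)
    then show "s \<in> coh_class n (x + x')"
      using lop.subspace_add[OF exact_subspace e(1,2)] unfolding coh_class_def by blast
  next
    fix s assume "s \<in> coh_class n (x + x')"
    then obtain e where "e \<in> exact n" "s = cls gm ((e + x) + (0 + x'))" by (auto simp: coh_class_def add_ac)
    then show "s \<in> {cls gm ((e + x) + (e' + x')) | e e'. e \<in> exact n \<and> e' \<in> exact n}"
      using lop.subspace_0[OF exact_subspace[of n]] by blast
  qed
  finally show ?thesis .
qed

text \<open>Scalar multiplication in the quotient is a union over all members of a coset; they give
  the same class, and the union is nonempty because 0 is exact.\<close>

lemma coh_smult:
  assumes "x \<in> Z n"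
  shows "s \<odot>\<^bsub>cohomology q r n\<^esub> coh_class n x = coh_class n (s \<bullet> x)"
proof -
  note R = Z_range[OF assms]
  have "s \<odot>\<^bsub>cohomology q r n\<^esub> coh_class n x = (\<Union>t\<in>coh_class n x. exact_forms q r n +>\<^bsub>Omega q r\<^esub> (s \<odot>\<^bsub>Omega q r\<^esub> t))"
    by (simp add: cohomology_def quot_module_def ring.extend_def module.fields_def a_r_coset_def')
  also have "\<dots> = (\<Union>e\<in>exact n. exact_forms q r n +>\<^bsub>Omega q r\<^esub> (s \<odot>\<^bsub>Omega q r\<^esub> cls gm (e + x)))"
    unfolding coh_class_def by blast
  also have "\<dots> = (\<Union>e\<in>exact n. coh_class n (s \<bullet> x))"
  proof (rule SUP_cong[OF refl])
    fix e assume e: "e \<in> exact n"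
    then have ex: "e + x \<in> range (ev gm)" using exact_range R by (intro pres.range_ev(1)) auto
    have "exact_forms q r n +>\<^bsub>Omega q r\<^esub> (s \<odot>\<^bsub>Omega q r\<^esub> cls gm (e + x)) = coh_class n (s \<bullet> (e + x))"
      using coh_coset[OF pres.range_ev(5)[OF ex]] pres.smult_P[OF ex] by (simp add: Omega_def)
    also have "\<dots> = coh_class n (s \<bullet> x)"
    proof (subst coh_class_eq_iff)
      show "s \<bullet> (e + x) - s \<bullet> x \<in> exact n"
        using lop.subspace_scale[OF exact_subspace e] by (simp add: lop.scale_right_distrib)
    qed (use ex R in \<open>auto intro: pres.range_ev(5)\<close>)
    finally show "exact_forms q r n +>\<^bsub>Omega q r\<^esub> (s \<odot>\<^bsub>Omega q r\<^esub> cls gm (e + x)) = coh_class n (s \<bullet> x)" .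
  qed
  also have "\<dots> = coh_class n (s \<bullet> x)" using lop.subspace_0[OF exact_subspace[of n]] by blast
  finally show ?thesis .
qed

lemma rep_Z: "x \<in> crit n \<Longrightarrow> rep x \<in> Z n"
proof -
  assume "x \<in> crit n"
  then have x: "x \<in> dcodes n" "x \<in> codes" "critical x" "fdeg x = n" by (auto simp: crit_def dcodes_def)
  obtain s e where se: "dif (fdeg x) (rep x) = 0" "e \<in> lop.span (bs ` below x)" "rep x = s \<bullet> bs x + e"
    using crit_rep_rep x unfolding crit_rep_def by blast
  have "e \<in> forms n"
    using se(2) unfolding forms_def by (rule rev_subsetD) (intro lop.span_mono image_mono, auto simp: below_def dcodes_def x)
  moreover have "s \<bullet> bs x \<in> forms n"
    unfolding forms_def using x by (intro lop.span_scale lop.span_base imageI)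
  ultimately have "rep x \<in> forms n" unfolding se(3) by (rule lop.subspace_add[OF forms_subspace, rotated])
  then show "rep x \<in> Z n" using se(1) x(4) by simp
qed

lemma cohomology_is_basis:
  assumes "distinct bl" "set bl = bits n"
  shows "is_basis (cohomology q r n) (map (coh_class n) (map (\<lambda>t. rep (crit_code t)) bl))"
proof -
  let ?xs = "map (\<lambda>t. rep (crit_code t)) bl"
  let ?cs = "map crit_code bl"
  have inj: "inj crit_code" by (auto simp: inj_def crit_code_def)
  have cs: "distinct ?cs" "set ?cs = crit n"
    using assms inj by (auto simp: distinct_map crit_eq intro: inj_on_subset)
  have sum: "(\<Sum>u\<in>crit n. g u \<bullet> rep u) = (\<Sum>i<length ?xs. g (?cs ! i) \<bullet> (?xs ! i))" for g
    unfolding cs(2)[symmetric] using sum.reindex_bij_betw[OF bij_betw_nth[OF cs(1) refl refl], of "\<lambda>u. g u \<bullet> rep u"]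
    by simp
  show ?thesis
  proof (rule is_basis_transfer[where Q = "cohomology q r n" and T = "coh_class n" and Z = "Z n" and W = "exact n"])
    show "lop.subspace (Z n)" "lop.subspace (exact n)" "carrier (cohomology q r n) = coh_class n ` Z n"
      "\<zero>\<^bsub>cohomology q r n\<^esub> = coh_class n 0"
      by (fact closed_subspace exact_subspace coh_carrier coh_zero)+
    show "coh_class n x \<oplus>\<^bsub>cohomology q r n\<^esub> coh_class n x' = coh_class n (x + x')" if "x \<in> Z n" "x' \<in> Z n" for x x'
      using that by (rule coh_add)
    show "s \<odot>\<^bsub>cohomology q r n\<^esub> coh_class n x = coh_class n (s \<bullet> x)" if "x \<in> Z n" for s x
      using that by (rule coh_smult)
    show "coh_class n x = coh_class n x' \<longleftrightarrow> x - x' \<in> exact n" if "x \<in> Z n" "x' \<in> Z n" for x x'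
      using that by (intro coh_class_eq_iff Z_range)
    have "rep (crit_code t) \<in> Z n" if "t \<in> bits n" for t
      by (rule rep_Z) (simp add: crit_eq that)
    then show "set ?xs \<subseteq> Z n" unfolding set_map assms(2) by blast
    show "\<exists>s. x - (\<Sum>i<length ?xs. s i \<bullet> (?xs ! i)) \<in> exact n" if "x \<in> Z n" for x
    proof -
      have x: "x \<in> forms n" "dif n x = 0" using that by auto
      obtain g where "x - (\<Sum>u\<in>crit n. g u \<bullet> rep u) \<in> exact n"
        by (rule closed_decomp[OF crit_rep_rep x])
      then show ?thesis unfolding sum by (rule exI[of _ "\<lambda>i. g (?cs ! i)"])
    qed
    fix s i assume s: "(\<Sum>i<length ?xs. s i \<bullet> (?xs ! i)) \<in> exact n" and i: "i < length ?xs"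
    \<comment> \<open>\<open>crit_indep\<close> expects coefficients indexed by codes;
      \<open>g\<close> moves them there from positions in the list.\<close>
    define g where "g u = s (THE i. i < length ?cs \<and> ?cs ! i = u)" for u
    have g: "g (?cs ! i) = s i" if "i < length ?xs" for i
    proof -
      have "(THE j. j < length ?cs \<and> ?cs ! j = ?cs ! i) = i"
        using that cs(1) by (intro the_equality) (auto simp: nth_eq_iff_index_eq simp del: nth_map)
      then show ?thesis by (simp add: g_def del: nth_map)
    qed
    have "(\<Sum>u\<in>crit n. g u \<bullet> rep u) = (\<Sum>i<length ?xs. s i \<bullet> (?xs ! i))"
      unfolding sum by (rule sum.cong[OF refl]) (simp only: lessThan_iff g)
    then have "(\<Sum>u\<in>crit n. g u \<bullet> rep u) \<in> exact n" using s by simp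
    then have "g (?cs ! i) = 0"
      by (rule crit_indep[OF crit_rep_rep]) (use nth_mem[of i ?cs] i in \<open>simp add: cs(2) del: nth_map set_map\<close>)
    then show "s i = 0" using g i by simp
  qed
qed

lemma cohomology_dim: "has_dim (cohomology q r n) (card (bits n))"
proof -
  have "finite (bits n)" by (rule finite_subset[of _ UNIV]) simp_all
  then obtain bl where "distinct bl" "set bl = bits n" using finite_distinct_list by blast
  then show ?thesis using cohomology_is_basis[of bl n] unfolding has_dim_def by (metis distinct_card length_map)
qed

lemma cohomology_basisI:
  assumes "distinct bl" "set bl = bits n" "map (ev gm) fs = map (\<lambda>t. rep (crit_code t)) bl"
  shows "cohomology_basis q r n fs"
proof -
  have cl: "Omega_class q r f = cls gm (ev gm f)" for f by (simp add: Omega_class_def pres.presented_class_eq)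
  have "ev gm f \<in> Z n" if "f \<in> set fs" for f
  proof -
    have "ev gm f \<in> set (map (\<lambda>t. rep (crit_code t)) bl)" using that unfolding assms(3)[symmetric] by simp
    then obtain t where "t \<in> bits n" "ev gm f = rep (crit_code t)" using assms(2) by auto
    then show ?thesis using rep_Z[of "crit_code t" n] by (simp add: crit_eq)
  qed
  then have "Omega_class q r ` set fs \<subseteq> closed_forms q r n" by (auto simp: cl closed_forms_eq)
  moreover have "map (\<lambda>f. exact_forms q r n +>\<^bsub>Omega q r\<^esub> Omega_class q r f) fs = map (coh_class n) (map (ev gm) fs)"
    using coh_coset by (simp add: cl)
  ultimately show ?thesis
    unfolding cohomology_basis_def using cohomology_is_basis[OF assms(1,2)] assms(3) by simp
qed

section \<open>Evaluating the stated forms\<close>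

lemma y_a: "y * (a * x) = q \<bullet> (c * x)"
proof -
  have "y * a = q \<bullet> c" by (simp add: y_def mult.assoc c_a scale_simps) (simp add: ai_a flip: mult.assoc)
  then show ?thesis by (simp add: scale_simps flip: mult.assoc)
qed

lemma c_b_pow: "c * (b ^ n * x) = b ^ n * (c * x)"
  using swap_assoc[OF swap_pow_right[OF swap1[OF c_b]]] by (simp add: lop.scale_one)

lemma c_top: "c * c ^ (r - Suc 0) = 0" "c * c ^ (r - 2) = c ^ (r - Suc 0)"
proof -
  have "Suc (r - Suc 0) = r" "Suc (r - 2) = r - Suc 0" using r_ge by auto
  then show "c * c ^ (r - Suc 0) = 0" "c * c ^ (r - 2) = c ^ (r - Suc 0)"
    using c_pow_r power_Suc[of c] by metis+
qed

lemma q4_p2: "q ^ 4 * p\<^sup>2 = q\<^sup>2" "p\<^sup>2 * q ^ 4 = q\<^sup>2" "p\<^sup>2 * q = p" "q * p\<^sup>2 = p"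
  by (simp_all add: power4_eq_xxxx power2_eq_square qp mult.assoc)

text \<open>Rewriting \<open>ea * eb * ga * ed\<close> evaluates the last three factors first and
  leaves this product.\<close>

lemma ea_et_be_ga: "ea * et * be * ga = al * et * be * ga"
  by (rule cell_eqI, simp only: original_defs pointwise prod.case,
      case_tac i; case_tac j; case_tac k; case_tac l; simp add: fac_def pointwise algebra_simps)

lemmas form_products_assoc = form_products[THEN assoc_swap, unfolded mult.assoc]
lemmas form_products3_assoc = form_products3[THEN assoc_swap, unfolded mult.assoc]
  ea_et_be_ga[THEN assoc_swap, unfolded mult.assoc]

lemmas eval_simps = ev_simps scale_simps distrib_right left_diff_distrib right_diff_distrib y_a c_b_pow c_top q4_p2 rep_def crit_code_def
  rep_coeff_def form_def mon_def lop.scale_one lop.scale_minus_left lop.scale_minus_right lop.scale_right_diff_distrib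

text \<open>In the first two forms the terms with \<open>y\<close> meet
  \<open>a * c ^ (r - 1)\<close> and vanish as multiples of \<open>c ^ r\<close>.\<close>

lemma ev_reps2:
  "ev gm (xf B * xf D * xc A * xc C ^ (r - 1)) = rep (crit_code (False, True, True, False))"
  "ev gm (xf A * xf B * xc A * xc C ^ (r - 1)) = rep (crit_code (True, False, True, False))"
  "ev gm (xf A * xf C * xc A ^ (r - 1) * xc B ^ (r - 1)) = rep (crit_code (True, False, False, True))"
  "ev gm (xf C * xf D * xc A ^ (r - 1) * xc B ^ (r - 1)) = rep (crit_code (False, True, False, True))"
  by (simp_all add: eval_simps mult.assoc form_products_assoc)

lemma ev_rep_m5: "ev gm ((xf A * xf C - xf C * xf D) * xc A ^ (r - 1) * xc C - xf A * xf D) = rep (crit_code (True, True, False, False))"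
proof -
  have yac: "a ^ (r - 1) * c = y" by (simp add: y_def ai_eq)
  have "ev gm ((xf A * xf C - xf C * xf D) * xc A ^ (r - 1) * xc C - xf A * xf D) = (ea * ga - ga * ed) * (a ^ (r - 1) * c) - ea * ed"
    by (simp only: ev_simps ev_gen gm.simps mult.assoc)
  also have "\<dots> = - (al * et)"
    unfolding yac form_products by (simp add: distrib_right left_diff_distrib scale_simps lop.scale_minus_left mult.assoc)
  finally show ?thesis by (simp add: eval_simps)
qed

text \<open>Here the term with \<open>y\<close> survives, since \<open>c * c ^ (r - 2)\<close> is
  the top power; it supplies the leading form with \<beta> \<gamma>.\<close>

lemma ev_rep_m6:
  "ev gm (xf B * xf D * xc A * xc B ^ (r - 1) * xc C ^ (r - 2)
     + scal (q ^ 4) * xf C * xf D * xc A ^ (r - 1) * xc B ^ (r - 2) * xc C ^ (r - 1)) = rep (crit_code (False, False, True, True))"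
  by (simp add: eval_simps mixed_rep_def mult.assoc form_products_assoc)

lemma ev_reps3:
  "ev gm (xf B * xf C * xf D * xc B ^ (r - 1) * xc C ^ (r - 1)) = rep (crit_code (False, True, True, True))"
  "ev gm (xf A * xf B * xf D * xc A * xc C ^ (r - 1)) = rep (crit_code (True, True, True, False))"
  "ev gm (xf A * xf C * xf D * xc A ^ (r - 1) * xc B ^ (r - 1)) = rep (crit_code (True, True, False, True))"
  "ev gm (xf A * xf B * xf C * xf D * xc B ^ (r - 1) * xc C ^ (r - 1)) = rep (crit_code (True, True, True, True))"
  by (simp_all add: eval_simps mult.assoc form_products3_assoc)

text \<open>Two terms with \<open>y\<close> survive: one leads, the other is the summand of
  \<open>rep\<close> that is added to \<alpha> times \<open>mixed_rep\<close>.\<close>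

lemma ev_rep_s:
  "ev gm (xf A * xf B * xf D * xc A * xc B ^ (r - 1) * xc C ^ (r - 2)
     + scal (q ^ 4) * xf A * xf C * xf D * xc A ^ (r - 1) * xc B ^ (r - 2) * xc C ^ (r - 1)) = rep (crit_code (True, False, True, True))"
  by (simp add: eval_simps mixed_rep_def mult.assoc form_products3_assoc)

section \<open>The dimensions of Lambda\<close>

definition gl :: "idx \<Rightarrow> cell lop" where "gl i = gm (Form i)"

lemma bits_eqI: "(\<And>i j k l. (i, j, k, l) \<in> bits n \<longleftrightarrow> (i, j, k, l) \<in> S) \<Longrightarrow> bits n = S"
  by auto

lemma bits_lists:
  "bits 0 = set [(False, False, False, False)]"
  "bits 1 = set [(True, False, False, False), (False, True, False, False), (False, False, True, False), (False, False, False, True)]"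
  "bits 2 = set [(False, True, True, False), (True, False, True, False), (True, False, False, True), (False, True, False, True),
     (True, True, False, False), (False, False, True, True)]"
  "bits 3 = set [(False, True, True, True), (True, True, True, False), (True, True, False, True), (True, False, True, True)]"
  "bits 4 = set [(True, True, True, True)]"
  by (rule bits_eqI; case_tac i; case_tac j; case_tac k; case_tac l; simp add: bits_def)+

lemma sum_list_nth: "distinct bl \<Longrightarrow> (\<Sum>t\<in>set bl. F t) = (\<Sum>i<length bl. F (bl ! i))"
  using sum.reindex_bij_betw[OF bij_betw_nth[of bl "{..<length bl}" "set bl"], of F] by simp

lemma ev_gl_word: "ev gl (form_word gen t) = ev gm (form_word xf t)"
  by (cases t) (simp add: form_word_def ev_simps gl_def)

text \<open>A form word is a normal word of the full calculus with all exponents 0, so independence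
  is inherited from \<Omega>.\<close>

lemma gl_indep:
  assumes "(\<Sum>t\<in>T. g t \<bullet> ev gl (form_word gen t)) = 0" "t \<in> T"
  shows "g t = 0"
proof -
  define emb :: "bool \<times> bool \<times> bool \<times> bool \<Rightarrow> code" where "emb = (\<lambda>(i, j, k, l). (i, j, k, l, 0, 0, 0))"
  define prj :: "code \<Rightarrow> bool \<times> bool \<times> bool \<times> bool" where "prj = (\<lambda>(i, j, k, l, _). (i, j, k, l))"
  have pe: "prj (emb t) = t" for t by (cases t) (simp add: emb_def prj_def)
  have word: "om.basis_word (emb t) = form_word xf t" for t by (cases t) (simp add: emb_def om.basis_word_def)
  have emb: "emb ` T \<subseteq> codes" using r_ge by (auto simp: emb_def codes_def)
  have inj: "inj_on emb T" using pe by (metis inj_onI)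
  have "(\<Sum>x\<in>codes. (if x \<in> emb ` T then g (prj x) else 0) \<bullet> ev gm (om.basis_word x))
      = (\<Sum>x\<in>emb ` T. g (prj x) \<bullet> ev gm (om.basis_word x))"
    using emb finite_codes by (intro sum.mono_neutral_cong_right) auto
  also have "\<dots> = (\<Sum>t\<in>T. g t \<bullet> ev gl (form_word gen t))"
    by (simp add: sum.reindex[OF inj] pe word ev_gl_word)
  finally have "(if emb t \<in> emb ` T then g (prj (emb t)) else 0) = 0"
    using assms emb by (intro words_indep[of "\<lambda>x. if x \<in> emb ` T then g (prj x) else 0"]) auto
  then show ?thesis using assms(2) by (simp add: pe)
qed

end

sublocale root_calculus \<subseteq> lam: form_ideal "Idl\<^bsub>free_algebra\<^esub> (form_rels q gen)" q gen
  by (intro form_ideal.intro two_sided_ideal_genideal form_ideal_axioms.intro genideal_superset q_nz)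

context root_calculus
begin

lemma ev_lambda_ideal: "f \<in> Idl\<^bsub>free_algebra\<^esub> (form_rels q gen) \<Longrightarrow> ev gl f = 0"
  using genideal_kernel[of "form_rels q gen" gl] ev_form_rels[of _ gen gl] by (auto simp: gl_def)

lemma lambda_single: "Poly_Mapping.single w s \<in> lam.spn (lam.words (length (letters w)))"
  unfolding single_word by (intro lam.spn_scale lam.prod_words)

lemma lambda_homog_spn:
  assumes "f \<in> homog (\<lambda>_. True) n"
  shows "f \<in> lam.spn (lam.words n)"
proof -
  have "(\<Sum>w\<in>S. Poly_Mapping.single w (Poly_Mapping.lookup f w)) \<in> lam.spn (lam.words n)"
    if "finite S" "S \<subseteq> Poly_Mapping.keys f" for S
    using that
  proof (induction S rule: finite_induct)
    case (insert w S)
    then have "length (letters w) = n" using assms by (auto simp: homog_def)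
    then show ?case using insert lambda_single[of w] by (auto intro: lam.spn_add)
  qed (simp add: lam.spn_0)
  then show ?thesis by (metis poly_mapping_expand finite_keys order_refl)
qed

lemma finite_bits [simp]: "finite (T :: (bool \<times> bool \<times> bool \<times> bool) set)"
  by (rule finite_subset[of _ UNIV]) simp_all

lemma kernel_Lambda: "Idl\<^bsub>free_algebra\<^esub> (form_rels q gen) = {f. ev gl f = 0}"
proof (intro equalityI subsetI)
  fix f assume "f \<in> {f. ev gl f = 0}"
  then have f0: "ev gl f = 0" by simp
  have "Poly_Mapping.single w s \<in> lam.spn (form_word gen ` UNIV)" for w s
    by (rule lam.spn_mono[OF lambda_single]) (auto simp: lam.words_def)
  then have "f \<in> lam.spn (form_word gen ` UNIV)"
    by (induction f rule: poly_mapping_single_induct) (auto intro: lam.spn_add)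
  then obtain h where h: "h \<in> fa.span (form_word gen ` UNIV)" "f - h \<in> Idl\<^bsub>free_algebra\<^esub> (form_rels q gen)"
    by (rule lam.spn_decomp)
  obtain g where g: "h = (\<Sum>t\<in>UNIV. scal (g t) * form_word gen t)"
    using h(1) unfolding fa.span_family[OF finite_bits] by blast
  have "ev gl h = 0" using ev_lambda_ideal[OF h(2)] f0 by (simp add: ev_diff)
  then have "g t = 0" for t
    using gl_indep[of g UNIV t] by (simp add: g ev_sum ev_scale)
  then have "h = 0" by (simp add: g fa.scale_zero_left)
  then show "f \<in> Idl\<^bsub>free_algebra\<^esub> (form_rels q gen)" using h by simp
qed (use ev_lambda_ideal in simp)

end

sublocale root_calculus \<subseteq> lpres: presentation gl "form_rels q gen"
  by unfold_locales (rule kernel_Lambda)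

context root_calculus
begin

lemma Lambda_dim: "has_dim (Lambda_part q n) (card (bits n))"
proof -
  obtain bl where bl: "distinct bl" "set bl = bits n" using finite_distinct_list[OF finite_bits[of "bits n"]] by blast
  let ?w = "\<lambda>t. ev gl (form_word gen t)"
  define V where "V = ev gl ` homog (\<lambda>_. True) n"
  have V_range: "x \<in> range (ev gl)" if "x \<in> V" for x using that by (auto simp: V_def)
  have homog_word: "form_word gen t \<in> homog (\<lambda>_. True) n" if "t \<in> bits n" for t
  proof -
    obtain i j k l where t: "t = (i, j, k, l)" by (cases t)
    have e: "gen x \<in> homog (\<lambda>_. True) 1" for x :: idx using homog_gen[of x "\<lambda>_. True"] by simp
    have "opt i (gen A) * (opt j (gen B) * (opt k (gen C) * (opt l (gen D) * 1)))
       \<in> homog (\<lambda>_. True) (of_bool i + (of_bool j + (of_bool k + (of_bool l + 0))))"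
      by (intro homog_opt e homog_1)
    then show ?thesis using that by (simp add: t form_word_def bits_def add_ac)
  qed
  have "is_basis (Lambda_part q n) (map (cls gl) (map ?w bl))"
  proof (rule is_basis_transfer[where Q = "Lambda_part q n" and T = "cls gl" and Z = V and W = "{0}"])
    show "lop.subspace V"
      unfolding V_def
    proof (rule lop.subspaceI)
      show "0 \<in> ev gl ` homog (\<lambda>_. True) n" using homog_0 by (metis ev_0 imageI)
    next
      fix x x' assume "x \<in> ev gl ` homog (\<lambda>_. True) n" "x' \<in> ev gl ` homog (\<lambda>_. True) n"
      then show "x + x' \<in> ev gl ` homog (\<lambda>_. True) n" by (auto simp: homog_add simp flip: ev_add)
    next
      fix s x assume "x \<in> ev gl ` homog (\<lambda>_. True) n"
      then show "s \<bullet> x \<in> ev gl ` homog (\<lambda>_. True) n" by (auto simp: homog_scale simp flip: ev_scale)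
    qed
    show "lop.subspace {0}" by (rule lop.subspace_single_0)
    show "carrier (Lambda_part q n) = cls gl ` V"
      by (simp add: Lambda_part_def graded_part_def lpres.presented_class_eq image_image V_def homog_def)
    show "cls gl x \<oplus>\<^bsub>Lambda_part q n\<^esub> cls gl x' = cls gl (x + x')" if "x \<in> V" "x' \<in> V" for x x'
      using lpres.add_P[OF V_range V_range] that by (simp add: Lambda_part_def graded_part_def)
    show "\<zero>\<^bsub>Lambda_part q n\<^esub> = cls gl 0" using lpres.zero_P by (simp add: Lambda_part_def graded_part_def)
    show "s \<odot>\<^bsub>Lambda_part q n\<^esub> cls gl x = cls gl (s \<bullet> x)" if "x \<in> V" for s x
      using lpres.smult_P[OF V_range[OF that]] by (simp add: Lambda_part_def graded_part_def)
    show "cls gl x = cls gl x' \<longleftrightarrow> x - x' \<in> {0}" if "x \<in> V" "x' \<in> V" for x x'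
      using that lpres.cls_eq_iff by (auto simp: V_def)
    show "set (map ?w bl) \<subseteq> V" using homog_word bl by (auto simp: V_def)
    show "\<exists>s. x - (\<Sum>i<length (map ?w bl). s i \<bullet> (map ?w bl ! i)) \<in> {0}" if xV: "x \<in> V" for x
    proof -
      obtain f where f: "f \<in> homog (\<lambda>_. True) n" "x = ev gl f" using xV by (auto simp: V_def)
      obtain h where h: "h \<in> fa.span (lam.words n)" "f - h \<in> Idl\<^bsub>free_algebra\<^esub> (form_rels q gen)"
        by (rule lam.spn_decomp[OF lambda_homog_spn[OF f(1)]])
      obtain g where g: "h = (\<Sum>t\<in>bits n. scal (g t) * form_word gen t)"
        using h(1) unfolding lam.words_def fa.span_family[OF finite_bits] by blast
      have "x = ev gl h" using ev_lambda_ideal[OF h(2)] f by (simp add: ev_diff)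
      also have "\<dots> = (\<Sum>t\<in>set bl. g t \<bullet> ?w t)" by (simp add: g bl ev_sum ev_scale)
      also have "\<dots> = (\<Sum>i<length bl. g (bl ! i) \<bullet> ?w (bl ! i))" by (rule sum_list_nth[OF bl(1)])
      finally show ?thesis by (intro exI[of _ "\<lambda>i. g (bl ! i)"]) simp
    qed
    fix s i assume s: "(\<Sum>i<length (map ?w bl). s i \<bullet> (map ?w bl ! i)) \<in> {0}" and i: "i < length (map ?w bl)"
    define g where "g u = s (THE i. i < length bl \<and> bl ! i = u)" for u
    have g: "g (bl ! i) = s i" if "i < length bl" for i
    proof -
      have "(THE j. j < length bl \<and> bl ! j = bl ! i) = i"
        using that bl(1) by (intro the_equality) (auto simp: nth_eq_iff_index_eq)
      then show ?thesis by (simp add: g_def)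
    qed
    have "(\<Sum>t\<in>set bl. g t \<bullet> ?w t) = 0"
      unfolding sum_list_nth[OF bl(1)] using s g by simp
    then have "g (bl ! i) = 0" by (rule gl_indep) (use i in simp)
    then show "s i = 0" using g i by simp
  qed
  moreover have "length (map (cls gl) (map ?w bl)) = card (bits n)"
    using bl distinct_card[of bl] by simp
  ultimately show ?thesis unfolding has_dim_def by blast
qed

section \<open>The stated dimensions and bases\<close>

lemma cohomology_dims:
  "has_dim (cohomology q r 0) 1" "has_dim (cohomology q r 1) 4" "has_dim (cohomology q r 2) 6"
  "has_dim (cohomology q r 3) 4" "has_dim (cohomology q r 4) 1"
  using cohomology_dim[of 0] cohomology_dim[of 1] cohomology_dim[of 2] cohomology_dim[of 3] cohomology_dim[of 4]
  unfolding bits_lists by (simp_all add: eval_nat_numeral)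

lemma cohomology_basis_2:
  "cohomology_basis q r 2
    [xf B * xf D * xc A * xc C ^ (r - 1),
     xf A * xf B * xc A * xc C ^ (r - 1),
     xf A * xf C * xc A ^ (r - 1) * xc B ^ (r - 1),
     xf C * xf D * xc A ^ (r - 1) * xc B ^ (r - 1),
     (xf A * xf C - xf C * xf D) * xc A ^ (r - 1) * xc C - xf A * xf D,
     xf B * xf D * xc A * xc B ^ (r - 1) * xc C ^ (r - 2)
       + scal (q ^ 4) * xf C * xf D * xc A ^ (r - 1) * xc B ^ (r - 2) * xc C ^ (r - 1)]"
  by (rule cohomology_basisI[OF _ bits_lists(3)[symmetric]], simp, simp only: list.map ev_reps2 ev_rep_m5 ev_rep_m6)

lemma cohomology_basis_3:
  "cohomology_basis q r 3
    [xf B * xf C * xf D * xc B ^ (r - 1) * xc C ^ (r - 1),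
     xf A * xf B * xf D * xc A * xc C ^ (r - 1),
     xf A * xf C * xf D * xc A ^ (r - 1) * xc B ^ (r - 1),
     xf A * xf B * xf D * xc A * xc B ^ (r - 1) * xc C ^ (r - 2)
       + scal (q ^ 4) * xf A * xf C * xf D * xc A ^ (r - 1) * xc B ^ (r - 2) * xc C ^ (r - 1)]"
  by (rule cohomology_basisI[OF _ bits_lists(4)[symmetric]], simp, simp only: list.map ev_reps3 ev_rep_s)

lemma cohomology_basis_4:
  "cohomology_basis q r 4 [xf A * xf B * xf C * xf D * xc B ^ (r - 1) * xc C ^ (r - 1)]"
  by (rule cohomology_basisI[OF _ bits_lists(5)[symmetric]], simp, simp only: list.map ev_reps3)

end

theorem proposition3p4:
  fixes r :: nat and q :: complex
  assumes "r \<in> {3, 5, 7}"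
    and "q ^ r = 1" and "\<forall>k. 0 < k \<and> k < r \<longrightarrow> q ^ k \<noteq> 1"
  shows
    "(\<forall>i. \<exists>n. has_dim (Lambda_part q i) n \<and> has_dim (cohomology q r i) n) \<and>
     has_dim (cohomology q r 0) 1 \<and>
     has_dim (cohomology q r 1) 4 \<and>
     has_dim (cohomology q r 2) 6 \<and>
     has_dim (cohomology q r 3) 4 \<and>
     has_dim (cohomology q r 4) 1 \<and>
     (let a = gen (Coord A); b = gen (Coord B); c = gen (Coord C);
          ea = gen (Form A); eb = gen (Form B); ec = gen (Form C); ed = gen (Form D)
      in
        cohomology_basis q r 2
          [eb * ed * a * c ^ (r - 1),
           ea * eb * a * c ^ (r - 1),
           ea * ec * a ^ (r - 1) * b ^ (r - 1),
           ec * ed * a ^ (r - 1) * b ^ (r - 1),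
           (ea * ec - ec * ed) * a ^ (r - 1) * c - ea * ed,
           eb * ed * a * b ^ (r - 1) * c ^ (r - 2)
             + scal (q ^ 4) * ec * ed * a ^ (r - 1) * b ^ (r - 2) * c ^ (r - 1)] \<and>
        cohomology_basis q r 3
          [eb * ec * ed * b ^ (r - 1) * c ^ (r - 1),
           ea * eb * ed * a * c ^ (r - 1),
           ea * ec * ed * a ^ (r - 1) * b ^ (r - 1),
           ea * eb * ed * a * b ^ (r - 1) * c ^ (r - 2)
             + scal (q ^ 4) * ea * ec * ed * a ^ (r - 1) * b ^ (r - 2) * c ^ (r - 1)] \<and>
        cohomology_basis q r 4
          [ea * eb * ec * ed * b ^ (r - 1) * c ^ (r - 1)])"
proof -
  interpret root_calculus q r
    using assms by unfold_locales auto
  \<comment> \<open>The common dimension in degree \<open>i\<close> is \<open>card (bits i)\<close>,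
    which is 0 above degree 4.\<close>
  show ?thesis
    unfolding Let_def
    using Lambda_dim cohomology_dim by (intro conjI allI cohomology_dims cohomology_basis_2 cohomology_basis_3 cohomology_basis_4) blast
qed

end
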